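(* Let $q\in[1,2)$, and let $f_q(u)=|u|^{q-2}u$ if $q\in(1,2)$ (with $f_q(0)=0$) and $f_q(u)=\operatorname{sgn}(u)$ if $q=1$ (with $\operatorname{sgn}(0)=0$). Define $\phi(x):=\psi(|x|)$ for $x\in\mathbb{R}^n\setminus\{0\}$, where for $r>0$ $$\psi(r)=-\ln(r)+\frac1{10}\left(\ln(r)\arctan(\ln(r))-\frac12\ln(1+\ln^2(r))\right).$$ Then there exist constants $\tau_0>1$ and $C>1$, depending only on $n$ and $q$, such that the following holds. Let $r_1\in(0,1/2)$, let $g\in L^2(\mathbb{R}^n)$ and let $u\in H^1_{loc}(\mathbb{R}^n)\cap L^\infty_{loc}(\mathbb{R}^n)$ be a (real-valued, weak) solution of $$\Delta u+f_q(u)=g\quad\text{in }\mathbb{R}^n$$ with support contained in $B_1\setminus\overline{B_{r_1}}$. Then for all $\tau\ge\tau_0$ $$\tau^{3/2}\left\|e^{\tau\phi}(1+\ln^2(|x|))^{-1/2}u\right\|_{L^2(\mathbb{R}^n)}+\tau^{1/2}\left\|e^{\tau\phi}|x|(1+\ln^2(|x|))^{-1/2}\nabla u\right\|_{L^2(\mathbb{R}^n)}+\left(\frac{2-q}{q}\right)^{1/2}\tau\left\|e^{\tau\phi}|x||u|^{\frac q2}\right\|_{L^2(\mathbb{R}^n)}\le C\left\|e^{\tau\phi}|x|^2g\right\|_{L^2(\mathbb{R}^n)}.$$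
   Context: $B_r$ denotes the open ball of radius $r$ centered at $0$ in $\mathbb{R}^n$. Weak solution means that $-\int\nabla u\cdot\nabla\xi\,dx+\int f_q(u)\xi\,dx=\int g\,\xi\,dx$ for all compactly supported $\xi\in H^1(\mathbb{R}^n)\cap L^\infty(\mathbb{R}^n)$. *)

theory Defs
  imports "HOL-Analysis.Analysis"
begin

(* All function spaces are with respect to Lebesgue measure on the whole space.  The L2 norm is
   extended-valued, so that no inequality between norms can hold through a junk value. *)

definition L2_norm :: "('a::euclidean_space \<Rightarrow> 'b::euclidean_space) \<Rightarrow> ennreal" where
  "L2_norm f =
     (let N = (\<integral>\<^sup>+ x. ennreal ((norm (f x))\<^sup>2) \<partial>lebesgue)
      in if N = \<infinity> then \<infinity> else ennreal (sqrt (enn2real N)))"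

definition in_L2 :: "('a::euclidean_space \<Rightarrow> 'b::euclidean_space) \<Rightarrow> bool" where
  "in_L2 f \<longleftrightarrow> f \<in> borel_measurable lebesgue \<and> L2_norm f < \<infinity>"

definition in_L2_loc :: "('a::euclidean_space \<Rightarrow> 'b::euclidean_space) \<Rightarrow> bool" where
  "in_L2_loc f \<longleftrightarrow> f \<in> borel_measurable lebesgue \<and>
     (\<forall>K. compact K \<longrightarrow> L2_norm (\<lambda>x. indicator K x *\<^sub>R f x) < \<infinity>)"

definition in_Linf :: "('a::euclidean_space \<Rightarrow> real) \<Rightarrow> bool" where
  "in_Linf f \<longleftrightarrow> f \<in> borel_measurable lebesgue \<and> (\<exists>M. AE x in lebesgue. \<bar>f x\<bar> \<le> M)"

definition in_Linf_loc :: "('a::euclidean_space \<Rightarrow> real) \<Rightarrow> bool" where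
  "in_Linf_loc f \<longleftrightarrow> f \<in> borel_measurable lebesgue \<and>
     (\<forall>K. compact K \<longrightarrow> (\<exists>M. AE x in lebesgue. x \<in> K \<longrightarrow> \<bar>f x\<bar> \<le> M))"

(* The support of an almost-everywhere class: the complement of the largest open set on which
   f vanishes almost everywhere. *)

definition ess_support :: "('a::euclidean_space \<Rightarrow> real) \<Rightarrow> 'a set" where
  "ess_support f = - \<Union>{U. open U \<and> (AE x in lebesgue. x \<in> U \<longrightarrow> f x = 0)}"

(* The class of C-infinity functions, as the largest class of differentiable functions that is
   closed under taking partial derivatives. *)

coinductive smooth :: "('a::euclidean_space \<Rightarrow> real) \<Rightarrow> bool" where
  "(\<And>x. GDERIV f x :> G x) \<Longrightarrow> (\<And>b. b \<in> Basis \<Longrightarrow> smooth (\<lambda>x. G x \<bullet> b)) \<Longrightarrow> smooth f"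

(* has_weak_gradient is a relation because the weak gradient is only determined almost
   everywhere; V may be any of its representatives. *)

definition has_weak_gradient ::
    "('a::euclidean_space \<Rightarrow> real) \<Rightarrow> ('a \<Rightarrow> 'a) \<Rightarrow> bool" where
  "has_weak_gradient u V \<longleftrightarrow>
     (\<forall>K. compact K \<longrightarrow> set_integrable lebesgue K u \<and> set_integrable lebesgue K V) \<and>
     (\<forall>\<eta> G. smooth \<eta> \<longrightarrow> compact (closure {x. \<eta> x \<noteq> 0}) \<longrightarrow> (\<forall>x. GDERIV \<eta> x :> G x) \<longrightarrow>
        (\<integral>x. u x *\<^sub>R G x \<partial>lebesgue) = - (\<integral>x. \<eta> x *\<^sub>R V x \<partial>lebesgue))"

definition in_H1 :: "('a::euclidean_space \<Rightarrow> real) \<Rightarrow> ('a \<Rightarrow> 'a) \<Rightarrow> bool" where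
  "in_H1 u Du \<longleftrightarrow> in_L2 u \<and> in_L2 Du \<and> has_weak_gradient u Du"

definition in_H1_loc :: "('a::euclidean_space \<Rightarrow> real) \<Rightarrow> ('a \<Rightarrow> 'a) \<Rightarrow> bool" where
  "in_H1_loc u Du \<longleftrightarrow> in_L2_loc u \<and> in_L2_loc Du \<and> has_weak_gradient u Du"

(* For q > 1 the value at 0 is 0. *)

definition fq :: "real \<Rightarrow> real \<Rightarrow> real" where
  "fq q s = (if q = 1 then sgn s else \<bar>s\<bar> powr (q - 2) * s)"

definition weak_solution ::
    "real \<Rightarrow> ('a::euclidean_space \<Rightarrow> real) \<Rightarrow> ('a \<Rightarrow> real) \<Rightarrow> ('a \<Rightarrow> 'a) \<Rightarrow> bool" where
  "weak_solution q g u Du \<longleftrightarrow>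
     (\<forall>\<xi> D\<xi>. in_H1 \<xi> D\<xi> \<longrightarrow> in_Linf \<xi> \<longrightarrow> compact (ess_support \<xi>) \<longrightarrow>
        - (\<integral>x. Du x \<bullet> D\<xi> x \<partial>lebesgue) + (\<integral>x. fq q (u x) * \<xi> x \<partial>lebesgue)
          = (\<integral>x. g x * \<xi> x \<partial>lebesgue))"

definition carleman_psi :: "real \<Rightarrow> real" where
  "carleman_psi r =
     - ln r + 1/10 * (ln r * arctan (ln r) - 1/2 * ln (1 + (ln r)\<^sup>2))"

(* The value at the origin, a null set, is irrelevant. *)

definition carleman_phi :: "'a::euclidean_space \<Rightarrow> real" where
  "carleman_phi x = carleman_psi (norm x)"

end

theory Submission
  imports Defs
begin

text \<open>Put \<open>t = ln |x|\<close>, \<open>e = x \<bullet> \<nabla>u\<close> and \<open>p = - (\<tau> \<psi>'(t) + 1)\<close>, which is comparable to \<open>\<tau>\<close> on the unit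
  ball, and conjugate the equation by \<open>exp (\<tau> \<psi> + n t / 2)\<close>. The equation is tested with
  the antisymmetric part \<open>2 p \<partial>\<^sub>t v + p' v\<close> of the conjugated operator. Its commutator with the symmetric
  part is positive, because \<open>p' < 0\<close>, and controls \<open>\<tau>\<^sup>3 v\<^sup>2 / (1 + t\<^sup>2)\<close>; since \<open>q < 2\<close>, the sublinear term contributes
  a further positive term \<open>(2 - q) / q \<tau>\<^sup>2 |x|\<^sup>2 |u|\<^sup>q\<close>. Testing with \<open>- p' v\<close> then recovers the full gradient.
  In the original variables everything reduces to four integral identities with radial coefficients: an
  energy identity, a Rellich identity, and the chain rule for \<open>u\<^sup>2\<close> and for \<open>|u|\<^sup>q\<close>. The test function
  \<open>x \<bullet> \<nabla>u\<close> is not admissible for a weak solution, so the identities are proved for mollified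
  solutions and then pass to the limit in \<open>L\<^sup>2\<close>.\<close>

section \<open>Square-integrable functions\<close>

text \<open>The weight \<open>- ln r\<close> alone makes \<open>p\<close> constant, and the
  commutator, all of whose terms carry a derivative of \<open>p\<close>, then vanishes. The
  arctangent correction gives \<open>p' = - \<tau> / (10 (1 + t^2))\<close>: this is the origin of
  the factor \<open>(1 + ln^2 |x|)^(-1/2)\<close>, and the product of \<open>- p'\<close> and
  \<open>p^2\<close> is the origin of the power 3/2 of \<tau>. With \<open>a = (2 - q) / q\<close>
  one has \<open>1 / q = (1 + a) / 2\<close>. At a = 0 the terms of order \<open>p^2\<close> in
  front of |u|^q would cancel, so the gain \<open>a \<tau>^2\<close> is due to the excess a / 2
  alone, and \<tau> must exceed 2 / a + n up to a constant for this gain to absorb the terms of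
  order \<open>p\<close>. Pairing \<open>x \<bullet> \<nabla>u\<close> with the equation produces
  second derivatives, of which only the trace is known to lie in L^2. The identities are therefore
  arranged so that only the trace occurs. Since \<open>f_q\<close> is not Lipschitz at 0 and jumps
  there for q = 1, its chain rule is proved for powers of \<open>s^2 + \<delta>\<close>; \<delta>
  tends to 0 only after the mollification limit. Translations and Fubini require Borel functions, so
  the data are replaced by Borel representatives at the end.\<close>

definition sq_integrable :: "('a::euclidean_space \<Rightarrow> real) \<Rightarrow> bool" where
  "sq_integrable f \<longleftrightarrow> f \<in> borel_measurable borel \<and> integrable lborel (\<lambda>x. (f x)\<^sup>2)"

lemma sq_integrable_measurable [measurable_dest]: "sq_integrable f \<Longrightarrow> f \<in> borel_measurable borel"
  by (simp add: sq_integrable_def)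

lemma sq_integrable_mult:
  assumes f: "sq_integrable f" and g: "sq_integrable g"
  shows "integrable lborel (\<lambda>x. f x * g x)"
proof (rule Bochner_Integration.integrable_bound)
  show "integrable lborel (\<lambda>x. (f x)\<^sup>2 + (g x)\<^sup>2)"
    using assms by (auto simp: sq_integrable_def)
  show "(\<lambda>x. f x * g x) \<in> borel_measurable lborel"
    using assms by (auto simp: sq_integrable_def)
  show "AE x in lborel. norm (f x * g x) \<le> norm ((f x)\<^sup>2 + (g x)\<^sup>2)"
  proof (rule AE_I2)
    fix x
    have "2 * (\<bar>f x\<bar> * \<bar>g x\<bar>) \<le> (f x)\<^sup>2 + (g x)\<^sup>2"
      using sum_squares_bound[of "\<bar>f x\<bar>" "\<bar>g x\<bar>"] by simp
    moreover have "0 \<le> \<bar>f x\<bar> * \<bar>g x\<bar>" by simp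
    ultimately show "norm (f x * g x) \<le> norm ((f x)\<^sup>2 + (g x)\<^sup>2)"
      unfolding real_norm_def abs_mult by linarith
  qed
qed

lemma sq_integrable_bounded_mult:
  assumes f: "sq_integrable f" and a: "a \<in> borel_measurable borel" "\<And>x. \<bar>a x\<bar> \<le> B"
  shows "sq_integrable (\<lambda>x. a x * f x)"
  unfolding sq_integrable_def
proof
  show "(\<lambda>x. a x * f x) \<in> borel_measurable borel" using assms by measurable
  show "integrable lborel (\<lambda>x. (a x * f x)\<^sup>2)"
  proof (rule Bochner_Integration.integrable_bound)
    show "integrable lborel (\<lambda>x. B\<^sup>2 * (f x)\<^sup>2)"
      using f by (auto simp: sq_integrable_def)
    show "(\<lambda>x. (a x * f x)\<^sup>2) \<in> borel_measurable lborel" using assms by measurable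
    have "\<bar>a x\<bar>\<^sup>2 \<le> B\<^sup>2" for x using a(2)[of x] by (intro power_mono) auto
    then show "AE x in lborel. norm ((a x * f x)\<^sup>2) \<le> norm (B\<^sup>2 * (f x)\<^sup>2)"
      by (auto simp: power_mult_distrib intro!: mult_right_mono)
  qed
qed

lemma sq_integrable_cmult: "sq_integrable f \<Longrightarrow> sq_integrable (\<lambda>x. c * f x)"
  by (rule sq_integrable_bounded_mult[where B = "\<bar>c\<bar>"]) auto

lemma sq_integrable_indicator:
  "sq_integrable f \<Longrightarrow> A \<in> sets borel \<Longrightarrow> sq_integrable (\<lambda>x. indicator A x * f x)"
  by (rule sq_integrable_bounded_mult[where B = 1]) (auto simp: indicator_def)

lemma sq_integrable_add:
  assumes f: "sq_integrable f" and g: "sq_integrable g"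
  shows "sq_integrable (\<lambda>x. f x + g x)"
  using sq_integrable_mult[OF f g] assms
  by (auto simp: sq_integrable_def power2_sum mult.assoc)

lemma sq_integrable_diff:
  assumes "sq_integrable f" and "sq_integrable g"
  shows "sq_integrable (\<lambda>x. f x - g x)"
  using sq_integrable_add[OF assms(1) sq_integrable_cmult[OF assms(2), of "-1"]] by simp

lemma sq_integrable_sum:
  "finite I \<Longrightarrow> (\<And>i. i \<in> I \<Longrightarrow> sq_integrable (f i)) \<Longrightarrow> sq_integrable (\<lambda>x. \<Sum>i\<in>I. f i x)"
  by (induction I rule: finite_induct) (auto simp: sq_integrable_add sq_integrable_def[of "\<lambda>x. 0"])

lemma sq_integrable_abs: "sq_integrable f \<Longrightarrow> sq_integrable (\<lambda>x. \<bar>f x\<bar>)"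
  by (auto simp: sq_integrable_def)

lemma sq_integrable_bound:
  assumes f: "sq_integrable f" and "g \<in> borel_measurable borel" "\<And>x. \<bar>g x\<bar> \<le> f x"
  shows "sq_integrable g"
  unfolding sq_integrable_def
proof
  show "integrable lborel (\<lambda>x. (g x)\<^sup>2)"
  proof (rule Bochner_Integration.integrable_bound)
    show "integrable lborel (\<lambda>x. (f x)\<^sup>2)" using f by (simp add: sq_integrable_def)
    have "(g x)\<^sup>2 \<le> (f x)\<^sup>2" for x using power_mono[OF assms(3)[of x], of 2] by simp
    then show "AE x in lborel. norm ((g x)\<^sup>2) \<le> norm ((f x)\<^sup>2)" by simp
  qed (use assms in measurable)
qed fact

text \<open>The integral of \<open>(s |f| - |g|)^2\<close> is a nonnegative quadratic polynomial in
  s.\<close>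

lemma sq_integrable_Cauchy_Schwarz:
  assumes f: "sq_integrable f" and g: "sq_integrable g"
  shows "(LBINT x. \<bar>f x * g x\<bar>)\<^sup>2 \<le> (LBINT x. (f x)\<^sup>2) * (LBINT x. (g x)\<^sup>2)"
proof -
  define a b c where "a = (LBINT x. (f x)\<^sup>2)" and "b = (LBINT x. \<bar>f x * g x\<bar>)"
    and "c = (LBINT x. (g x)\<^sup>2)"
  have i: "integrable lborel (\<lambda>x. (f x)\<^sup>2)" "integrable lborel (\<lambda>x. (g x)\<^sup>2)"
    using f g by (auto simp: sq_integrable_def)
  have ifg: "integrable lborel (\<lambda>x. \<bar>f x * g x\<bar>)" using sq_integrable_mult[OF f g] by simp
  have a0: "a \<ge> 0" by (simp add: a_def)
  have q: "a * s\<^sup>2 - 2 * s * b + c \<ge> 0" for s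
  proof -
    have "0 \<le> (LBINT x. (s * \<bar>f x\<bar> - \<bar>g x\<bar>)\<^sup>2)" by simp
    also have "\<dots> = (LBINT x. s\<^sup>2 * (f x)\<^sup>2 - 2 * s * \<bar>f x * g x\<bar> + (g x)\<^sup>2)"
      by (rule Bochner_Integration.integral_cong) (auto simp: power2_diff power_mult_distrib abs_mult)
    also have "\<dots> = s\<^sup>2 * a - 2 * s * b + c"
      using i ifg by (simp add: a_def b_def c_def)
    finally show ?thesis by (simp add: mult.commute)
  qed
  have "b\<^sup>2 \<le> a * c"
  proof (cases "a = 0")
    case True
    have "b = 0"
    proof (rule ccontr)
      assume "b \<noteq> 0"
      \<comment> \<open>For a = 0 the polynomial is affine in s, and at this s it equals -1.\<close>
      then show False using q[of "(c + 1) / (2 * b)"] True by simp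
    qed
    then show ?thesis using True by simp
  next
    case False
    then have "a > 0" using a0 by simp
    \<comment> \<open>\<open>b / a\<close> is the minimiser of the polynomial.\<close>
    then show ?thesis using q[of "b / a"]
      by (auto simp: field_simps power2_eq_square split: if_splits)
  qed
  then show ?thesis by (simp add: a_def b_def c_def)
qed

lemma sq_integrable_Cauchy_Schwarz':
  assumes f: "sq_integrable f" and g: "sq_integrable g" and a: "a \<in> borel_measurable borel"
    and B: "\<And>x. \<bar>a x\<bar> \<le> B"
  shows "\<bar>\<integral>x. a x * (f x * g x) \<partial>lborel\<bar>
    \<le> B * sqrt ((LBINT x. (f x)\<^sup>2) * (LBINT x. (g x)\<^sup>2))"
proof -
  have i: "integrable lborel (\<lambda>x. \<bar>f x * g x\<bar>)" using sq_integrable_mult[OF f g] by simp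
  have B0: "B \<ge> 0" using B[of undefined] by linarith
  have "\<bar>\<integral>x. a x * (f x * g x) \<partial>lborel\<bar> \<le> (LBINT x. \<bar>a x * (f x * g x)\<bar>)"
    by simp
  also have "\<dots> \<le> (LBINT x. B * \<bar>f x * g x\<bar>)"
  proof (rule integral_mono)
    show "integrable lborel (\<lambda>x. \<bar>a x * (f x * g x)\<bar>)"
      using sq_integrable_mult[OF sq_integrable_bounded_mult[OF f a B] g] by (simp add: mult.assoc)
    show "integrable lborel (\<lambda>x. B * \<bar>f x * g x\<bar>)" using i by simp
    show "\<bar>a x * (f x * g x)\<bar> \<le> B * \<bar>f x * g x\<bar>" for x
      using B[of x] by (auto simp: abs_mult intro!: mult_right_mono)
  qed
  also have "\<dots> = B * (LBINT x. \<bar>f x * g x\<bar>)" by simp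
  also have "\<dots> \<le> B * sqrt ((LBINT x. (f x)\<^sup>2) * (LBINT x. (g x)\<^sup>2))"
    using B0 sq_integrable_Cauchy_Schwarz[OF f g] by (intro mult_left_mono real_le_rsqrt) auto
  finally show ?thesis .
qed

lemma tendsto_zero_le:
  fixes a b :: "nat \<Rightarrow> real"
  assumes "\<And>n. 0 \<le> a n" and "\<And>n. a n \<le> b n" and "b \<longlonglongrightarrow> 0"
  shows "a \<longlonglongrightarrow> 0"
  using assms(3) by (rule Lim_null_comparison[rotated]) (simp add: assms)

section \<open>Strong convergence in L^2 and its compatibility with products and
  compositions\<close>

definition L2_tendsto :: "(nat \<Rightarrow> 'a::euclidean_space \<Rightarrow> real) \<Rightarrow> ('a \<Rightarrow> real) \<Rightarrow> bool" where
  "L2_tendsto F f \<longleftrightarrow> (\<forall>k. sq_integrable (F k)) \<and> sq_integrable f \<and>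
     (\<lambda>k. LBINT x. (F k x - f x)\<^sup>2) \<longlonglongrightarrow> 0"

lemma L2_tendstoD:
  assumes "L2_tendsto F f"
  shows "sq_integrable (F k)" "sq_integrable f" "(\<lambda>k. LBINT x. (F k x - f x)\<^sup>2) \<longlonglongrightarrow> 0"
  using assms by (auto simp: L2_tendsto_def)

text \<open>Every term of the integral identities that is a product of two L^2 factors passes to the
  limit through this lemma; \<open>a\<close> is the bounded coefficient in front of them.\<close>

lemma L2_tendsto_mult:
  assumes F: "L2_tendsto F f" and G: "L2_tendsto G g" and a: "a \<in> borel_measurable borel"
    and B: "\<And>x. \<bar>a x\<bar> \<le> B"
  shows "(\<lambda>k. LBINT x. a x * (F k x * G k x)) \<longlonglongrightarrow> (LBINT x. a x * (f x * g x))"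
proof -
  note sF = L2_tendstoD(1)[OF F] and sf = L2_tendstoD(2)[OF F] and tF = L2_tendstoD(3)[OF F]
  note sG = L2_tendstoD(1)[OF G] and sg = L2_tendstoD(2)[OF G] and tG = L2_tendstoD(3)[OF G]
  have ia: "integrable lborel (\<lambda>x. a x * (p x * r x))" if "sq_integrable p" "sq_integrable r" for p r
    using sq_integrable_mult[OF sq_integrable_bounded_mult[OF that(1) a B] that(2)]
    by (simp add: mult.assoc)
  define d e where "d k = (LBINT x. (F k x - f x)\<^sup>2)" and "e k = (LBINT x. (G k x - g x)\<^sup>2)"
    for k
  define M N where "M = (LBINT x. (f x)\<^sup>2)" and "N = (LBINT x. (g x)\<^sup>2)"
  have d: "d \<longlonglongrightarrow> 0" and e: "e \<longlonglongrightarrow> 0" using tF tG by (auto simp: d_def[abs_def] e_def[abs_def])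
  have bd: "\<bar>(LBINT x. a x * (F k x * G k x)) - (LBINT x. a x * (f x * g x))\<bar>
     \<le> B * sqrt (d k * e k) + B * sqrt (d k * N) + B * sqrt (M * e k)" for k
  proof -
    let ?F = "\<lambda>x. F k x - f x" and ?G = "\<lambda>x. G k x - g x"
    have s: "sq_integrable ?F" "sq_integrable ?G" using sF sf sG sg by (auto intro: sq_integrable_diff)
    have "(LBINT x. a x * (F k x * G k x)) - (LBINT x. a x * (f x * g x))
       = (LBINT x. a x * (F k x * G k x) - a x * (f x * g x))"
      using ia[OF sF sG] ia[OF sf sg] by simp
    \<comment> \<open>The difference of the products is split so that each summand contains a factor
      F - f or G - g, on which Cauchy-Schwarz gives a null sequence.\<close>
    also have "\<dots> = (LBINT x. a x * (?F x * ?G x) + a x * (?F x * g x) + a x * (f x * ?G x))"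
      by (rule Bochner_Integration.integral_cong) (auto simp: algebra_simps)
    also have "\<dots> = (LBINT x. a x * (?F x * ?G x)) + (LBINT x. a x * (?F x * g x))
        + (LBINT x. a x * (f x * ?G x))"
      using ia[OF s] ia[OF s(1) sg] ia[OF sf s(2)] by (simp del: right_diff_distrib left_diff_distrib)
    finally show ?thesis
      using sq_integrable_Cauchy_Schwarz'[OF s a B] sq_integrable_Cauchy_Schwarz'[OF s(1) sg a B]
        sq_integrable_Cauchy_Schwarz'[OF sf s(2) a B] unfolding d_def e_def M_def N_def by linarith
  qed
  have "(\<lambda>k. B * sqrt (d k * e k) + B * sqrt (d k * N) + B * sqrt (M * e k)) \<longlonglongrightarrow>
      B * sqrt (0 * 0) + B * sqrt (0 * N) + B * sqrt (M * 0)"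
    by (intro tendsto_intros d e)
  then have "(\<lambda>k. B * sqrt (d k * e k) + B * sqrt (d k * N) + B * sqrt (M * e k)) \<longlonglongrightarrow> 0" by simp
  then have "(\<lambda>k. (LBINT x. a x * (F k x * G k x)) - (LBINT x. a x * (f x * g x))) \<longlonglongrightarrow> 0"
    by (rule Lim_null_comparison[rotated]) (use bd in auto)
  then show ?thesis by (simp add: LIM_zero_iff)
qed

lemma L2_tendsto_comparison:
  assumes "\<And>k. sq_integrable (F k)" and "sq_integrable f"
    and le: "\<And>k x. (F k x - f x)\<^sup>2 \<le> d k x" and d: "\<And>k. integrable lborel (d k)"
    and lim: "(\<lambda>k. LBINT x. d k x) \<longlonglongrightarrow> 0"
  shows "L2_tendsto F f"
proof -
  have "(LBINT x. (F k x - f x)\<^sup>2) \<le> (LBINT x. d k x)" for k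
    using order_trans[OF zero_le_power2 le] by (intro integral_mono' d le) auto
  then have "(\<lambda>k. LBINT x. (F k x - f x)\<^sup>2) \<longlonglongrightarrow> 0"
    using lim by (intro tendsto_zero_le[of "\<lambda>k. LBINT x. (F k x - f x)\<^sup>2"]) auto
  with assms(1,2) show ?thesis by (simp add: L2_tendsto_def)
qed

lemma L2_tendsto_distance:
  assumes "L2_tendsto F f"
  shows "integrable lborel (\<lambda>x. c * (F k x - f x)\<^sup>2)" "(\<lambda>k. LBINT x. c * (F k x - f x)\<^sup>2) \<longlonglongrightarrow> 0"
  using sq_integrable_diff[OF L2_tendstoD(1,2)[OF assms]] tendsto_mult_right_zero[OF L2_tendstoD(3)[OF assms], of c]
  by (auto simp: sq_integrable_def)

lemma L2_tendsto_bounded_mult: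
  assumes F: "L2_tendsto F f" and a: "a \<in> borel_measurable borel" and B: "\<And>x. \<bar>a x\<bar> \<le> B"
  shows "L2_tendsto (\<lambda>k x. a x * F k x) (\<lambda>x. a x * f x)"
proof (rule L2_tendsto_comparison[OF _ _ _ L2_tendsto_distance[OF F]])
  show "(a x * F k x - a x * f x)\<^sup>2 \<le> B\<^sup>2 * (F k x - f x)\<^sup>2" for k x
    unfolding right_diff_distrib[symmetric] power_mult_distrib
    using power_mono[OF B[of x], of 2] by (intro mult_right_mono) auto
qed (intro sq_integrable_bounded_mult[OF _ a B] L2_tendstoD[OF F])+

lemma L2_tendsto_add:
  assumes F: "L2_tendsto F f" and G: "L2_tendsto G g"
  shows "L2_tendsto (\<lambda>k x. F k x + G k x) (\<lambda>x. f x + g x)"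
proof (rule L2_tendsto_comparison)
  show "(F k x + G k x - (f x + g x))\<^sup>2 \<le> 2 * (F k x - f x)\<^sup>2 + 2 * (G k x - g x)\<^sup>2" for k x
    using sum_squares_bound[of "F k x - f x" "G k x - g x"] by (simp add: power2_eq_square algebra_simps)
  show "integrable lborel (\<lambda>x. 2 * (F k x - f x)\<^sup>2 + 2 * (G k x - g x)\<^sup>2)" for k
    by (intro Bochner_Integration.integrable_add L2_tendsto_distance F G)
  then show "(\<lambda>k. LBINT x. 2 * (F k x - f x)\<^sup>2 + 2 * (G k x - g x)\<^sup>2) \<longlonglongrightarrow> 0"
    using tendsto_add[OF L2_tendsto_distance(2)[OF F, of 2] L2_tendsto_distance(2)[OF G, of 2]]
    by (subst Bochner_Integration.integral_add[OF L2_tendsto_distance(1)[OF F] L2_tendsto_distance(1)[OF G]]) simp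
qed (intro sq_integrable_add L2_tendstoD[OF F] L2_tendstoD[OF G])+

lemma L2_tendsto_zero: "L2_tendsto (\<lambda>k x. 0) (\<lambda>x. 0)"
  by (simp add: L2_tendsto_def sq_integrable_def)

lemma L2_tendsto_sum:
  "finite I \<Longrightarrow> (\<And>i. i \<in> I \<Longrightarrow> L2_tendsto (F i) (f i)) \<Longrightarrow>
    L2_tendsto (\<lambda>k x. \<Sum>i\<in>I. F i k x) (\<lambda>x. \<Sum>i\<in>I. f i x)"
  by (induction I rule: finite_induct) (auto simp: L2_tendsto_add L2_tendsto_zero)

text \<open>The condition \<open>\<phi> 0 = 0\<close> bounds \<open>\<phi> (f x)\<close> by a
  multiple of \<open>f x\<close>, which keeps the composition square-integrable over a space of
  infinite measure.\<close>

lemma L2_tendsto_Lipschitz: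
  assumes F: "L2_tendsto F f" and \<phi>: "\<phi> \<in> borel_measurable borel" "\<phi> 0 = 0"
    and L: "\<And>s t. \<bar>\<phi> s - \<phi> t\<bar> \<le> L * \<bar>s - t\<bar>"
  shows "L2_tendsto (\<lambda>k x. \<phi> (F k x)) (\<lambda>x. \<phi> (f x))"
proof (rule L2_tendsto_comparison[OF _ _ _ L2_tendsto_distance[OF F]])
  have s\<phi>: "sq_integrable (\<lambda>x. \<phi> (h x))" if "sq_integrable h" for h
  proof (rule sq_integrable_bound)
    show "sq_integrable (\<lambda>x. L * \<bar>h x\<bar>)" using that by (intro sq_integrable_cmult sq_integrable_abs)
    show "(\<lambda>x. \<phi> (h x)) \<in> borel_measurable borel" using that \<phi> by measurable
    show "\<bar>\<phi> (h x)\<bar> \<le> L * \<bar>h x\<bar>" for x using L[of "h x" 0] \<phi>(2) by simp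
  qed
  show "sq_integrable (\<lambda>x. \<phi> (F k x))" "sq_integrable (\<lambda>x. \<phi> (f x))" for k
    by (intro s\<phi> L2_tendstoD[OF F])+
  show "(\<phi> (F k x) - \<phi> (f x))\<^sup>2 \<le> L\<^sup>2 * (F k x - f x)\<^sup>2" for k x
    using power_mono[OF L[of "F k x" "f x"], of 2] by (simp add: power_mult_distrib)
qed

section \<open>Divergence theorem and continuity of translations\<close>

lemma lborel_integral_translation:
  fixes f :: "'a::euclidean_space \<Rightarrow> 'b::{banach, second_countable_topology}"
  assumes [measurable]: "f \<in> borel_measurable borel"
  shows "(LBINT x. f (c + x)) = (LBINT x. f x)"
proof -
  have "(LBINT x. f x) = (\<integral>x. f x \<partial>(distr lborel borel ((+) c)))"
    by (simp only: lborel_distr_plus)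
  also have "\<dots> = (LBINT x. f (c + x))"
    by (rule integral_distr) auto
  finally show ?thesis ..
qed

lemma lborel_integrable_translation:
  fixes f :: "'a::euclidean_space \<Rightarrow> 'b::{banach, second_countable_topology}"
  assumes "integrable lborel f"
  shows "integrable lborel (\<lambda>x. f (c + x))"
proof -
  have [measurable]: "f \<in> borel_measurable borel" using assms by auto
  have "integrable (distr lborel borel ((+) c)) f" using assms by (simp only: lborel_distr_plus)
  then show ?thesis by (subst (asm) integrable_distr_eq) auto
qed

lemma integrable_bounded_support:
  fixes f :: "'a::euclidean_space \<Rightarrow> real"
  assumes "f \<in> borel_measurable borel" and "\<And>x. \<bar>f x\<bar> \<le> M" and "\<And>x. R < norm x \<Longrightarrow> f x = 0"
  shows "integrable lborel f"
proof (rule Bochner_Integration.integrable_bound)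
  show "integrable lborel (\<lambda>x::'a. M * indicator (cball 0 R) x :: real)"
    by (intro integrable_mult_right integrable_real_indicator emeasure_bounded_finite bounded_cball) simp
  show "AE x in lborel. norm (f x) \<le> norm (M * indicator (cball 0 R) x :: real)"
  proof (rule AE_I2)
    fix x show "norm (f x) \<le> norm (M * indicator (cball 0 R) x :: real)"
      using assms(2)[of x] assms(3)[of x] by (cases "norm x \<le> R") (auto simp: indicator_def)
  qed
qed (use assms in simp)

text \<open>The difference quotients of \<open>f\<close> have integral zero by translation invariance.\<close>

lemma integral_derivative_compact_support:
  fixes f :: "'a::euclidean_space \<Rightarrow> real"
  assumes C: "compact C" and f0: "\<And>x. x \<notin> C \<Longrightarrow> f x = 0"
    and f': "\<And>x. x \<in> C \<Longrightarrow> (f has_derivative f' x) (at x)"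
    and cont: "continuous_on C (\<lambda>x. f' x b)"
  shows "(LBINT x. indicator C x * f' x b) = 0"
proof -
  define g where "g x = indicator C x * f' x b" for x
  have "closed C" using C by (rule compact_imp_closed)
  then have CB: "C \<in> sets borel" by simp
  have gm[measurable]: "g \<in> borel_measurable borel"
    using borel_measurable_continuous_on_indicator[OF CB cont] by (simp add: g_def[abs_def])
  obtain M where M: "\<And>x. x \<in> C \<Longrightarrow> \<bar>f' x b\<bar> \<le> M" and M0: "M \<ge> 0"
    using compact_imp_bounded[OF compact_continuous_image[OF cont C]]
    unfolding bounded_iff by (metis abs_ge_zero image_eqI order_trans real_norm_def abs_ge_self)
  have gM: "\<bar>g x\<bar> \<le> M" for x using M M0 by (auto simp: g_def indicator_def)
  \<comment> \<open>Off C the function vanishes on an open set. Hence \<open>g\<close>, the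
    derivative on C extended by 0, is the directional derivative at every point.\<close>
  have out: "(f has_derivative (\<lambda>_. 0)) (at x)" if "x \<notin> C" for x
  proof (rule has_derivative_transform_within_open)
    show "((\<lambda>_. 0) has_derivative (\<lambda>_. 0)) (at x)" by simp
    show "open (- C)" using \<open>closed C\<close> by auto
  qed (use that f0 in auto)
  have cf: "continuous_on UNIV f"
    unfolding continuous_on_eq_continuous_at[OF open_UNIV]
    using f' out has_derivative_continuous by blast
  then have fm[measurable]: "f \<in> borel_measurable borel" by (rule borel_measurable_continuous_onI)
  have line: "((\<lambda>t. f (x + t *\<^sub>R b)) has_real_derivative g (x + t *\<^sub>R b)) (at t)" for x t
  proof -
    have l: "((\<lambda>t. x + t *\<^sub>R b) has_derivative (\<lambda>t. t *\<^sub>R b)) (at t)"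
      by (auto intro!: derivative_eq_intros)
    show ?thesis
    proof (cases "x + t *\<^sub>R b \<in> C")
      case True
      have "((\<lambda>t. f (x + t *\<^sub>R b)) has_derivative (\<lambda>s. f' (x + t *\<^sub>R b) (s *\<^sub>R b))) (at t)"
        by (rule has_derivative_compose[OF l f'[OF True]])
      moreover have "f' (x + t *\<^sub>R b) (s *\<^sub>R b) = g (x + t *\<^sub>R b) * s" for s
        using True linear_scale[OF has_derivative_linear[OF f'[OF True]]] by (simp add: g_def)
      ultimately show ?thesis by (simp add: has_field_derivative_def)
    next
      case False
      have "((\<lambda>t. f (x + t *\<^sub>R b)) has_derivative (\<lambda>s. 0)) (at t)"
        by (rule has_derivative_compose[OF l out[OF False]])
      then show ?thesis using False by (simp add: g_def has_field_derivative_def lambda_zero)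
    qed
  qed
  define h where "h k = inverse (real (Suc k))" for k
  have h0: "h k > 0" and h1: "h k \<le> 1" for k by (auto simp: h_def field_simps)
  have hlim: "h \<longlonglongrightarrow> 0" unfolding h_def[abs_def] by (rule LIMSEQ_inverse_real_of_nat)
  define q where "q k x = (f (h k *\<^sub>R b + x) - f x) / h k" for k x
  obtain R where R: "\<And>x. x \<in> C \<Longrightarrow> norm x \<le> R"
    using compact_imp_bounded[OF C] by (auto simp: bounded_iff)
  \<comment> \<open>The mean value theorem on the segment bounds all difference quotients by
    \<open>M\<close>; since \<open>h k \<le> 1\<close>, they also vanish outside one fixed ball.
    Together this yields the dominating function.\<close>
  have qM: "\<bar>q k x\<bar> \<le> M" for k x
  proof -
    obtain z where "f (x + h k *\<^sub>R b) - f (x + 0 *\<^sub>R b) = (h k - 0) * g (x + z *\<^sub>R b)"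
      using MVT2[OF h0[of k], of "\<lambda>t. f (x + t *\<^sub>R b)" "\<lambda>t. g (x + t *\<^sub>R b)"] line by blast
    then have "q k x = g (x + z *\<^sub>R b)" using h0[of k] by (simp add: q_def add.commute)
    then show ?thesis using gM by simp
  qed
  have q0: "q k x = 0" if "R + norm b < norm x" for k x
  proof -
    have "norm (h k *\<^sub>R b) \<le> norm b" using h0[of k] h1[of k] by (simp add: mult_left_le_one_le)
    then have "norm x \<le> norm (h k *\<^sub>R b + x) + norm b"
      using norm_triangle_ineq4[of "h k *\<^sub>R b + x" "h k *\<^sub>R b"] by simp
    then have "R < norm (h k *\<^sub>R b + x)" using that by linarith
    moreover have "R < norm x" using that norm_ge_zero[of b] by linarith
    ultimately have "h k *\<^sub>R b + x \<notin> C" "x \<notin> C" using R by force+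
    then show ?thesis by (simp add: q_def f0)
  qed
  have fi: "integrable lborel f"
  proof -
    have "bounded (f ` C)"
      using compact_imp_bounded[OF compact_continuous_image[OF continuous_on_subset[OF cf] C]] by simp
    then obtain B where B: "\<And>x. x \<in> C \<Longrightarrow> \<bar>f x\<bar> \<le> B" by (auto simp: bounded_iff)
    have "\<bar>f x\<bar> \<le> max B 0" for x using B[of x] f0[of x] by (cases "x \<in> C") auto
    show ?thesis
    proof (rule integrable_bounded_support[OF fm])
      show "\<bar>f x\<bar> \<le> max B 0" for x by fact
      show "f x = 0" if "R < norm x" for x using R[of x] f0[of x] that by force
    qed
  qed
  have qint: "(LBINT x. q k x) = 0" for k
    using fi lborel_integrable_translation[OF fi] lborel_integral_translation[OF fm]
    by (simp add: q_def)
  have "(\<lambda>k. LBINT x. q k x) \<longlonglongrightarrow> (LBINT x. g x)"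
  proof (rule integral_dominated_convergence[where w = "\<lambda>x. M * indicator (cball 0 (R + norm b)) x"])
    show "integrable lborel (\<lambda>x::'a. M * indicator (cball 0 (R + norm b)) x)"
      by (intro integrable_mult_right integrable_real_indicator emeasure_bounded_finite bounded_cball) simp
    show "AE x in lborel. (\<lambda>k. q k x) \<longlonglongrightarrow> g x"
    proof (rule AE_I2)
      fix x
      have "((\<lambda>t. (f (x + t *\<^sub>R b) - f (x + 0 *\<^sub>R b)) / (t - 0)) \<longlongrightarrow> g (x + 0 *\<^sub>R b)) (at 0)"
        using line[of x 0] unfolding has_field_derivative_iff by simp
      moreover have "filterlim h (at 0) sequentially"
        using hlim h0 by (auto simp: filterlim_at less_imp_neq[symmetric] intro!: always_eventually)
      ultimately have "(\<lambda>k. (f (x + h k *\<^sub>R b) - f (x + 0 *\<^sub>R b)) / (h k - 0)) \<longlonglongrightarrow> g (x + 0 *\<^sub>R b)"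
        by (rule filterlim_compose)
      then show "(\<lambda>k. q k x) \<longlonglongrightarrow> g x" by (simp add: q_def add.commute)
    qed
    show "AE x in lborel. norm (q k x) \<le> M * indicator (cball 0 (R + norm b)) x" for k
    proof (rule AE_I2)
      fix x show "norm (q k x) \<le> M * indicator (cball 0 (R + norm b)) x"
        using qM[of k x] q0[of x k] by (cases "norm x \<le> R + norm b") auto
    qed
    show "q k \<in> borel_measurable lborel" for k unfolding q_def by measurable
  qed (use gm in simp)
  then have "(LBINT x. g x) = 0" by (simp add: qint LIMSEQ_const_iff)
  then show ?thesis by (simp add: g_def)
qed

text \<open>Differentiability is asked on C only, because the fields of the later sections have
  coefficients depending on ln |x|, which are singular at the origin, a point outside C.\<close>

lemma integral_divergence_compact_support:
  fixes F :: "'a::euclidean_space \<Rightarrow> 'a"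
  assumes C: "compact C" and F0: "\<And>x. x \<notin> C \<Longrightarrow> F x = 0"
    and F': "\<And>x. x \<in> C \<Longrightarrow> (F has_derivative F' x) (at x)"
    and cont: "\<And>b. b \<in> Basis \<Longrightarrow> continuous_on C (\<lambda>x. F' x b)"
  shows "(LBINT x. indicator C x * (\<Sum>b\<in>Basis. F' x b \<bullet> b)) = 0"
proof -
  have i: "integrable lborel (\<lambda>x. indicator C x * (F' x b \<bullet> b))" if "b \<in> Basis" for b
    using borel_integrable_compact[OF C, of "\<lambda>x. F' x b \<bullet> b"] cont[OF that]
    by (simp add: continuous_intros indicator_scaleR_eq_if[symmetric] set_integrable_def)
  have z: "(LBINT x. indicator C x * (F' x b \<bullet> b)) = 0" if b: "b \<in> Basis" for b
  proof (rule integral_derivative_compact_support[where f' = "\<lambda>x v. F' x v \<bullet> b"])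
    show "((\<lambda>x. F x \<bullet> b) has_derivative (\<lambda>v. F' x v \<bullet> b)) (at x)" if "x \<in> C" for x
      by (rule has_derivative_inner_left[OF F'[OF that]])
    show "continuous_on C (\<lambda>x. F' x b \<bullet> b)" using cont[OF b] by (intro continuous_intros)
  qed (use C F0 in auto)
  have "(LBINT x. indicator C x * (\<Sum>b\<in>Basis. F' x b \<bullet> b))
      = (\<Sum>b\<in>Basis. (LBINT x. indicator C x * (F' x b \<bullet> b)))"
    unfolding sum_distrib_left by (rule Bochner_Integration.integral_sum) (rule i)
  then show ?thesis by (simp add: z)
qed

section \<open>Continuity of translations in L^1, then in L^2\<close>

definition translation_continuous :: "('a::euclidean_space \<Rightarrow> real) \<Rightarrow> bool" where
  "translation_continuous f \<longleftrightarrow> (\<forall>h. h \<longlonglongrightarrow> 0 \<longrightarrow> (\<lambda>n. LBINT x. \<bar>f (h n + x) - f x\<bar>) \<longlonglongrightarrow> 0)"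

text \<open>The property is closed under L^1 limits: by translation invariance, replacing f by g
  costs the same small amount for the shifted and for the unshifted function.\<close>

lemma translation_continuous_approx:
  assumes f: "integrable lborel f"
    and ex: "\<And>e. e > 0 \<Longrightarrow> \<exists>g. integrable lborel g \<and> translation_continuous g \<and> (LBINT x. \<bar>f x - g x\<bar>) \<le> e"
  shows "translation_continuous f"
  unfolding translation_continuous_def
proof (intro allI impI)
  fix h :: "nat \<Rightarrow> 'a" assume h: "h \<longlonglongrightarrow> 0"
  have fm[measurable]: "f \<in> borel_measurable borel" using f by auto
  show "(\<lambda>n. LBINT x. \<bar>f (h n + x) - f x\<bar>) \<longlonglongrightarrow> 0"
  proof (rule LIMSEQ_I)
    fix e :: real assume e: "e > 0"
    obtain g where g: "integrable lborel g" "translation_continuous g"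
      and fg: "(LBINT x. \<bar>f x - g x\<bar>) \<le> e / 4" using ex[of "e / 4"] e by auto
    have gm[measurable]: "g \<in> borel_measurable borel" using g by auto
    obtain N where N: "\<And>n. n \<ge> N \<Longrightarrow> norm ((LBINT x. \<bar>g (h n + x) - g x\<bar>) - 0) < e / 4"
      using LIMSEQ_D[OF g(2)[unfolded translation_continuous_def, rule_format, OF h], of "e/4"] e by auto
    have "norm ((LBINT x. \<bar>f (h n + x) - f x\<bar>) - 0) < e" if n: "n \<ge> N" for n
    proof -
      have "(LBINT x. \<bar>f (h n + x) - f x\<bar>)
        \<le> (LBINT x. \<bar>f (h n + x) - g (h n + x)\<bar> + \<bar>g (h n + x) - g x\<bar> + \<bar>f x - g x\<bar>)"
        using f g lborel_integrable_translation[OF f] lborel_integrable_translation[OF g(1)]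
        by (intro integral_mono) auto
      also have "\<dots> = (LBINT x. \<bar>f (h n + x) - g (h n + x)\<bar>) + (LBINT x. \<bar>g (h n + x) - g x\<bar>)
          + (LBINT x. \<bar>f x - g x\<bar>)"
        using f g lborel_integrable_translation[OF f] lborel_integrable_translation[OF g(1)]
        by simp
      also have "(LBINT x. \<bar>f (h n + x) - g (h n + x)\<bar>) = (LBINT x. \<bar>f x - g x\<bar>)"
        by (rule lborel_integral_translation) measurable
      finally show ?thesis using fg N[OF n] e by simp
    qed
    then show "\<exists>N. \<forall>n\<ge>N. norm ((LBINT x. \<bar>f (h n + x) - f x\<bar>) - 0) < e" by blast
  qed
qed

text \<open>For an open set, \<open>1\<^sub>U(x) 1\<^sub>U(h + x) \<rightarrow> 1\<^sub>U(x)\<close> holds at \<^emph>\<open>every\<close> point, and translation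
  invariance turns this into \<open>L\<^sup>1\<close> convergence.\<close>

lemma translation_continuous_open:
  fixes U :: "'a::euclidean_space set"
  assumes U: "open U" and fin: "emeasure lborel U < \<infinity>"
  shows "translation_continuous (indicator U)"
  unfolding translation_continuous_def
proof (intro allI impI)
  fix h :: "nat \<Rightarrow> 'a" assume h: "h \<longlonglongrightarrow> 0"
  let ?i = "indicator U :: 'a \<Rightarrow> real"
  have i: "integrable lborel ?i" using U fin by (intro integrable_real_indicator) auto
  have [measurable]: "U \<in> sets borel" using U by simp
  have ip: "integrable lborel (\<lambda>x. ?i x * ?i (h n + x))" for n
    by (rule Bochner_Integration.integrable_bound[OF i]) (auto simp: indicator_def)
  have eq: "(LBINT x. \<bar>?i (h n + x) - ?i x\<bar>)
      = 2 * ((LBINT x. ?i x) - (LBINT x. ?i x * ?i (h n + x)))" for n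
  proof -
    have "(LBINT x. \<bar>?i (h n + x) - ?i x\<bar>)
      = (LBINT x. ?i (h n + x) + ?i x - 2 * (?i x * ?i (h n + x)))"
      by (rule Bochner_Integration.integral_cong) (auto simp: indicator_def)
    also have "\<dots> = (LBINT x. ?i (h n + x)) + (LBINT x. ?i x) - 2 * (LBINT x. ?i x * ?i (h n + x))"
      using i ip lborel_integrable_translation[OF i] by simp
    also have "(LBINT x. ?i (h n + x)) = (LBINT x. ?i x)"
      by (rule lborel_integral_translation) simp
    finally show ?thesis by simp
  qed
  have "(\<lambda>n. LBINT x. ?i x * ?i (h n + x)) \<longlonglongrightarrow> (LBINT x. ?i x)"
  proof (rule integral_dominated_convergence[OF _ _ i])
    show "AE x in lborel. (\<lambda>n. ?i x * ?i (h n + x)) \<longlonglongrightarrow> ?i x"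
    proof (rule AE_I2)
      fix x show "(\<lambda>n. ?i x * ?i (h n + x)) \<longlonglongrightarrow> ?i x"
      proof (cases "x \<in> U")
        case True
        have "(\<lambda>n. h n + x) \<longlonglongrightarrow> 0 + x" by (intro tendsto_intros h)
        then have "eventually (\<lambda>n. h n + x \<in> U) sequentially"
          using topological_tendstoD[of _ _ _ U] U True by auto
        then have "eventually (\<lambda>n. ?i x * ?i (h n + x) = ?i x) sequentially"
          by eventually_elim (use True in auto)
        then show ?thesis by (rule tendsto_eventually)
      qed auto
    qed
  qed (auto simp: indicator_def)
  then have "(\<lambda>n. 2 * ((LBINT x. ?i x) - (LBINT x. ?i x * ?i (h n + x))))
      \<longlonglongrightarrow> 2 * ((LBINT x. ?i x) - (LBINT x. ?i x))"
    by (intro tendsto_intros)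
  then show "(\<lambda>n. LBINT x. \<bar>?i (h n + x) - ?i x\<bar>) \<longlonglongrightarrow> 0" by (simp add: eq)
qed

lemma translation_continuous_scale:
  assumes "translation_continuous f" shows "translation_continuous (\<lambda>x. c * f x)"
proof -
  have "(LBINT x. \<bar>c * f (y + x) - c * f x\<bar>) = \<bar>c\<bar> * (LBINT x. \<bar>f (y + x) - f x\<bar>)" for y
    by (simp add: right_diff_distrib[symmetric] abs_mult)
  then show ?thesis using assms tendsto_mult_right_zero
    unfolding translation_continuous_def by fastforce
qed

lemma translation_continuous_add:
  assumes f: "integrable lborel f" "translation_continuous f"
    and g: "integrable lborel g" "translation_continuous g"
  shows "translation_continuous (\<lambda>x. f x + g x)"
  unfolding translation_continuous_def
proof (intro allI impI)
  fix h :: "nat \<Rightarrow> 'a" assume h: "h \<longlonglongrightarrow> 0"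
  have "(LBINT x. \<bar>f (h n + x) + g (h n + x) - (f x + g x)\<bar>)
     \<le> (LBINT x. \<bar>f (h n + x) - f x\<bar>) + (LBINT x. \<bar>g (h n + x) - g x\<bar>)" for n
  proof -
    have "(LBINT x. \<bar>f (h n + x) + g (h n + x) - (f x + g x)\<bar>)
       \<le> (LBINT x. \<bar>f (h n + x) - f x\<bar> + \<bar>g (h n + x) - g x\<bar>)"
      using f g lborel_integrable_translation[OF f(1)] lborel_integrable_translation[OF g(1)]
      by (intro integral_mono) auto
    also have "\<dots> = (LBINT x. \<bar>f (h n + x) - f x\<bar>) + (LBINT x. \<bar>g (h n + x) - g x\<bar>)"
      using f g lborel_integrable_translation[OF f(1)] lborel_integrable_translation[OF g(1)] by simp
    finally show ?thesis .
  qed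
  moreover have "(\<lambda>n. (LBINT x. \<bar>f (h n + x) - f x\<bar>) + (LBINT x. \<bar>g (h n + x) - g x\<bar>)) \<longlonglongrightarrow> 0"
    using tendsto_add[of _ 0 _ _ 0] f(2) g(2) h unfolding translation_continuous_def by fastforce
  ultimately show "(\<lambda>n. LBINT x. \<bar>f (h n + x) + g (h n + x) - (f x + g x)\<bar>) \<longlonglongrightarrow> 0"
    by (rule_tac Lim_null_comparison[rotated]) (auto intro!: always_eventually)
qed

text \<open>Induction over integrable functions: open sets are settled, outer regularity extends
  this to measurable sets of finite measure, and closure under L^1 limits does the rest.\<close>

lemma integrable_translation_continuous:
  fixes f :: "'a::euclidean_space \<Rightarrow> real"
  assumes "integrable lborel f"
  shows "translation_continuous f"
  using assms
proof (induction rule: integrable_induct)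
  case (base A c)
  have A: "A \<in> sets lborel" "emeasure lborel A < \<infinity>" using base by auto
  have "translation_continuous (indicator A)"
  proof (rule translation_continuous_approx)
    show iA: "integrable lborel (indicator A :: 'a \<Rightarrow> real)" using A by (intro integrable_real_indicator) auto
    fix e :: real assume e: "e > 0"
    obtain U where U: "open U" "A \<subseteq> U" "emeasure lborel (U - A) < ennreal e"
      using outer_regular_lborel[of A e] A e by auto
    have "emeasure lborel U \<le> emeasure lborel A + emeasure lborel (U - A)"
      using A U by (metis Diff_partition borel_open emeasure_subadditive sets.Diff sets_lborel)
    also have "\<dots> < \<infinity>" using A U by (auto simp: less_top[symmetric] ennreal_add_eq_top)
    finally have fU: "emeasure lborel U < \<infinity>" .
    have "(LBINT x. \<bar>indicator A x - indicator U x :: real\<bar>) = (LBINT x. indicator (U - A) x)"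
      by (rule Bochner_Integration.integral_cong) (use U in \<open>auto simp: indicator_def\<close>)
    also have "\<dots> = measure lborel (U - A)" by simp
    also have "\<dots> \<le> e" using U(3) e by (simp add: measure_def enn2real_leI less_imp_le)
    finally have "(LBINT x. \<bar>indicator A x - indicator U x :: real\<bar>) \<le> e" .
    moreover have "integrable lborel (indicator U :: 'a \<Rightarrow> real)"
      using U fU by (intro integrable_real_indicator) auto
    ultimately show "\<exists>g. integrable lborel g \<and> translation_continuous g \<and> (LBINT x. \<bar>indicator A x - g x\<bar>) \<le> e"
      using translation_continuous_open[OF U(1) fU] by blast
  qed
  from translation_continuous_scale[OF this, of c] show ?case by (simp add: mult.commute)
next
  case (add f g)
  then show ?case by (intro translation_continuous_add)
next
  case (lim f s)
  show ?case
  proof (rule translation_continuous_approx[OF lim.hyps(4)])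
    fix e :: real assume e: "e > 0"
    have "(\<lambda>i. LBINT x. \<bar>f x - s i x\<bar>) \<longlonglongrightarrow> (\<integral>x. 0 \<partial>(lborel :: 'a measure))"
    \<comment> \<open>The induction rule supplies simple functions bounded by 2 |f|, so their
      distance to f is at most 3 |f|.\<close>
    proof (rule integral_dominated_convergence[where w = "\<lambda>x. 3 * \<bar>f x\<bar>"])
      show "AE x in lborel. (\<lambda>i. \<bar>f x - s i x\<bar>) \<longlonglongrightarrow> 0"
      proof (rule AE_I2)
        fix x :: 'a
        have "(\<lambda>i. \<bar>f x - s i x\<bar>) \<longlonglongrightarrow> \<bar>f x - f x\<bar>" by (intro tendsto_intros lim.hyps(2)) simp
        then show "(\<lambda>i. \<bar>f x - s i x\<bar>) \<longlonglongrightarrow> 0" by simp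
      qed
      show "AE x in lborel. norm \<bar>f x - s i x\<bar> \<le> 3 * \<bar>f x\<bar>" for i
        using lim.hyps(3)[of _ i] by (intro AE_I2) (auto intro!: order_trans[OF abs_triangle_ineq4] )
      have "f \<in> borel_measurable lborel" "s i \<in> borel_measurable lborel" for i
        using lim.hyps(1)[of i] lim.hyps(4) borel_measurable_integrable by blast+
      then show "(\<lambda>x. \<bar>f x - s i x\<bar>) \<in> borel_measurable lborel" for i by measurable
    qed (use lim.hyps(4) in auto)
    then obtain N where "norm ((LBINT x. \<bar>f x - s N x\<bar>) - 0) < e"
      using LIMSEQ_D[of _ 0 e] e by fastforce
    then show "\<exists>g. integrable lborel g \<and> translation_continuous g \<and> (LBINT x. \<bar>f x - g x\<bar>) \<le> e"
      using lim.hyps(1) lim.IH by (intro exI[of _ "s N"]) auto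
  qed
qed

text \<open>The signed square \<open>F = f |f|\<close> is integrable, and \<open>(a - b)^2\<close>
  is at most twice the difference of the signed squares of a and b. This reduces L^2 to the L^1
  statement.\<close>

lemma sq_integrable_translation_continuous:
  assumes f: "sq_integrable f" and h: "h \<longlonglongrightarrow> 0"
  shows "(\<lambda>n. LBINT x. (f (h n + x) - f x)\<^sup>2) \<longlonglongrightarrow> 0"
proof -
  define F where "F x = f x * \<bar>f x\<bar>" for x
  have [measurable]: "f \<in> borel_measurable borel" using f by measurable
  have F: "integrable lborel F" unfolding F_def by (rule sq_integrable_mult[OF f sq_integrable_abs[OF f]])
  have pt: "(a - b)\<^sup>2 \<le> 2 * \<bar>a * \<bar>a\<bar> - b * \<bar>b\<bar>\<bar>" for a b :: real
  proof -
    have *: "(a - b)\<^sup>2 \<le> 2 * \<bar>a * \<bar>a\<bar> - b * \<bar>b\<bar>\<bar>" if "\<bar>b\<bar> \<le> a" for a b :: real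
    proof (cases "b \<ge> 0")
      case True
      then have "0 \<le> b * (a - b)" "0 \<le> (a - b) * (a - b)" "b * b \<le> a * a" using that by (auto intro: mult_mono)
      then show ?thesis using True that by (simp add: power2_eq_square algebra_simps)
    next
      case False
      then have "0 \<le> a * a" "0 \<le> b * b" by auto
      then show ?thesis using False that sum_squares_bound[of a "-b"]
        by (simp add: power2_eq_square algebra_simps)
    qed
    \<comment> \<open>The cases say which of a, b is larger in modulus and what sign it has;
      exchanging the two and changing both signs reduces all of them to the first.\<close>
    consider "\<bar>b\<bar> \<le> a" | "\<bar>a\<bar> \<le> b" | "\<bar>b\<bar> \<le> -a" | "\<bar>a\<bar> \<le> -b" by linarith
    then show ?thesis
    proof cases
      case 1 then show ?thesis by (rule *)
    next
      case 2 then show ?thesis using *[of a b] by (simp add: power2_commute abs_minus_commute)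
    next
      case 3
      then have "(- a - - b)\<^sup>2 \<le> 2 * \<bar>- a * \<bar>- a\<bar> - - b * \<bar>- b\<bar>\<bar>" by (intro *) simp
      moreover have "- a * \<bar>- a\<bar> - - b * \<bar>- b\<bar> = - (a * \<bar>a\<bar> - b * \<bar>b\<bar>)" "- a - - b = - (a - b)" by auto
      ultimately show ?thesis by (simp only: abs_minus_cancel power2_minus)
    next
      case 4
      then have "(- b - - a)\<^sup>2 \<le> 2 * \<bar>- b * \<bar>- b\<bar> - - a * \<bar>- a\<bar>\<bar>" by (intro *) simp
      moreover have "- b * \<bar>- b\<bar> - - a * \<bar>- a\<bar> = a * \<bar>a\<bar> - b * \<bar>b\<bar>" "- b - - a = a - b" by auto
      ultimately show ?thesis by simp
    qed
  qed
  have "(LBINT x. (f (h n + x) - f x)\<^sup>2) \<le> 2 * (LBINT x. \<bar>F (h n + x) - F x\<bar>)" for n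
  proof -
    have "(LBINT x. (f (h n + x) - f x)\<^sup>2) \<le> (LBINT x. 2 * \<bar>F (h n + x) - F x\<bar>)"
    proof (rule integral_mono')
      show "integrable lborel (\<lambda>x. 2 * \<bar>F (h n + x) - F x\<bar>)"
        using F lborel_integrable_translation[OF F] by simp
    qed (auto simp: F_def pt)
    then show ?thesis by simp
  qed
  moreover have "(\<lambda>n. 2 * (LBINT x. \<bar>F (h n + x) - F x\<bar>)) \<longlonglongrightarrow> 0"
    using integrable_translation_continuous[OF F] h
    by (intro tendsto_mult_right_zero) (auto simp: translation_continuous_def)
  ultimately show ?thesis
    by (rule tendsto_zero_le[of "\<lambda>n. LBINT x. (f (h n + x) - f x)\<^sup>2", rotated]) simp
qed

section \<open>Bump functions and convolution\<close>

text \<open>The flat function \<open>s^(-k) exp (- 1 / s)\<close>, extended by 0. The power is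
  carried along because differentiation maps the span of these functions into itself.\<close>

definition expinv :: "nat \<Rightarrow> real \<Rightarrow> real" where
  "expinv k s = (if s > 0 then (1/s) ^ k * exp (- (1/s)) else 0)"

lemma expinv_nonneg: "expinv k s \<ge> 0"
  by (simp add: expinv_def)

text \<open>With m = k + 2, raise \<open>1 / (m s) \<le> exp (1 / (m s))\<close> to the power m. The
  quadratic decay at s = 0 is what makes the derivative there equal to 0.\<close>

lemma expinv_le: "expinv k s \<le> real (k+2) ^ (k+2) * s\<^sup>2"
proof (cases "s > 0")
  case True
  define m where "m = k + 2"
  have "(1/s / m) ^ m \<le> exp (1/s / m) ^ m"
  proof (rule power_mono)
    show "1/s / m \<le> exp (1/s / m)" using exp_ge_add_one_self[of "1/s / m"] by linarith
  qed (use True in simp)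
  also have "\<dots> = exp (real m * (1/s / m))" by (rule exp_of_nat_mult[symmetric])
  also have "real m * (1/s / m) = 1/s" by (simp add: m_def)
  finally have "(1/s) ^ m / real m ^ m \<le> exp (1/s)" by (simp only: power_divide[of "1/s"])
  moreover have "real m ^ m > 0" by (simp add: m_def)
  ultimately have "(1/s) ^ m \<le> real m ^ m * exp (1/s)" by (simp only: pos_divide_le_eq mult.commute)
  then have "(1/s)^k * (1/s)^2 \<le> real m ^ m * exp (1/s)"
    by (simp only: m_def power_add)
  then have "(1/s)^k * (1/s)^2 * s\<^sup>2 * exp (- (1/s)) \<le> real m ^ m * exp (1/s) * s\<^sup>2 * exp (- (1/s))"
    by (intro mult_right_mono) auto
  moreover have "(1/s)^k * (1/s)^2 * s\<^sup>2 * exp (- (1/s)) = (1/s)^k * exp (- (1/s))"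
    using True by (simp add: power_divide)
  moreover have "real m ^ m * exp (1/s) * s\<^sup>2 * exp (- (1/s)) = real m ^ m * s\<^sup>2"
    by (simp add: exp_minus_inverse mult.assoc mult.left_commute[of "exp (1/s)"])
  ultimately have "(1/s)^k * exp (- (1/s)) \<le> real m ^ m * s\<^sup>2"
    by (simp only:)
  then show ?thesis using True by (simp add: expinv_def m_def)
qed (simp add: expinv_def)

lemma expinv_deriv: "(expinv k has_real_derivative (expinv (k+2) s - k * expinv (k+1) s)) (at s)"
proof -
  consider "s < 0" | "s = 0" | "s > 0" by linarith
  then show ?thesis
  proof cases
    case 1
    have "((\<lambda>_. 0) has_real_derivative 0) (at s)" by simp
    then have "(expinv k has_real_derivative 0) (at s)"
      by (rule has_field_derivative_transform_within_open[where S = "{..<0}"]) (use 1 in \<open>auto simp: expinv_def\<close>)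
    then show ?thesis using 1 by (simp add: expinv_def)
  next
    case 2
    have "((\<lambda>h. (expinv k (0 + h) - expinv k 0) / h) \<longlongrightarrow> 0) (at 0)"
    proof (rule Lim_null_comparison)
      show "\<forall>\<^sub>F h in at 0. norm ((expinv k (0 + h) - expinv k 0) / h) \<le> real (k+2) ^ (k+2) * \<bar>h\<bar>"
      proof (rule always_eventually, rule allI)
        fix h :: real
        have "\<bar>expinv k h\<bar> / \<bar>h\<bar> \<le> (real (k+2) ^ (k+2) * h\<^sup>2) / \<bar>h\<bar>"
          using expinv_le[of k h] expinv_nonneg[of k h] by (intro divide_right_mono) auto
        also have "\<dots> = real (k+2) ^ (k+2) * \<bar>h\<bar>" by (cases "h = 0") (simp_all add: power2_eq_square abs_if)
        finally show "norm ((expinv k (0 + h) - expinv k 0) / h) \<le> real (k+2) ^ (k+2) * \<bar>h\<bar>"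
          by (simp add: expinv_def[of k 0])
      qed
      have "((\<lambda>h. real (k+2) ^ (k+2) * \<bar>h\<bar>) \<longlongrightarrow> real (k+2) ^ (k+2) * \<bar>0\<bar>) (at 0)"
        by (intro tendsto_intros)
      then show "((\<lambda>h. real (k+2) ^ (k+2) * \<bar>h\<bar>) \<longlongrightarrow> 0) (at (0::real))" by simp
    qed
    then have "(expinv k has_real_derivative 0) (at 0)" by (simp add: DERIV_def)
    then show ?thesis using 2 by (simp add: expinv_def)
  next
    case 3
    have "((\<lambda>s. (1/s) ^ k * exp (- (1/s))) has_real_derivative (expinv (k+2) s - k * expinv (k+1) s)) (at s)"
    proof (rule DERIV_cong)
      show "((\<lambda>s. (1/s) ^ k * exp (- (1/s))) has_real_derivative
          (real k * (1/s)^(k - 1) * (- 1 / s\<^sup>2)) * exp (- (1/s)) + exp (- (1/s)) * (1 / s\<^sup>2) * (1/s)^k) (at s)"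
        using 3 by (auto intro!: derivative_eq_intros simp: power2_eq_square)
      show "(real k * (1/s)^(k - 1) * (- 1 / s\<^sup>2)) * exp (- (1/s)) + exp (- (1/s)) * (1 / s\<^sup>2) * (1/s)^k
          = expinv (k+2) s - k * expinv (k+1) s"
        using 3 by (cases k) (auto simp: expinv_def power2_eq_square field_simps)
    qed
    then show ?thesis
      by (rule has_field_derivative_transform_within_open[where S = "{0<..}"]) (use 3 in \<open>auto simp: expinv_def\<close>)
  qed
qed

text \<open>The span of the functions \<open>p(z) s\<^bsup>-k\<^esup> exp(-1/s)\<close> with \<open>p\<close> a polynomial and
  \<open>s = \<epsilon>\<^sup>2 - |z - y|\<^sup>2\<close>; it is closed under partial derivatives.\<close>

inductive bump :: "'a::euclidean_space \<Rightarrow> real \<Rightarrow> ('a \<Rightarrow> real) \<Rightarrow> bool" for y \<epsilon> where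
  base: "bump y \<epsilon> (\<lambda>z. expinv k (\<epsilon>\<^sup>2 - (z - y) \<bullet> (z - y)))"
| add: "bump y \<epsilon> f \<Longrightarrow> bump y \<epsilon> g \<Longrightarrow> bump y \<epsilon> (\<lambda>z. f z + g z)"
| scale: "bump y \<epsilon> f \<Longrightarrow> bump y \<epsilon> (\<lambda>z. c * f z)"
| coord: "bump y \<epsilon> f \<Longrightarrow> bump y \<epsilon> (\<lambda>z. (z \<bullet> b) * f z)"

lemma bump_zero:
  assumes "bump y \<epsilon> f" and "\<bar>\<epsilon>\<bar> \<le> norm (z - y)" shows "f z = 0"
  using assms
proof (induction rule: bump.induct)
  case (base k)
  have "\<bar>\<epsilon>\<bar>\<^sup>2 \<le> (norm (z - y))\<^sup>2" using base by (intro power_mono) auto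
  then show ?case by (simp add: expinv_def power2_norm_eq_inner)
qed auto

text \<open>Differentiating \<open>\<epsilon>\<^sup>2 - |z - y|\<^sup>2\<close> produces the factor
  -2 (z - y). This is why multiplication by coordinates is among the generators.\<close>

lemma bump_gradient:
  assumes "bump y \<epsilon> f"
  obtains G where "\<And>z. GDERIV f z :> G z" and "\<And>b. bump y \<epsilon> (\<lambda>z. G z \<bullet> b)"
proof -
  have "\<exists>G. (\<forall>z. GDERIV f z :> G z) \<and> (\<forall>b. bump y \<epsilon> (\<lambda>z. G z \<bullet> b))"
    using assms
  proof (induction rule: bump.induct)
    case (base k)
    define q where "q z = expinv (k+2) (\<epsilon>\<^sup>2 - (z - y) \<bullet> (z - y)) + (- real k) * expinv (k+1) (\<epsilon>\<^sup>2 - (z - y) \<bullet> (z - y))" for z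
    have q: "bump y \<epsilon> q" unfolding q_def[abs_def] by (intro bump.intros)
    have g: "GDERIV (\<lambda>z. expinv k (\<epsilon>\<^sup>2 - (z - y) \<bullet> (z - y))) z :> q z *\<^sub>R ((-2) *\<^sub>R (z - y))" for z
    proof (rule GDERIV_DERIV_compose[where f = "\<lambda>z. \<epsilon>\<^sup>2 - (z - y) \<bullet> (z - y)" and g = "expinv k"])
      show "GDERIV (\<lambda>z. \<epsilon>\<^sup>2 - (z - y) \<bullet> (z - y)) z :> (-2) *\<^sub>R (z - y)"
        unfolding gderiv_def by (auto intro!: derivative_eq_intros simp: inner_commute algebra_simps)
      show "(expinv k has_real_derivative q z) (at (\<epsilon>\<^sup>2 - (z - y) \<bullet> (z - y)))"
        using expinv_deriv by (simp add: q_def)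
    qed
    have "bump y \<epsilon> (\<lambda>z. (q z *\<^sub>R ((-2) *\<^sub>R (z - y))) \<bullet> b)" for b
    proof -
      have "bump y \<epsilon> (\<lambda>z. (-2) * ((z \<bullet> b) * q z) + (2 * (y \<bullet> b)) * q z)" by (intro bump.intros q)
      also have "(\<lambda>z. (-2) * ((z \<bullet> b) * q z) + (2 * (y \<bullet> b)) * q z) = (\<lambda>z. (q z *\<^sub>R ((-2) *\<^sub>R (z - y))) \<bullet> b)"
        by (auto simp: fun_eq_iff inner_diff_left algebra_simps)
      finally show ?thesis .
    qed
    with g show ?case by (intro exI[of _ "\<lambda>z. q z *\<^sub>R ((-2) *\<^sub>R (z - y))"]) blast
  next
    case (add f g)
    then obtain F G where "\<And>z. GDERIV f z :> F z" "\<And>b. bump y \<epsilon> (\<lambda>z. F z \<bullet> b)"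
      "\<And>z. GDERIV g z :> G z" "\<And>b. bump y \<epsilon> (\<lambda>z. G z \<bullet> b)" by metis
    then show ?case
      by (intro exI[of _ "\<lambda>z. F z + G z"]) (auto intro: GDERIV_add bump.add simp: inner_add_left)
  next
    case (scale f c)
    then obtain F where F: "\<And>z. GDERIV f z :> F z" "\<And>b. bump y \<epsilon> (\<lambda>z. F z \<bullet> b)" by metis
    have "GDERIV (\<lambda>z. c * f z) z :> c *\<^sub>R F z" for z
      using GDERIV_mult[OF GDERIV_const F(1)] by simp
    then show ?case using F(2)
      by (intro exI[of _ "\<lambda>z. c *\<^sub>R F z"]) (auto intro: bump.scale)
  next
    case (coord f c)
    then obtain F where F: "\<And>z. GDERIV f z :> F z" "\<And>b. bump y \<epsilon> (\<lambda>z. F z \<bullet> b)" by metis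
    have c: "GDERIV (\<lambda>z. z \<bullet> c) z :> c" for z
      unfolding gderiv_def by (auto intro!: derivative_eq_intros)
    have "GDERIV (\<lambda>z. (z \<bullet> c) * f z) z :> (z \<bullet> c) *\<^sub>R F z + f z *\<^sub>R c" for z
      using GDERIV_mult[OF c F(1)] by simp
    moreover have "bump y \<epsilon> (\<lambda>z. ((z \<bullet> c) *\<^sub>R F z + f z *\<^sub>R c) \<bullet> b)" for b
    proof -
      have "bump y \<epsilon> (\<lambda>z. (z \<bullet> c) * (F z \<bullet> b) + (c \<bullet> b) * f z)" by (intro bump.intros F(2) coord.hyps)
      then show ?thesis by (simp add: inner_add_left mult.commute)
    qed
    ultimately show ?case by (intro exI[of _ "\<lambda>z. (z \<bullet> c) *\<^sub>R F z + f z *\<^sub>R c"]) blast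
  qed
  then show thesis using that by blast
qed

text \<open>Coinduction: the bumps are differentiable and closed under partial derivatives, hence
  contained in the largest such class.\<close>

lemma bump_smooth:
  assumes "bump y \<epsilon> f" shows "smooth f"
  using assms
proof (coinduction arbitrary: f)
  case smooth
  then obtain G where "\<And>z. GDERIV f z :> G z" "\<And>b. bump y \<epsilon> (\<lambda>z. G z \<bullet> b)"
    using bump_gradient by blast
  then show ?case by blast
qed

text \<open>A convolution evaluated at x integrates against \<open>\<rho> (x - y)\<close> as a
  function of y. As this is again a bump, the weak formulations may be tested with it.\<close>

lemma bump_reflect:
  assumes "bump 0 \<epsilon> f" shows "bump x \<epsilon> (\<lambda>z. f (x - z))"
  using assms
proof (induction rule: bump.induct)
  case (base k)
  have "(\<lambda>z. expinv k (\<epsilon>\<^sup>2 - (x - z - 0) \<bullet> (x - z - 0))) = (\<lambda>z. expinv k (\<epsilon>\<^sup>2 - (z - x) \<bullet> (z - x)))"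
    by (auto simp: fun_eq_iff inner_diff_left inner_diff_right inner_commute algebra_simps)
  then show ?case using bump.base[of x \<epsilon> k] by simp
next
  case (coord f b)
  have "bump x \<epsilon> (\<lambda>z. (x \<bullet> b) * f (x - z) + (-1) * ((z \<bullet> b) * f (x - z)))"
    by (intro bump.intros coord.IH)
  then show ?case by (simp add: inner_diff_left left_diff_distrib)
qed (auto intro: bump.intros)

lemma bump_continuous: "bump y \<epsilon> f \<Longrightarrow> continuous_on UNIV f"
  by (meson bump_gradient continuous_at_imp_continuous_on gderiv_def has_derivative_continuous)

lemma bump_measurable: "bump y \<epsilon> f \<Longrightarrow> f \<in> borel_measurable borel"
  by (intro borel_measurable_continuous_onI bump_continuous)

lemma bump_bounded:
  assumes "bump y \<epsilon> f" obtains M where "M \<ge> 0" "\<And>z. \<bar>f z\<bar> \<le> M"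
proof -
  have "bounded (f ` cball y \<bar>\<epsilon>\<bar>)"
    by (intro compact_imp_bounded compact_continuous_image continuous_on_subset[OF bump_continuous[OF assms]]) auto
  then obtain B where B: "\<And>z. z \<in> cball y \<bar>\<epsilon>\<bar> \<Longrightarrow> \<bar>f z\<bar> \<le> B"
    unfolding bounded_iff by (metis imageI real_norm_def)
  have "\<bar>f z\<bar> \<le> max 0 B" for z
    using B[of z] bump_zero[OF assms, of z] by (cases "norm (z - y) \<le> \<bar>\<epsilon>\<bar>") (auto simp: dist_norm norm_minus_commute)
  then show thesis using that[of "max 0 B"] by auto
qed

lemma bump_integrable:
  assumes "bump y \<epsilon> f" shows "integrable lborel f" "sq_integrable f"
proof -
  obtain M where M: "M \<ge> 0" "\<And>z. \<bar>f z\<bar> \<le> M" using bump_bounded[OF assms] by blast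
  have z: "f z = 0" if "norm y + \<bar>\<epsilon>\<bar> < norm z" for z
    using bump_zero[OF assms, of z] norm_triangle_ineq2[of z y] that by auto
  show "integrable lborel f"
    by (rule integrable_bounded_support[OF bump_measurable[OF assms] M(2) z])
  have "integrable lborel (\<lambda>z. (f z)\<^sup>2)"
  proof (rule integrable_bounded_support)
    show "\<bar>(f z)\<^sup>2\<bar> \<le> M\<^sup>2" for z using power_mono[OF M(2)[of z], of 2] by simp
    show "(\<lambda>z. (f z)\<^sup>2) \<in> borel_measurable borel" using bump_measurable[OF assms] by measurable
  qed (use z in simp)
  then show "sq_integrable f" using bump_measurable[OF assms] by (simp add: sq_integrable_def)
qed

lemma gradient_bounded_imp_Lipschitz:
  fixes f :: "'a::euclidean_space \<Rightarrow> real"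
  assumes G: "\<And>z. GDERIV f z :> G z" and M: "\<And>z. norm (G z) \<le> M"
  shows "\<bar>f x - f y\<bar> \<le> M * norm (x - y)"
proof -
  have "norm (f x - f y) \<le> M * norm (x - y)"
  proof (rule differentiable_bound[OF convex_UNIV])
    show "(f has_derivative (\<lambda>h. h \<bullet> G z)) (at z within UNIV)" for z using G by (simp add: gderiv_def)
    show "onorm (\<lambda>h. h \<bullet> G z) \<le> M" for z
    proof (rule onorm_bound)
      show "0 \<le> M" using order_trans[OF norm_ge_zero M[of z]] .
            fix h show "norm (h \<bullet> G z) \<le> M * norm h"
        using Cauchy_Schwarz_ineq2[of h "G z"] mult_left_mono[OF M[of z], of "norm h"] by (simp add: mult.commute)
    qed
  qed auto
  then show ?thesis by simp
qed

lemma bump_gradient_bounded: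
  fixes G :: "'a::euclidean_space \<Rightarrow> 'a"
  assumes G: "\<And>b. bump y \<epsilon> (\<lambda>z. G z \<bullet> b)"
  obtains M where "M \<ge> 0" "\<And>z. norm (G z) \<le> M"
proof -
  have "\<exists>M. \<forall>z. \<bar>G z \<bullet> b\<bar> \<le> M" for b using bump_bounded[OF G[of b]] by blast
  then obtain M where M: "\<And>b z. \<bar>G z \<bullet> b\<bar> \<le> M b" by metis
  have "norm (G z) \<le> (\<Sum>b\<in>Basis. M b)" for z
    using norm_le_l1[of "G z"] sum_mono[of Basis "\<lambda>b. \<bar>G z \<bullet> b\<bar>" M] M by auto
  then show thesis using that[of "\<Sum>b\<in>Basis. M b"] norm_ge_zero order_trans by metis
qed

lemma bump_Lipschitz:
  assumes "bump y \<epsilon> f" obtains L where "L \<ge> 0" "\<And>x z. \<bar>f x - f z\<bar> \<le> L * norm (x - z)"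
proof -
  obtain G where G: "\<And>z. GDERIV f z :> G z" "\<And>b. bump y \<epsilon> (\<lambda>z. G z \<bullet> b)"
    using bump_gradient[OF assms] by blast
  obtain M where M: "M \<ge> 0" "\<And>z. norm (G z) \<le> M" using bump_gradient_bounded[OF G(2)] by blast
  show thesis using that[OF M(1)] gradient_bounded_imp_Lipschitz[OF G(1) M(2)] by blast
qed

text \<open>The gradient is globally Lipschitz, since its components are bumps; the mean value
  theorem on a segment then gives a remainder that is quadratic uniformly in the base point.\<close>

lemma bump_Taylor:
  fixes f :: "'a::euclidean_space \<Rightarrow> real"
  assumes "bump y \<epsilon> f" and G: "\<And>z. GDERIV f z :> G z" and Gb: "\<And>b. bump y \<epsilon> (\<lambda>z. G z \<bullet> b)"
  obtains L where "L \<ge> 0" "\<And>z h. \<bar>f (z + h) - f z - G z \<bullet> h\<bar> \<le> L * (norm h)\<^sup>2"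
proof -
  have "\<exists>L. L \<ge> 0 \<and> (\<forall>x z. \<bar>G x \<bullet> b - G z \<bullet> b\<bar> \<le> L * norm (x - z))" for b
    using bump_Lipschitz[OF Gb[of b]] by metis
  then obtain L where L: "\<And>b. L b \<ge> 0" "\<And>b x z. \<bar>G x \<bullet> b - G z \<bullet> b\<bar> \<le> L b * norm (x - z)" by metis
  define K where "K = (\<Sum>b\<in>Basis. L b)"
  have K0: "K \<ge> 0" unfolding K_def by (intro sum_nonneg L)
  have K: "norm (G x - G z) \<le> K * norm (x - z)" for x z
  proof -
    have "norm (G x - G z) \<le> (\<Sum>b\<in>Basis. \<bar>(G x - G z) \<bullet> b\<bar>)" by (rule norm_le_l1)
    also have "\<dots> \<le> (\<Sum>b\<in>Basis. L b * norm (x - z))" using L(2) by (intro sum_mono) (simp add: inner_diff_left)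
    finally show ?thesis by (simp add: K_def sum_distrib_right)
  qed
  have "\<bar>f (z + h) - f z - G z \<bullet> h\<bar> \<le> K * (norm h)\<^sup>2" for z h
  proof -
    have d: "((\<lambda>t. f (z + t *\<^sub>R h) - t * (G z \<bullet> h)) has_real_derivative (h \<bullet> G (z + t *\<^sub>R h) - G z \<bullet> h)) (at t)" for t
    proof -
      have l: "((\<lambda>t. z + t *\<^sub>R h) has_derivative (\<lambda>t. t *\<^sub>R h)) (at t)"
        by (auto intro!: derivative_eq_intros)
      have "((\<lambda>t. f (z + t *\<^sub>R h)) has_real_derivative (h \<bullet> G (z + t *\<^sub>R h))) (at t)"
        using has_derivative_compose[OF l G[unfolded gderiv_def]]
        by (simp add: has_field_derivative_def mult.commute[of _ "h \<bullet> _"] )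
      then show ?thesis by (auto intro!: derivative_eq_intros)
    qed
    obtain s where s: "0 < s" "s < 1" and
      eq: "(f (z + 1 *\<^sub>R h) - 1 * (G z \<bullet> h)) - (f (z + 0 *\<^sub>R h) - 0 * (G z \<bullet> h)) = (1 - 0) * (h \<bullet> G (z + s *\<^sub>R h) - G z \<bullet> h)"
      using MVT2[of 0 1, OF _ d] by auto
    have "\<bar>h \<bullet> G (z + s *\<^sub>R h) - G z \<bullet> h\<bar> = \<bar>h \<bullet> (G (z + s *\<^sub>R h) - G z)\<bar>"
      by (simp add: inner_diff_right inner_commute)
    also have "\<dots> \<le> norm h * norm (G (z + s *\<^sub>R h) - G z)" by (rule Cauchy_Schwarz_ineq2)
    also have "\<dots> \<le> norm h * (K * norm (z + s *\<^sub>R h - z))" by (intro mult_left_mono K) auto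
    also have "\<dots> \<le> norm h * (K * norm h)"
      using s K0 by (intro mult_left_mono) (auto simp: mult_left_le_one_le)
    finally show ?thesis using eq by (simp add: power2_eq_square algebra_simps)
  qed
  then show thesis using that K0 by blast
qed

section \<open>Convolution with a bump function\<close>

definition convol :: "('a::euclidean_space \<Rightarrow> real) \<Rightarrow> ('a \<Rightarrow> real) \<Rightarrow> 'a \<Rightarrow> real" where
  "convol \<rho> f x = (LBINT y. \<rho> (x - y) * f y)"

lemma convol_integrable:
  fixes f :: "'a::euclidean_space \<Rightarrow> real"
  assumes "bump 0 \<epsilon> \<rho>" and "integrable lborel f"
  shows "integrable lborel (\<lambda>y. \<rho> (x - y) * f y)"
proof -
  obtain M where M: "M \<ge> 0" "\<And>z. \<bar>\<rho> z\<bar> \<le> M" using bump_bounded[OF assms(1)] by blast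
  have [measurable]: "\<rho> \<in> borel_measurable borel" "f \<in> borel_measurable borel"
    using bump_measurable[OF assms(1)] assms(2) by auto
  show ?thesis
  proof (rule Bochner_Integration.integrable_bound)
    show "integrable lborel (\<lambda>y. M * f y)" using assms by simp
    show "AE y in lborel. norm (\<rho> (x - y) * f y) \<le> norm (M * f y)"
      using M by (intro AE_I2) (auto simp: abs_mult intro!: mult_right_mono)
  qed measurable
qed

text \<open>Integrating the uniform Taylor remainder of the kernel against an integrable f leaves an
  error of order \<open>|h|^2\<close> times the L^1 norm of f, so the derivative may be taken under
  the integral.\<close>

lemma convol_gradient:
  fixes f :: "'a::euclidean_space \<Rightarrow> real"
  assumes \<rho>: "bump 0 \<epsilon> \<rho>" and G: "\<And>z. GDERIV \<rho> z :> G z" and Gb: "\<And>b. bump 0 \<epsilon> (\<lambda>z. G z \<bullet> b)"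
    and f: "integrable lborel f"
  shows "GDERIV (convol \<rho> f) x :> (\<Sum>b\<in>Basis. convol (\<lambda>z. G z \<bullet> b) f x *\<^sub>R b)"
proof -
  obtain L where L: "L \<ge> 0" "\<And>z h. \<bar>\<rho> (z + h) - \<rho> z - G z \<bullet> h\<bar> \<le> L * (norm h)\<^sup>2"
    using bump_Taylor[OF \<rho> G Gb] by blast
  define D where "D = (\<Sum>b\<in>Basis. convol (\<lambda>z. G z \<bullet> b) f x *\<^sub>R b)"
  define I where "I = (LBINT y. \<bar>f y\<bar>)"
  have Dh: "(LBINT y. (G (x - y) \<bullet> h) * f y) = h \<bullet> D"
    and Dint: "integrable lborel (\<lambda>y. (G (x - y) \<bullet> h) * f y)" for h
  proof -
    have e: "(G (x - y) \<bullet> h) * f y = (\<Sum>b\<in>Basis. (h \<bullet> b) * ((G (x - y) \<bullet> b) * f y))" for y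
      by (subst euclidean_inner) (simp add: sum_distrib_left sum_distrib_right algebra_simps)
    have i: "integrable lborel (\<lambda>y. (G (x - y) \<bullet> b) * f y)" for b
      by (rule convol_integrable[OF Gb f])
    show "integrable lborel (\<lambda>y. (G (x - y) \<bullet> h) * f y)" by (rule i)
    have "(LBINT y. (G (x - y) \<bullet> h) * f y) = (\<Sum>b\<in>Basis. (h \<bullet> b) * convol (\<lambda>z. G z \<bullet> b) f x)"
      unfolding e convol_def using i by simp
    also have "\<dots> = h \<bullet> D" by (simp add: D_def inner_sum_right mult.commute)
    finally show "(LBINT y. (G (x - y) \<bullet> h) * f y) = h \<bullet> D" .
  qed
  have est: "norm (convol \<rho> f (x + h) - convol \<rho> f x - h \<bullet> D) \<le> L * I * (norm h)\<^sup>2" for h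
  proof -
    have "convol \<rho> f (x + h) - convol \<rho> f x - h \<bullet> D
        = (LBINT y. (\<rho> (x + h - y) - \<rho> (x - y) - G (x - y) \<bullet> h) * f y)"
      using convol_integrable[OF \<rho> f, of "x + h"] convol_integrable[OF \<rho> f, of x] Dint[of h]
      by (simp add: convol_def left_diff_distrib Dh[symmetric])
    also have "norm \<dots> \<le> (LBINT y. norm ((\<rho> (x + h - y) - \<rho> (x - y) - G (x - y) \<bullet> h) * f y))"
      by (rule integral_norm_bound)
    also have "\<dots> \<le> (LBINT y. L * (norm h)\<^sup>2 * \<bar>f y\<bar>)"
    proof (rule integral_mono')
      show "integrable lborel (\<lambda>y. L * (norm h)\<^sup>2 * \<bar>f y\<bar>)" using f by simp
      show "norm ((\<rho> (x + h - y) - \<rho> (x - y) - G (x - y) \<bullet> h) * f y) \<le> L * (norm h)\<^sup>2 * \<bar>f y\<bar>" for y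
        using L(2)[of "x - y" h] unfolding diff_add_eq by (auto simp: abs_mult intro!: mult_right_mono)
    qed (use L in auto)
    also have "\<dots> = L * I * (norm h)\<^sup>2" by (simp add: I_def)
    finally show ?thesis .
  qed
  have "((\<lambda>h. norm (convol \<rho> f (x + h) - convol \<rho> f x - h \<bullet> D) / norm h) \<longlongrightarrow> 0) (at 0)"
  proof (rule Lim_null_comparison)
    show "\<forall>\<^sub>F h in at 0. norm (norm (convol \<rho> f (x + h) - convol \<rho> f x - h \<bullet> D) / norm h) \<le> L * I * norm h"
    proof (rule always_eventually, rule allI)
      fix h :: 'a
      show "norm (norm (convol \<rho> f (x + h) - convol \<rho> f x - h \<bullet> D) / norm h) \<le> L * I * norm h"
      proof (cases "h = 0")
        case False
        then show ?thesis using est[of h] by (simp add: field_simps power2_eq_square)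
      qed simp
    qed
    have "((\<lambda>h::'a. L * I * norm h) \<longlongrightarrow> L * I * 0) (at 0)"
      by (intro tendsto_mult tendsto_const tendsto_norm_zero tendsto_ident_at)
    then show "((\<lambda>h::'a. L * I * norm h) \<longlongrightarrow> 0) (at 0)" by simp
  qed
  then have "FDERIV (convol \<rho> f) x :> (\<lambda>h. h \<bullet> D)"
    unfolding has_derivative_at by (auto simp: bounded_linear_inner_left)
  then show ?thesis by (simp add: gderiv_def D_def)
qed

section \<open>Mollification\<close>

lemma GDERIV_unique: "GDERIV f x :> D \<Longrightarrow> GDERIV f x :> D' \<Longrightarrow> D = D'"
  unfolding gderiv_def by (metis has_derivative_unique inner_commute vector_eq_rdot)

definition mollifier :: "nat \<Rightarrow> 'a::euclidean_space \<Rightarrow> real" where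
  "mollifier k z = expinv 0 ((1 / Suc k)\<^sup>2 - z \<bullet> z) / (\<integral>z. expinv 0 ((1 / Suc k)\<^sup>2 - z \<bullet> z) \<partial>(lborel :: 'a measure))"

lemma bump_expinv: "bump 0 \<epsilon> (\<lambda>z. expinv k (\<epsilon>\<^sup>2 - z \<bullet> z))"
  using bump.base[of 0 \<epsilon> k] by simp

text \<open>If the integral were 0, the ball of radius \<open>1 / Suc k\<close>, on which the
  integrand is positive, would be a null set.\<close>

lemma mollifier_mass:
  "(\<integral>z. expinv 0 ((1 / Suc k)\<^sup>2 - z \<bullet> z) \<partial>(lborel :: 'a::euclidean_space measure)) > 0"
proof -
  let ?f = "\<lambda>z::'a. expinv 0 ((1 / Suc k)\<^sup>2 - z \<bullet> z)"
  have i: "integrable lborel ?f" by (rule bump_integrable(1)[OF bump_expinv])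
  have "(LBINT z. ?f z) \<noteq> 0"
  proof
    assume "(LBINT z. ?f z) = 0"
    then have "AE z in lborel. ?f z = 0"
      using integral_nonneg_eq_0_iff_AE[OF i] expinv_nonneg by auto
    then have "AE z in lborel. z \<notin> ball (0::'a) (1 / Suc k)"
    proof eventually_elim
      case (elim z)
      show ?case
      proof
        assume "z \<in> ball 0 (1 / Suc k)"
        then have "(norm z)\<^sup>2 < (1 / Suc k)\<^sup>2" by (intro power_strict_mono) auto
        then have "(1 / Suc k)\<^sup>2 - z \<bullet> z > 0" by (simp add: power2_norm_eq_inner)
        then have "?f z > 0" unfolding expinv_def by simp
        then show False using elim by simp
      qed
    qed
    then have "emeasure lborel (ball (0::'a) (1 / Suc k)) = 0"
      by (subst (asm) AE_iff_measurable[of "ball 0 (1 / Suc k)"]) auto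
    then show False using content_ball_pos[of "1 / Suc k" "0::'a"] by (simp add: measure_def)
  qed
  moreover have "(LBINT z. ?f z) \<ge> 0" by (simp add: expinv_nonneg)
  ultimately show ?thesis by simp
qed

lemma mollifier_bump: "bump 0 (1 / Suc k) (mollifier k)"
proof -
  have "mollifier k = (\<lambda>z::'a. (1 / (\<integral>z. expinv 0 ((1 / Suc k)\<^sup>2 - z \<bullet> z) \<partial>(lborel :: 'a measure)))
      * expinv 0 ((1 / Suc k)\<^sup>2 - z \<bullet> z))"
    by (simp add: fun_eq_iff mollifier_def)
  then show ?thesis by (simp only: bump.scale[OF bump_expinv])
qed

lemma mollifier_nonneg: "mollifier k z \<ge> 0"
  using mollifier_mass[of k, where 'a='a] expinv_nonneg by (simp add: mollifier_def)

lemma mollifier_even: "mollifier k (x - y) = mollifier k (y - x)"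
  by (simp add: mollifier_def inner_diff_left inner_diff_right inner_commute algebra_simps)

lemma mollifier_integral: "(LBINT z. mollifier k z) = 1"
  using mollifier_mass[of k, where 'a='a] by (simp add: mollifier_def)

lemma mollifier_zero: "1 / Suc k \<le> norm z \<Longrightarrow> mollifier k z = 0"
  using bump_zero[OF mollifier_bump[of k], of z] by simp

text \<open>The last clause, symmetry of the Hessian, is read off an explicit formula: uniqueness of
  gradients identifies \<open>G\<close> and \<open>H\<close> with the derivatives of the radial
  expression, which combine \<open>b\<close> with \<open>(z \<bullet> b) z\<close>.\<close>

lemma mollifier_derivatives:
  obtains G :: "'a::euclidean_space \<Rightarrow> 'a" and H :: "'a \<Rightarrow> 'a \<Rightarrow> 'a" where
    "\<And>z. GDERIV (mollifier k) z :> G z" "\<And>b. bump 0 (1 / Suc k) (\<lambda>z. G z \<bullet> b)"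
    "\<And>b z. GDERIV (\<lambda>z. G z \<bullet> b) z :> H b z" "\<And>b c. bump 0 (1 / Suc k) (\<lambda>z. H b z \<bullet> c)"
    "\<And>b c z. H b z \<bullet> c = H c z \<bullet> b"
proof -
  obtain G :: "'a \<Rightarrow> 'a" where G: "\<And>z. GDERIV (mollifier k) z :> G z" "\<And>b. bump 0 (1 / Suc k) (\<lambda>z. G z \<bullet> b)"
    using bump_gradient[OF mollifier_bump] by blast
  have "\<exists>H. (\<forall>z. GDERIV (\<lambda>z. G z \<bullet> b) z :> H z) \<and> (\<forall>c. bump 0 (1 / Suc k) (\<lambda>z. H z \<bullet> c))" for b
    using bump_gradient[OF G(2)[of b]] by metis
  then obtain H where H: "\<And>b z. GDERIV (\<lambda>z. G z \<bullet> b) z :> H b z" "\<And>b c. bump 0 (1 / Suc k) (\<lambda>z. H b z \<bullet> c)"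
    by metis
  define C where "C = (\<integral>z. expinv 0 ((1 / Suc k)\<^sup>2 - z \<bullet> z) \<partial>(lborel :: 'a measure))"
  define s where "s z = (1 / Suc k)\<^sup>2 - z \<bullet> z" for z :: 'a
  have s: "GDERIV s z :> (-2) *\<^sub>R z" for z
    unfolding gderiv_def s_def by (auto intro!: derivative_eq_intros simp: inner_commute)
  have e: "GDERIV (\<lambda>z. expinv m (s z)) z :> (expinv (m+2) (s z) - m * expinv (m+1) (s z)) *\<^sub>R ((-2) *\<^sub>R z)" for m z
    by (rule GDERIV_DERIV_compose[where f = s and g = "expinv m", OF s expinv_deriv])
  \<comment> \<open>For k = 0 the second term in the derivative of \<open>expinv\<close> drops out,
    so only \<open>expinv 2\<close> appears.\<close>
  have Gz: "G z = (expinv 2 (s z) * (-2) / C) *\<^sub>R z" for z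
  proof -
    have "GDERIV (\<lambda>z. (1 / C) * expinv 0 (s z)) z :> (1 / C) *\<^sub>R ((expinv (0+2) (s z) - (0::nat) * expinv (0+1) (s z)) *\<^sub>R ((-2) *\<^sub>R z)) + expinv 0 (s z) *\<^sub>R 0"
      by (rule GDERIV_mult[OF GDERIV_const e])
    moreover have "(\<lambda>z. (1 / C) * expinv 0 (s z)) = mollifier k"
      by (auto simp: mollifier_def fun_eq_iff s_def C_def)
    ultimately show ?thesis using GDERIV_unique[OF G(1)] by (fastforce simp: numeral_2_eq_2)
  qed
  have Hz: "H b z = (-2 / C) *\<^sub>R (expinv 2 (s z) *\<^sub>R b + (z \<bullet> b) *\<^sub>R ((expinv 4 (s z) - 2 * expinv 3 (s z)) *\<^sub>R ((-2) *\<^sub>R z)))" for b z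
  proof -
    have b: "GDERIV (\<lambda>z. z \<bullet> b) z :> b" for z
      unfolding gderiv_def by (auto intro!: derivative_eq_intros)
    have "GDERIV (\<lambda>z. (-2 / C) * (expinv 2 (s z) * (z \<bullet> b))) z :>
      (-2 / C) *\<^sub>R (expinv 2 (s z) *\<^sub>R b + (z \<bullet> b) *\<^sub>R ((expinv (2+2) (s z) - real 2 * expinv (2+1) (s z)) *\<^sub>R ((-2) *\<^sub>R z))) + (expinv 2 (s z) * (z \<bullet> b)) *\<^sub>R 0"
      by (rule GDERIV_mult[OF GDERIV_const GDERIV_mult[OF e b]])
    moreover have "(\<lambda>z. (-2 / C) * (expinv 2 (s z) * (z \<bullet> b))) = (\<lambda>z. G z \<bullet> b)"
      by (auto simp: fun_eq_iff Gz)
    ultimately show ?thesis using GDERIV_unique[OF H(1)[of b z]] by fastforce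
  qed
  have "H b z \<bullet> c = H c z \<bullet> b" for b c z
    unfolding Hz by (simp add: inner_add_left inner_commute algebra_simps)
  with G H show thesis using that by blast
qed

lemma sq_integrable_translation: "sq_integrable f \<Longrightarrow> sq_integrable (\<lambda>x. f (c + x))"
  using lborel_integrable_translation[of "\<lambda>x. (f x)\<^sup>2" c]
  by (auto simp: sq_integrable_def)

lemma convol_mollifier_eq:
  assumes [measurable]: "f \<in> borel_measurable borel"
  shows "convol (mollifier k) f x = (LBINT y. mollifier k y * f (x + y))"
proof -
  have [measurable]: "mollifier k \<in> borel_measurable borel" by (rule bump_measurable[OF mollifier_bump])
  have "convol (mollifier k) f x = (LBINT y. mollifier k (y - x) * f y)"
    by (simp add: convol_def mollifier_even)
  also have "\<dots> = (LBINT y. mollifier k (x + y - x) * f (x + y))"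
    by (rule lborel_integral_translation[symmetric]) measurable
  finally show ?thesis by simp
qed

text \<open>The mollifier is a probability density and the convolution is the mean m of
  \<open>f (x + y)\<close>. The second moment about \<open>f x\<close> exceeds the nonnegative
  variance by exactly \<open>(m - f x)^2\<close>.\<close>

lemma mollifier_Jensen:
  fixes f :: "'a::euclidean_space \<Rightarrow> real"
  assumes f: "sq_integrable f"
  shows "integrable lborel (\<lambda>y. mollifier k y * (f (x + y) - f x)\<^sup>2)"
    and "(convol (mollifier k) f x - f x)\<^sup>2 \<le> (LBINT y. mollifier k y * (f (x + y) - f x)\<^sup>2)"
proof -
  let ?\<rho> = "mollifier k :: 'a \<Rightarrow> real"
  have [measurable]: "f \<in> borel_measurable borel" using f by measurable
  have \<rho>m[measurable]: "?\<rho> \<in> borel_measurable borel" by (rule bump_measurable[OF mollifier_bump])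
  obtain M where M: "M \<ge> 0" "\<And>z. \<bar>?\<rho> z\<bar> \<le> M" using bump_bounded[OF mollifier_bump] by blast
  note fx = sq_integrable_translation[OF f, of x]
  note \<rho> = bump_integrable[OF mollifier_bump[of k, where 'a='a]]
  have i1: "integrable lborel (\<lambda>y. ?\<rho> y * f (x + y))" by (rule sq_integrable_mult[OF \<rho>(2) fx])
  have i2: "integrable lborel (\<lambda>y. ?\<rho> y * (f (x + y))\<^sup>2)"
    using sq_integrable_mult[OF sq_integrable_bounded_mult[OF fx \<rho>m M(2)] fx]
    by (simp add: power2_eq_square mult.assoc)
  have i3: "integrable lborel (\<lambda>y. ?\<rho> y * (f (x + y) - a)\<^sup>2)" for a
  proof -
    have "integrable lborel (\<lambda>y. ?\<rho> y * (f (x + y))\<^sup>2 - 2 * a * (?\<rho> y * f (x + y)) + a\<^sup>2 * ?\<rho> y)"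
      using i1 i2 \<rho>(1) by auto
    then show ?thesis by (simp add: power2_diff algebra_simps)
  qed
  show "integrable lborel (\<lambda>y. ?\<rho> y * (f (x + y) - f x)\<^sup>2)" by (rule i3)
  define m where "m = convol ?\<rho> f x"
  have m: "m = (LBINT y. ?\<rho> y * f (x + y))" by (simp add: m_def convol_mollifier_eq)
  have "0 \<le> (LBINT y. ?\<rho> y * (f (x + y) - m)\<^sup>2)"
    by (intro Bochner_Integration.integral_nonneg mult_nonneg_nonneg mollifier_nonneg) auto
  also have "\<dots> = (LBINT y. ?\<rho> y * (f (x + y) - f x)\<^sup>2 - 2 * (m - f x) * (?\<rho> y * f (x + y)) + (m\<^sup>2 - (f x)\<^sup>2) * ?\<rho> y)"
    by (rule Bochner_Integration.integral_cong) (auto simp: power2_eq_square algebra_simps)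
  also have "\<dots> = (LBINT y. ?\<rho> y * (f (x + y) - f x)\<^sup>2) - 2 * (m - f x) * m + (m\<^sup>2 - (f x)\<^sup>2)"
  proof -
    have iB: "integrable lborel (\<lambda>y. 2 * (m - f x) * (?\<rho> y * f (x + y)))" using i1 by simp
    have iC: "integrable lborel (\<lambda>y. (m\<^sup>2 - (f x)\<^sup>2) * ?\<rho> y)" using \<rho>(1) by simp
    show ?thesis
      by (subst Bochner_Integration.integral_add[OF Bochner_Integration.integrable_diff[OF i3 iB] iC],
          subst Bochner_Integration.integral_diff[OF i3 iB])
         (simp add: mollifier_integral m[symmetric])
  qed
  finally show "(convol ?\<rho> f x - f x)\<^sup>2 \<le> (LBINT y. ?\<rho> y * (f (x + y) - f x)\<^sup>2)"
    by (simp add: m_def power2_eq_square algebra_simps)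
qed

lemma convol_measurable:
  assumes [measurable]: "\<rho> \<in> borel_measurable borel" "f \<in> borel_measurable borel"
  shows "convol \<rho> f \<in> borel_measurable borel"
proof -
  have "convol \<rho> f \<in> borel_measurable lborel"
    unfolding convol_def[abs_def] by (rule lborel.borel_measurable_lebesgue_integral) simp
  then show ?thesis by simp
qed

text \<open>Integrate the Jensen inequality over x and exchange the integrals: only shifts shorter
  than \<open>1 / Suc k\<close> carry mass. The argument uses nonnegative integrals, so
  square-integrability is a by-product.\<close>

lemma mollifier_L2_bound:
  fixes f :: "'a::euclidean_space \<Rightarrow> real"
  assumes f: "sq_integrable f"
    and e: "\<And>y. norm y < 1 / Suc k \<Longrightarrow> (LBINT x. (f (y + x) - f x)\<^sup>2) \<le> e" and e0: "e \<ge> 0"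
  shows "sq_integrable (\<lambda>x. convol (mollifier k) f x - f x)"
    "(LBINT x. (convol (mollifier k) f x - f x)\<^sup>2) \<le> e"
proof -
  let ?\<rho> = "mollifier k :: 'a \<Rightarrow> real"
  have [measurable]: "f \<in> borel_measurable borel" using f by measurable
  have [measurable]: "?\<rho> \<in> borel_measurable borel" by (rule bump_measurable[OF mollifier_bump])
  have [measurable]: "convol ?\<rho> f \<in> borel_measurable borel" by (rule convol_measurable) auto
  have "(\<integral>\<^sup>+x. ennreal ((convol ?\<rho> f x - f x)\<^sup>2) \<partial>lborel)
      \<le> (\<integral>\<^sup>+x. (\<integral>\<^sup>+y. ennreal (?\<rho> y * (f (x + y) - f x)\<^sup>2) \<partial>lborel) \<partial>lborel)"
  proof (rule nn_integral_mono)
    fix x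
    show "ennreal ((convol ?\<rho> f x - f x)\<^sup>2) \<le> (\<integral>\<^sup>+y. ennreal (?\<rho> y * (f (x + y) - f x)\<^sup>2) \<partial>lborel)"
      using mollifier_Jensen[OF f, of k x]
      by (subst nn_integral_eq_integral) (auto simp: mollifier_nonneg ennreal_leI)
  qed
  also have "\<dots> = (\<integral>\<^sup>+y. (\<integral>\<^sup>+x. ennreal (?\<rho> y * (f (x + y) - f x)\<^sup>2) \<partial>lborel) \<partial>lborel)"
    by (rule lborel_pair.Fubini'[symmetric]) measurable
  also have "\<dots> \<le> (\<integral>\<^sup>+y. ennreal (?\<rho> y) * ennreal e \<partial>lborel)"
  proof (rule nn_integral_mono)
    fix y :: 'a
    show "(\<integral>\<^sup>+x. ennreal (?\<rho> y * (f (x + y) - f x)\<^sup>2) \<partial>lborel) \<le> ennreal (?\<rho> y) * ennreal e"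
    proof (cases "norm y < 1 / Suc k")
      case True
      have i: "integrable lborel (\<lambda>x. (f (y + x) - f x)\<^sup>2)"
        using sq_integrable_diff[OF sq_integrable_translation[OF f] f] by (simp add: sq_integrable_def)
      have "(\<integral>\<^sup>+x. ennreal (?\<rho> y * (f (x + y) - f x)\<^sup>2) \<partial>lborel) = ennreal (?\<rho> y) * (\<integral>\<^sup>+x. ennreal ((f (y + x) - f x)\<^sup>2) \<partial>lborel)"
        by (simp add: ennreal_mult' mollifier_nonneg nn_integral_cmult add.commute)
      also have "(\<integral>\<^sup>+x. ennreal ((f (y + x) - f x)\<^sup>2) \<partial>lborel) = ennreal (LBINT x. (f (y + x) - f x)\<^sup>2)"
        by (rule nn_integral_eq_integral[OF i]) simp
      also have "\<dots> \<le> ennreal e" using e[OF True] by (rule ennreal_leI)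
      finally show ?thesis by (simp add: mult_left_mono)
    next
      case False
      then show ?thesis using mollifier_zero[of k y] by simp
    qed
  qed
  also have "\<dots> = ennreal (LBINT y. ?\<rho> y) * ennreal e"
    by (subst nn_integral_multc, measurable, subst nn_integral_eq_integral)
       (auto simp: bump_integrable(1)[OF mollifier_bump] mollifier_nonneg)
  also have "\<dots> = ennreal e" by (simp add: mollifier_integral)
  finally have b: "(\<integral>\<^sup>+x. ennreal ((convol ?\<rho> f x - f x)\<^sup>2) \<partial>lborel) \<le> ennreal e" .
  have "integrable lborel (\<lambda>x. (convol ?\<rho> f x - f x)\<^sup>2)"
    by (rule integrableI_nonneg) (use b in \<open>auto simp: less_top[symmetric] top_unique\<close>)
  then show "sq_integrable (\<lambda>x. convol ?\<rho> f x - f x)" by (simp add: sq_integrable_def)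
  show "(LBINT x. (convol ?\<rho> f x - f x)\<^sup>2) \<le> e"
    using b e0 by (subst integral_eq_nn_integral) (auto simp: enn2real_leI)
qed

theorem convol_mollifier_L2_tendsto:
  fixes f :: "'a::euclidean_space \<Rightarrow> real"
  assumes f: "sq_integrable f"
  shows "L2_tendsto (\<lambda>k. convol (mollifier k) f) f"
proof -
  define \<omega> where "\<omega> y = (LBINT x. (f (y + x) - f x)\<^sup>2)" for y
  have \<omega>0: "\<omega> y \<ge> 0" for y by (simp add: \<omega>_def)
  have "(\<omega> \<longlongrightarrow> 0) (at 0)"
    unfolding tendsto_at_iff_sequentially comp_def \<omega>_def
    using sq_integrable_translation_continuous[OF f] by auto
  then have small: "\<exists>d>0. \<forall>y. norm y < d \<longrightarrow> \<omega> y < e" if "e > 0" for e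
  proof -
    obtain d where d: "d > 0" "\<And>y. y \<noteq> 0 \<Longrightarrow> norm y < d \<Longrightarrow> \<omega> y < e"
      using \<open>(\<omega> \<longlongrightarrow> 0) (at 0)\<close> \<open>e > 0\<close> unfolding LIM_eq by (auto simp: \<omega>0)
    have "\<omega> 0 = 0" by (simp add: \<omega>_def)
    then show ?thesis using d \<open>e > 0\<close> by metis
  qed
  \<comment> \<open>This crude bound holds for all shifts and serves only to show that the
    convolution is square-integrable; the convergence rests on \<open>small\<close>.\<close>
  have \<omega>bd: "\<omega> y \<le> 4 * (LBINT x. (f x)\<^sup>2)" for y
  proof -
    have [measurable]: "f \<in> borel_measurable borel" using f by measurable
    have i: "integrable lborel (\<lambda>x. (f x)\<^sup>2)" "integrable lborel (\<lambda>x. (f (y + x))\<^sup>2)"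
      using f sq_integrable_translation[OF f, of y] by (auto simp: sq_integrable_def)
    have "\<omega> y \<le> (LBINT x. 2 * (f (y + x))\<^sup>2 + 2 * (f x)\<^sup>2)"
      unfolding \<omega>_def
    proof (rule integral_mono')
      show "(f (y + x) - f x)\<^sup>2 \<le> 2 * (f (y + x))\<^sup>2 + 2 * (f x)\<^sup>2" for x
        using zero_le_power2[of "f (y + x) + f x"] by (simp add: power2_sum power2_diff)
    qed (use i in auto)
    also have "\<dots> = 2 * (LBINT x. (f (y + x))\<^sup>2) + 2 * (LBINT x. (f x)\<^sup>2)" using i by simp
    also have "(LBINT x. (f (y + x))\<^sup>2) = (LBINT x. (f x)\<^sup>2)"
      by (rule lborel_integral_translation) measurable
    finally show ?thesis by simp
  qed
  have s: "sq_integrable (convol (mollifier k) f)" for k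
  proof -
    have "sq_integrable (\<lambda>x. convol (mollifier k) f x - f x)"
      by (rule mollifier_L2_bound(1)[OF f \<omega>bd[unfolded \<omega>_def]]) auto
    from sq_integrable_add[OF this f] show ?thesis by simp
  qed
  have "(\<lambda>k. LBINT x. (convol (mollifier k) f x - f x)\<^sup>2) \<longlonglongrightarrow> 0"
  proof (rule LIMSEQ_I)
    fix r :: real assume "r > 0"
    then obtain d where d: "d > 0" "\<And>y. norm y < d \<Longrightarrow> \<omega> y < r / 2" using small[of "r / 2"] by auto
    obtain N where N: "inverse (real (Suc N)) < d" using reals_Archimedean[OF d(1)] by blast
    have "norm ((LBINT x. (convol (mollifier k) f x - f x)\<^sup>2) - 0) < r" if "k \<ge> N" for k
    proof -
      have "1 / real (Suc k) \<le> inverse (real (Suc N))" using that by (simp add: field_simps)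
      then have *: "norm y < 1 / Suc k \<Longrightarrow> \<omega> y \<le> r / 2" for y using d(2)[of y] N by auto
      have "(LBINT x. (convol (mollifier k) f x - f x)\<^sup>2) \<le> r / 2"
        by (rule mollifier_L2_bound(2)[OF f *[unfolded \<omega>_def]]) (use \<open>r > 0\<close> in auto)
      then show ?thesis using \<open>r > 0\<close> by simp
    qed
    then show "\<exists>N. \<forall>k\<ge>N. norm ((LBINT x. (convol (mollifier k) f x - f x)\<^sup>2) - 0) < r" by blast
  qed
  with s f show ?thesis by (simp add: L2_tendsto_def)
qed

text \<open>On S the error \<open>(convol (mollifier k) f x - f x)^2\<close> equals
  \<open>(f x)^2\<close>, so the integral of the latter over S is bounded by a null
  sequence.\<close>

lemma AE_zero_if_convol_zero:
  fixes f :: "'a::euclidean_space \<Rightarrow> real"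
  assumes f: "sq_integrable f" and S: "S \<in> sets borel"
    and z: "\<And>k x. k \<ge> N \<Longrightarrow> x \<in> S \<Longrightarrow> convol (mollifier k) f x = 0"
  shows "AE x in lborel. x \<in> S \<longrightarrow> f x = 0"
proof -
  let ?I = "LBINT x. (indicator S x * f x)\<^sup>2"
  note c = convol_mollifier_L2_tendsto[OF f]
  have i: "integrable lborel (\<lambda>x. (indicator S x * f x)\<^sup>2)"
    using sq_integrable_indicator[OF f S] by (simp add: sq_integrable_def)
  have "?I \<le> (LBINT x. (convol (mollifier k) f x - f x)\<^sup>2)" if "k \<ge> N" for k
  proof (rule integral_mono[OF i])
    show "integrable lborel (\<lambda>x. (convol (mollifier k) f x - f x)\<^sup>2)"
      using sq_integrable_diff[OF L2_tendstoD(1)[OF c] f] by (simp add: sq_integrable_def)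
    show "(indicator S x * f x)\<^sup>2 \<le> (convol (mollifier k) f x - f x)\<^sup>2" for x
      using z[OF that, of x] by (auto simp: indicator_def)
  qed
  then have "?I \<le> 0"
    by (intro LIMSEQ_le_const[OF L2_tendstoD(3)[OF c]]) auto
  then have "?I = 0" by (simp add: antisym)
  then have "AE x in lborel. (indicator S x * f x)\<^sup>2 = 0"
    using integral_nonneg_eq_0_iff_AE[OF i] by simp
  then show ?thesis by eventually_elim (auto simp: indicator_def)
qed

section \<open>Regularization of weak solutions of the Poisson equation\<close>

lemma integrable_indicator_compact:
  fixes C :: "'a::euclidean_space set"
  assumes "compact C" shows "integrable lborel (indicator C :: 'a \<Rightarrow> real)"
  using assms emeasure_bounded_finite[OF compact_imp_bounded[OF assms]] by (simp add: compact_imp_closed)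

lemma sq_integrable_indicator_compact:
  fixes C :: "'a::euclidean_space set"
  assumes "compact C" shows "sq_integrable (indicator C :: 'a \<Rightarrow> real)"
  using integrable_indicator_compact[OF assms] assms
  by (simp add: sq_integrable_def compact_imp_closed power2_eq_square indicator_inter_arith[symmetric])

text \<open>\<open>H x\<close> is the Hessian as a linear map. Its symmetry is a field of its own
  because the Rellich identity needs it; for mollified functions it comes from the explicit second
  derivatives of the mollifier.\<close>

locale C2_compact_support =
  fixes w :: "'a::euclidean_space \<Rightarrow> real" and D :: "'a \<Rightarrow> 'a" and H :: "'a \<Rightarrow> 'a \<Rightarrow> 'a" and C :: "'a set"
  assumes w: "\<And>x. GDERIV w x :> D x" and D: "\<And>x. (D has_derivative H x) (at x)"
    and sym: "\<And>x a c. H x a \<bullet> c = H x c \<bullet> a" and H: "\<And>a. continuous_on UNIV (\<lambda>x. H x a)"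
    and w0: "\<And>x. x \<notin> C \<Longrightarrow> w x = 0" and D0: "\<And>x. x \<notin> C \<Longrightarrow> D x = 0" and C: "compact C"

lemma GDERIV_reflect:
  fixes \<rho> :: "'a::real_inner \<Rightarrow> real"
  assumes "\<And>z. GDERIV \<rho> z :> G z" shows "GDERIV (\<lambda>y. \<rho> (x - y)) y :> - G (x - y)"
proof -
  have "((\<lambda>y. x - y) has_derivative (\<lambda>h. - h)) (at y)" by (auto intro!: derivative_eq_intros)
  from has_derivative_compose[OF this assms[unfolded gderiv_def]]
  show ?thesis by (simp add: gderiv_def)
qed

text \<open>The weak form of \<open>\<Delta>u = h\<close> with weak gradient V, tested with bumps
  only. The \<open>margin\<close> says that u and V already vanish in a uniform neighbourhood of the
  complement of C, so that mollification with a small radius keeps the support inside C.\<close>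

locale weak_poisson =
  fixes u :: "'a::euclidean_space \<Rightarrow> real" and V :: "'a \<Rightarrow> 'a" and h :: "'a \<Rightarrow> real" and C :: "'a set"
  assumes u: "sq_integrable u" and V: "\<And>b. b \<in> Basis \<Longrightarrow> sq_integrable (\<lambda>x. V x \<bullet> b)"
    and h: "sq_integrable h" and C: "compact C"
    and margin: "\<exists>\<delta>>0. \<forall>x y. x \<notin> C \<longrightarrow> dist x y < \<delta> \<longrightarrow> u y = 0 \<and> V y = 0"
    and weak_gradient: "\<And>y \<epsilon> \<eta> G b. bump y \<epsilon> \<eta> \<Longrightarrow> (\<And>z. GDERIV \<eta> z :> G z) \<Longrightarrow> b \<in> Basis \<Longrightarrow>
      (LBINT z. u z * (G z \<bullet> b)) = - (LBINT z. \<eta> z * (V z \<bullet> b))"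
    and weak_laplacian: "\<And>y \<epsilon> \<eta> G. bump y \<epsilon> \<eta> \<Longrightarrow> (\<And>z. GDERIV \<eta> z :> G z) \<Longrightarrow>
      (LBINT z. V z \<bullet> G z) = - (LBINT z. h z * \<eta> z)"
begin

lemma support: "x \<notin> C \<Longrightarrow> u x = 0" "x \<notin> C \<Longrightarrow> V x = 0"
  using margin by (metis dist_self)+

lemma C_borel [measurable]: "C \<in> sets borel"
  using C by (simp add: compact_imp_closed)

lemma integrable_u: "integrable lborel u"
proof -
  have "integrable lborel (\<lambda>x. indicator C x * u x)"
    by (rule sq_integrable_mult[OF sq_integrable_indicator_compact[OF C] u])
  moreover have "(\<lambda>x. indicator C x * u x) = u" using support by (auto simp: indicator_def fun_eq_iff)
  ultimately show ?thesis by simp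
qed

text \<open>The weak gradient moves the derivative from the kernel to u; the minus sign of the
  integration by parts cancels against that of the reflected kernel.\<close>

lemma convol_weak_gradient:
  assumes \<rho>: "bump 0 \<epsilon> \<rho>" and G: "\<And>z. GDERIV \<rho> z :> G z" and b: "b \<in> Basis"
  shows "convol (\<lambda>z. G z \<bullet> b) u x = convol \<rho> (\<lambda>z. V z \<bullet> b) x"
  using weak_gradient[OF bump_reflect[OF \<rho>, of x] GDERIV_reflect[OF G] b]
  by (simp add: convol_def mult.commute)

text \<open>One derivative is moved off the kernel by the weak gradient, the second by the weak
  equation.\<close>

lemma convol_weak_laplacian:
  assumes \<rho>: "bump 0 \<epsilon> \<rho>" and G: "\<And>z. GDERIV \<rho> z :> G z" and Gb: "\<And>b. bump 0 \<epsilon> (\<lambda>z. G z \<bullet> b)"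
    and H: "\<And>b z. GDERIV (\<lambda>z. G z \<bullet> b) z :> H b z"
  shows "(\<Sum>b\<in>Basis. convol (\<lambda>z. H b z \<bullet> b) u x) = convol \<rho> h x"
proof -
  have i: "integrable lborel (\<lambda>y. (G (x - y) \<bullet> b) * (V y \<bullet> b))" if "b \<in> Basis" for b
    using bump_integrable(2)[OF bump_reflect[OF Gb]] V[OF that] by (rule sq_integrable_mult)
  have "(\<Sum>b\<in>Basis. convol (\<lambda>z. H b z \<bullet> b) u x) = (\<Sum>b\<in>Basis. convol (\<lambda>z. G z \<bullet> b) (\<lambda>z. V z \<bullet> b) x)"
    by (intro sum.cong refl convol_weak_gradient[OF Gb H]) auto
  also have "\<dots> = (LBINT y. (\<Sum>b\<in>Basis. (G (x - y) \<bullet> b) * (V y \<bullet> b)))"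
    using i by (simp add: convol_def)
  also have "\<dots> = (LBINT y. V y \<bullet> G (x - y))"
    by (subst euclidean_inner) (simp add: mult.commute)
  also have "\<dots> = convol \<rho> h x"
    using weak_laplacian[OF bump_reflect[OF \<rho>, of x] GDERIV_reflect[OF G]]
    by (simp add: convol_def mult.commute)
  finally show ?thesis .
qed

text \<open>The approximations are the mollifications of u. Of their Hessians only the trace is
  claimed to converge, since the second derivatives of u are known in L^2 only through h.\<close>

lemma regularization:
  obtains w :: "nat \<Rightarrow> 'a \<Rightarrow> real" and D :: "nat \<Rightarrow> 'a \<Rightarrow> 'a" and H :: "nat \<Rightarrow> 'a \<Rightarrow> 'a \<Rightarrow> 'a" where
    "\<And>k. C2_compact_support (w k) (D k) (H k) C"
    "L2_tendsto w u" "\<And>b. b \<in> Basis \<Longrightarrow> L2_tendsto (\<lambda>k x. D k x \<bullet> b) (\<lambda>x. V x \<bullet> b)"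
    "L2_tendsto (\<lambda>k x. \<Sum>b\<in>Basis. H k x b \<bullet> b) h"
proof -
  obtain \<delta> where \<delta>: "\<delta> > 0" "\<And>x y. x \<notin> C \<Longrightarrow> dist x y < \<delta> \<Longrightarrow> u y = 0 \<and> V y = 0" using margin by blast
  \<comment> \<open>Shifting the index by N makes all radii smaller than the margin \<delta>, so
    every approximation is supported in C, not only those with large index.\<close>
  obtain N where N: "inverse (real (Suc N)) < \<delta>" using reals_Archimedean[OF \<delta>(1)] by blast
  define P where "P k G H \<longleftrightarrow> (\<forall>z. GDERIV (mollifier k) z :> G z) \<and> (\<forall>b. bump 0 (1 / Suc k) (\<lambda>z. G z \<bullet> b)) \<and>
     (\<forall>b z. GDERIV (\<lambda>z. G z \<bullet> b) z :> H b z) \<and> (\<forall>b c. bump 0 (1 / Suc k) (\<lambda>z. H b z \<bullet> c)) \<and>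
     (\<forall>b c z::'a. H b z \<bullet> c = H c z \<bullet> b)" for k and G :: "'a \<Rightarrow> 'a" and H :: "'a \<Rightarrow> 'a \<Rightarrow> 'a"
  have "\<exists>GH. P k (fst GH) (snd GH)" for k
  proof -
    obtain G :: "'a \<Rightarrow> 'a" and H :: "'a \<Rightarrow> 'a \<Rightarrow> 'a" where
      "\<And>z. GDERIV (mollifier k) z :> G z" "\<And>b. bump 0 (1 / Suc k) (\<lambda>z. G z \<bullet> b)"
      "\<And>b z. GDERIV (\<lambda>z. G z \<bullet> b) z :> H b z" "\<And>b c. bump 0 (1 / Suc k) (\<lambda>z. H b z \<bullet> c)"
      "\<And>b c z. H b z \<bullet> c = H c z \<bullet> b" by (rule mollifier_derivatives[of k]) (rule that)
    then have "P k G H" unfolding P_def by (intro conjI allI)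
    then show ?thesis by (intro exI[of _ "(G, H)"]) simp
  qed
  then obtain GH where GH: "\<And>k. P k (fst (GH k)) (snd (GH k))" by metis
  define G where "G k = fst (GH k)" for k
  define H where "H k = snd (GH k)" for k
  have P: "P k (G k) (H k)" for k using GH by (simp add: G_def H_def)
  have G: "\<And>k z. GDERIV (mollifier k) z :> G k z" "\<And>k b. bump 0 (1 / Suc k) (\<lambda>z. G k z \<bullet> b)"
    and H: "\<And>k b z. GDERIV (\<lambda>z. G k z \<bullet> b) z :> H k b z" "\<And>k b c. bump 0 (1 / Suc k) (\<lambda>z. H k b z \<bullet> c)"
     "\<And>k b c z. H k b z \<bullet> c = H k c z \<bullet> b" using P[unfolded P_def] by simp_all
  define w where "w k = convol (mollifier (k + N)) u" for k
  define D where "D k x = (\<Sum>b\<in>Basis. convol (\<lambda>z. G (k + N) z \<bullet> b) u x *\<^sub>R b)" for k x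
  define L where "L k x a = (\<Sum>b\<in>Basis. (\<Sum>c\<in>Basis. (a \<bullet> c) * convol (\<lambda>z. H (k + N) b z \<bullet> c) u x) *\<^sub>R b)" for k x a
  have Db: "D k x \<bullet> b = convol (\<lambda>z. G (k + N) z \<bullet> b) u x" if "b \<in> Basis" for k x b
    using that by (simp add: D_def inner_sum_left inner_Basis if_distrib cong: if_cong)
  have Lb: "L k x a \<bullet> b = (\<Sum>c\<in>Basis. (a \<bullet> c) * convol (\<lambda>z. H (k + N) b z \<bullet> c) u x)" if "b \<in> Basis" for k x a b
    using that by (simp add: L_def inner_sum_left inner_Basis if_distrib cong: if_cong)
  have out: "x - y \<noteq> 0 \<and> norm (x - y) \<ge> 1 / Suc (k + N)" if "x \<notin> C" "u y \<noteq> 0" for k x y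
  proof -
    have "dist x y \<ge> \<delta>" using \<delta>(2)[OF that(1), of y] that(2) by force
    moreover have "1 / real (Suc (k + N)) \<le> inverse (real (Suc N))" by (simp add: field_simps)
    ultimately show ?thesis using N \<delta>(1) by (auto simp: dist_norm)
  qed
  have vanish: "convol \<rho> u x = 0" if "bump 0 (1 / Suc (k + N)) \<rho>" "x \<notin> C" for k x and \<rho> :: "'a \<Rightarrow> real"
  proof -
    have "\<rho> (x - y) * u y = 0" for y
      using bump_zero[OF that(1), of "x - y"] out[OF that(2), of y k] by (cases "u y = 0") auto
    then show ?thesis by (simp only: convol_def) simp
  qed
  have cont: "continuous_on UNIV (convol \<rho> u)" if \<rho>: "bump 0 \<epsilon> \<rho>" for \<epsilon> and \<rho> :: "'a \<Rightarrow> real"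
  proof -
    obtain G where "\<And>z. GDERIV \<rho> z :> G z" "\<And>b. bump 0 \<epsilon> (\<lambda>z. G z \<bullet> b)" using bump_gradient[OF \<rho>] by blast
    from convol_gradient[OF \<rho> this integrable_u] show ?thesis
      by (meson continuous_at_imp_continuous_on gderiv_def has_derivative_continuous)
  qed
  have N_L2: "L2_tendsto (\<lambda>k. convol (mollifier (k + N)) f) f" if "sq_integrable f" for f :: "'a \<Rightarrow> real"
    using convol_mollifier_L2_tendsto[OF that] LIMSEQ_ignore_initial_segment
    unfolding L2_tendsto_def by blast
  show thesis
  proof (rule that[of w D L])
    fix k show "C2_compact_support (w k) (D k) (L k) C"
    proof
      show "GDERIV (w k) x :> D k x" for x
        unfolding w_def D_def by (rule convol_gradient[OF mollifier_bump G integrable_u])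
      show "(D k has_derivative L k x) (at x)" for x
      proof (rule has_derivative_componentwise_within[THEN iffD2], rule ballI)
        fix b :: 'a assume b: "b \<in> Basis"
        have "GDERIV (convol (\<lambda>z. G (k + N) z \<bullet> b) u) x :> (\<Sum>c\<in>Basis. convol (\<lambda>z. H (k + N) b z \<bullet> c) u x *\<^sub>R c)"
          by (rule convol_gradient[OF G(2) H(1) H(2) integrable_u])
        then show "((\<lambda>x. D k x \<bullet> b) has_derivative (\<lambda>a. L k x a \<bullet> b)) (at x)"
          using b by (simp add: Db Lb gderiv_def inner_sum_right mult.commute)
      qed
      show "L k x a \<bullet> c = L k x c \<bullet> a"  for x a c
      proof -
        define T where "T i j = convol (\<lambda>z. H (k + N) i z \<bullet> j) u x" for i j
        have T: "T i j = T j i" for i j unfolding T_def by (subst H(3)) simp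
        have e: "L k x a \<bullet> c = (\<Sum>i\<in>Basis. \<Sum>j\<in>Basis. (a \<bullet> j) * T i j * (c \<bullet> i))" for a c
          by (simp add: euclidean_inner[of "L k x a" c] Lb sum_distrib_right T_def)
        have "L k x a \<bullet> c = (\<Sum>j\<in>Basis. \<Sum>i\<in>Basis. (a \<bullet> j) * T i j * (c \<bullet> i))"
          unfolding e by (rule sum.swap)
        also have "\<dots> = L k x c \<bullet> a"
          unfolding e by (intro sum.cong refl) (subst T, simp add: mult_ac)
        finally show ?thesis .
      qed
      show "continuous_on UNIV (\<lambda>x. L k x a)" for a
        unfolding L_def by (intro continuous_intros cont[OF H(2)])
      show "x \<notin> C \<Longrightarrow> w k x = 0" for x unfolding w_def by (rule vanish[OF mollifier_bump])
      show "x \<notin> C \<Longrightarrow> D k x = 0" for x unfolding D_def using vanish[OF G(2)] by simp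
    qed (rule C)
  next
    show "L2_tendsto w u" unfolding w_def[abs_def] by (rule N_L2[OF u])
    show "L2_tendsto (\<lambda>k x. D k x \<bullet> b) (\<lambda>x. V x \<bullet> b)" if "b \<in> Basis" for b
      using N_L2[OF V[OF that]] by (simp add: Db[OF that] convol_weak_gradient[OF mollifier_bump G(1) that])
    have "(\<Sum>b\<in>Basis. L k x b \<bullet> b) = convol (mollifier (k + N)) h x" for k x
    proof -
      have "(\<Sum>b\<in>Basis. L k x b \<bullet> b) = (\<Sum>b\<in>Basis. convol (\<lambda>z. H (k + N) b z \<bullet> b) u x)"
        by (intro sum.cong refl) (simp add: Lb inner_Basis if_distrib[of "\<lambda>t. t * _"] cong: if_cong)
      also have "\<dots> = convol (mollifier (k + N)) h x"
        by (rule convol_weak_laplacian[OF mollifier_bump G H(1)])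
      finally show ?thesis .
    qed
    then show "L2_tendsto (\<lambda>k x. \<Sum>b\<in>Basis. L k x b \<bullet> b) h" using N_L2[OF h] by simp
  qed
qed

end

section \<open>Integral identities\<close>

lemma GDERIV_continuous_on:
  assumes "\<And>x. x \<in> C \<Longrightarrow> GDERIV m x :> Dm x"
  shows "continuous_on C m"
  by (rule has_derivative_continuous_on)
     (rule has_derivative_at_withinI, erule assms[unfolded gderiv_def])

context C2_compact_support
begin

lemma continuous: "continuous_on C w" "continuous_on C D" "continuous_on C (\<lambda>x. H x a)"
proof -
  show "continuous_on C w" by (rule GDERIV_continuous_on[OF w])
  show "continuous_on C D" by (rule has_derivative_continuous_on) (rule has_derivative_at_withinI, rule D)
  show "continuous_on C (\<lambda>x. H x a)" using H continuous_on_subset by blast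
qed

lemma w_deriv: "(w has_derivative (\<lambda>a. a \<bullet> D x)) (at x)"
  using w by (simp add: gderiv_def)

lemma basis_sums:
  "(\<Sum>b\<in>Basis. (b \<bullet> y) * (z \<bullet> b)) = y \<bullet> (z::'a)" "(\<Sum>b\<in>Basis. (y \<bullet> b) * (b \<bullet> z)) = y \<bullet> (z::'a)"
  "(\<Sum>b\<in>Basis. (b \<bullet> y) * (b \<bullet> z)) = y \<bullet> (z::'a)" "(\<Sum>b\<in>Basis. (y \<bullet> b) * (z \<bullet> b)) = y \<bullet> (z::'a)"
  by (simp_all add: euclidean_inner[of y z] inner_commute mult.commute)

lemma H_sum: "(\<Sum>b\<in>Basis. (y \<bullet> H x b) * (b \<bullet> z)) = H x z \<bullet> y" "(\<Sum>b\<in>Basis. (y \<bullet> H x b) * (z \<bullet> b)) = H x z \<bullet> y"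
proof -
  have "(\<Sum>b\<in>Basis. (y \<bullet> H x b) * (b \<bullet> z)) = (\<Sum>b\<in>Basis. (H x y \<bullet> b) * (b \<bullet> z))"
    by (simp add: inner_commute[of y] sym[of x _ y])
  also have "\<dots> = H x y \<bullet> z" by (simp add: basis_sums)
  finally show "(\<Sum>b\<in>Basis. (y \<bullet> H x b) * (b \<bullet> z)) = H x z \<bullet> y" by (simp add: sym)
  then show "(\<Sum>b\<in>Basis. (y \<bullet> H x b) * (z \<bullet> b)) = H x z \<bullet> y" by (simp add: inner_commute)
qed

text \<open>Divergence of \<open>(m w) \<nabla>w\<close>. The factor 1 in the last term gives all
  summands the shape coefficient times product, which the limit lemmas match.\<close>

lemma energy_identity:
  assumes m: "\<And>x. x \<in> C \<Longrightarrow> GDERIV m x :> Dm x" and Dm: "continuous_on C Dm"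
  shows "(LBINT x. indicator C x * (m x * (w x * (\<Sum>b\<in>Basis. H x b \<bullet> b)) + m x * (D x \<bullet> D x) + 1 * (w x * (Dm x \<bullet> D x)))) = 0"
proof -
  define F' where "F' x a = (m x * w x) *\<^sub>R H x a + (m x * (a \<bullet> D x) + (a \<bullet> Dm x) * w x) *\<^sub>R D x" for x a
  have "(LBINT x. indicator C x * (\<Sum>b\<in>Basis. F' x b \<bullet> b)) = 0"
  proof (rule integral_divergence_compact_support[OF C, where F = "\<lambda>x. (m x * w x) *\<^sub>R D x"])
    show "((\<lambda>x. (m x * w x) *\<^sub>R D x) has_derivative F' x) (at x)" if "x \<in> C" for x
      unfolding F'_def
      by (rule derivative_eq_intros m[OF that, unfolded gderiv_def] w_deriv D refl)+
    show "continuous_on C (\<lambda>x. F' x b)" for b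
      unfolding F'_def by (intro continuous_intros continuous GDERIV_continuous_on[OF m] Dm)
  qed (use w0 in auto)
  moreover have "(\<Sum>b\<in>Basis. F' x b \<bullet> b)
     = m x * (w x * (\<Sum>b\<in>Basis. H x b \<bullet> b)) + m x * (D x \<bullet> D x) + w x * (Dm x \<bullet> D x)" for x
  proof -
    have "(\<Sum>b\<in>Basis. F' x b \<bullet> b) = (\<Sum>b\<in>Basis. m x * w x * (H x b \<bullet> b) + m x * ((b \<bullet> D x) * (D x \<bullet> b)) + w x * ((b \<bullet> Dm x) * (D x \<bullet> b)))"
      by (simp add: F'_def inner_add_left algebra_simps)
    then show ?thesis by (simp add: sum.distrib sum_distrib_left[symmetric] basis_sums)
  qed
  ultimately show ?thesis by simp
qed

text \<open>Divergence of \<open>m (x \<bullet> \<nabla>w) \<nabla>w - (m / 2) |\<nabla>w|\<^sup>2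
  x\<close>. The two terms in which the full Hessian is paired with x and \<nabla>w cancel by
  symmetry, so only its trace survives.\<close>

lemma Rellich_identity:
  fixes m :: "'a \<Rightarrow> real"
  assumes m: "\<And>x. x \<in> C \<Longrightarrow> GDERIV m x :> Dm x" and Dm: "continuous_on C Dm"
  shows "(LBINT x. indicator C x * (m x * ((x \<bullet> D x) * (\<Sum>b\<in>Basis. H x b \<bullet> b))
     + (m x - (Dm x \<bullet> x + DIM('a) * m x) / 2) * (D x \<bullet> D x) + 1 * ((Dm x \<bullet> D x) * (x \<bullet> D x)))) = 0"
proof -
  define F' where "F' x a = (m x * (x \<bullet> D x)) *\<^sub>R H x a + (m x * (x \<bullet> H x a + a \<bullet> D x) + (a \<bullet> Dm x) * (x \<bullet> D x)) *\<^sub>R D x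
     - ((m x * (D x \<bullet> D x) / 2) *\<^sub>R a + ((m x * (D x \<bullet> H x a + H x a \<bullet> D x) + (a \<bullet> Dm x) * (D x \<bullet> D x)) / 2) *\<^sub>R x)" for x a
  have "(LBINT x. indicator C x * (\<Sum>b\<in>Basis. F' x b \<bullet> b)) = 0"
  proof (rule integral_divergence_compact_support[OF C, where F = "\<lambda>x. (m x * (x \<bullet> D x)) *\<^sub>R D x - (m x * (D x \<bullet> D x) / 2) *\<^sub>R x"])
    show "((\<lambda>x. (m x * (x \<bullet> D x)) *\<^sub>R D x - (m x * (D x \<bullet> D x) / 2) *\<^sub>R x) has_derivative F' x) (at x)" if "x \<in> C" for x
      unfolding F'_def
      by (rule derivative_eq_intros m[OF that, unfolded gderiv_def] D refl | simp)+
    show "continuous_on C (\<lambda>x. F' x b)" for b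
      unfolding F'_def by (intro continuous_intros continuous GDERIV_continuous_on[OF m] Dm) auto
  qed (use D0 in auto)
  moreover have "(\<Sum>b\<in>Basis. F' x b \<bullet> b) = m x * ((x \<bullet> D x) * (\<Sum>b\<in>Basis. H x b \<bullet> b))
     + (m x - (Dm x \<bullet> x + DIM('a) * m x) / 2) * (D x \<bullet> D x) + (Dm x \<bullet> D x) * (x \<bullet> D x)" for x
  proof -
    have "(\<Sum>b\<in>Basis. F' x b \<bullet> b) = (\<Sum>b\<in>Basis. m x * (x \<bullet> D x) * (H x b \<bullet> b)
       + m x * ((x \<bullet> H x b) * (D x \<bullet> b)) + m x * ((b \<bullet> D x) * (D x \<bullet> b)) + (x \<bullet> D x) * ((b \<bullet> Dm x) * (D x \<bullet> b))
       - m x * (D x \<bullet> D x) / 2 * (b \<bullet> b) - m x * ((D x \<bullet> H x b) * (x \<bullet> b)) - (D x \<bullet> D x) / 2 * ((b \<bullet> Dm x) * (x \<bullet> b)))"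
      by (intro sum.cong refl) (simp add: F'_def inner_add_left inner_diff_left algebra_simps inner_commute[of "H _ _" "D _"])
    also have "\<dots> = m x * (x \<bullet> D x) * (\<Sum>b\<in>Basis. H x b \<bullet> b)
       + m x * (H x (D x) \<bullet> x) + m x * (D x \<bullet> D x) + (x \<bullet> D x) * (Dm x \<bullet> D x)
       - m x * (D x \<bullet> D x) / 2 * (\<Sum>b\<in>Basis. b \<bullet> (b::'a)) - m x * (H x x \<bullet> D x) - (D x \<bullet> D x) / 2 * (Dm x \<bullet> x)"
      by (simp add: sum.distrib sum_subtractf sum_distrib_left[symmetric] sum_divide_distrib[symmetric] basis_sums H_sum)
    also have "(\<Sum>b\<in>Basis. b \<bullet> (b::'a)) = DIM('a)" by simp
    also have "H x x \<bullet> D x = H x (D x) \<bullet> x" by (rule sym)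
    finally show ?thesis by (simp add: field_simps)
  qed
  ultimately show ?thesis by simp
qed

text \<open>Divergence of \<open>m F(w) x\<close>. The condition \<open>F 0 = 0\<close> makes the
  field vanish off C.\<close>

lemma chain_identity:
  fixes m :: "'a \<Rightarrow> real"
  assumes m: "\<And>x. x \<in> C \<Longrightarrow> GDERIV m x :> Dm x" and Dm: "continuous_on C Dm"
    and F: "\<And>s. (F has_real_derivative F' s) (at s)" and F': "continuous_on UNIV F'" and F0: "F 0 = 0"
  shows "(LBINT x. indicator C x * (m x * (F' (w x) * (x \<bullet> D x)) + (Dm x \<bullet> x + DIM('a) * m x) * F (w x))) = 0"
proof -
  have Fw: "((\<lambda>x. F (w x)) has_derivative (\<lambda>a. (a \<bullet> D x) * F' (w x))) (at x)" for x
    using has_derivative_compose[OF w_deriv F[unfolded has_field_derivative_def]] by (simp add: mult.commute)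
  have cF: "continuous_on C (\<lambda>x. F (w x))"
    by (rule has_derivative_continuous_on) (rule has_derivative_at_withinI, rule Fw)
  have cF': "continuous_on C (\<lambda>x. F' (w x))"
    by (rule continuous_on_compose2[OF F' continuous(1)]) auto
  define L where "L x a = (m x * F (w x)) *\<^sub>R a + (m x * ((a \<bullet> D x) * F' (w x)) + (a \<bullet> Dm x) * F (w x)) *\<^sub>R x" for x a
  have "(LBINT x. indicator C x * (\<Sum>b\<in>Basis. L x b \<bullet> b)) = 0"
  proof (rule integral_divergence_compact_support[OF C, where F = "\<lambda>x. (m x * F (w x)) *\<^sub>R x"])
    show "((\<lambda>x. (m x * F (w x)) *\<^sub>R x) has_derivative L x) (at x)" if "x \<in> C" for x
      unfolding L_def
      by (rule derivative_eq_intros m[OF that, unfolded gderiv_def] Fw refl | simp)+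
    show "continuous_on C (\<lambda>x. L x b)" for b
      unfolding L_def by (intro continuous_intros continuous GDERIV_continuous_on[OF m] Dm cF cF')
  qed (use w0 F0 in auto)
  moreover have "(\<Sum>b\<in>Basis. L x b \<bullet> b) = m x * (F' (w x) * (x \<bullet> D x)) + (Dm x \<bullet> x + DIM('a) * m x) * F (w x)" for x
  proof -
    have "(\<Sum>b\<in>Basis. L x b \<bullet> b) = (\<Sum>b\<in>Basis. m x * F (w x) * (b \<bullet> b) + m x * F' (w x) * ((b \<bullet> D x) * (x \<bullet> b)) + F (w x) * ((b \<bullet> Dm x) * (x \<bullet> b)))"
      by (simp add: L_def inner_add_left algebra_simps)
    also have "\<dots> = m x * F (w x) * (\<Sum>b\<in>Basis. b \<bullet> (b::'a)) + m x * F' (w x) * (D x \<bullet> x) + F (w x) * (Dm x \<bullet> x)"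
      by (simp add: sum.distrib sum_distrib_left[symmetric] basis_sums)
    also have "(\<Sum>b\<in>Basis. b \<bullet> (b::'a)) = DIM('a)" by simp
    finally show ?thesis by (simp add: field_simps inner_commute)
  qed
  ultimately show ?thesis by simp
qed

end

section \<open>Passage of the identities from mollifications to weak solutions\<close>

lemma indicator_continuous_bounded:
  fixes a :: "'a::euclidean_space \<Rightarrow> real"
  assumes C: "compact C" and a: "continuous_on C a"
  obtains B where "(\<lambda>x. indicator C x * a x) \<in> borel_measurable borel" "\<And>x. \<bar>indicator C x * a x\<bar> \<le> B"
proof -
  have CB: "C \<in> sets borel" using C by (simp add: compact_imp_closed)
  obtain B where B: "\<And>x. x \<in> C \<Longrightarrow> \<bar>a x\<bar> \<le> B" 
    using compact_imp_bounded[OF compact_continuous_image[OF a C]]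
    unfolding bounded_iff by (metis imageI real_norm_def)
  have "\<bar>indicator C x * a x\<bar> \<le> max B 0" for x using B[of x] by (auto simp: indicator_def)
  moreover have "(\<lambda>x. indicator C x * a x) \<in> borel_measurable borel"
    using borel_measurable_continuous_on_indicator[OF CB a] by simp
  ultimately show thesis by (rule that[rotated])
qed

lemma integrable_coefficient:
  assumes C: "compact C" and a: "continuous_on C a" and f: "sq_integrable f" and g: "sq_integrable g"
  shows "integrable lborel (\<lambda>x. indicator C x * (a x * (f x * g x)))"
proof -
  obtain B where B: "(\<lambda>x. indicator C x * a x) \<in> borel_measurable borel" "\<And>x. \<bar>indicator C x * a x\<bar> \<le> B"
    using indicator_continuous_bounded[OF C a] by blast
  from sq_integrable_mult[OF sq_integrable_bounded_mult[OF f B] g] show ?thesis by (simp add: mult.assoc)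
qed

lemma integrable_normsq:
  assumes C: "compact C" and a: "continuous_on C a" and V: "\<And>b. b \<in> Basis \<Longrightarrow> sq_integrable (\<lambda>x. V x \<bullet> b)"
  shows "integrable lborel (\<lambda>x. indicator C x * (a x * (V x \<bullet> V x)))"
  unfolding euclidean_inner[of "V _" "V _"] sum_distrib_left
  by (intro Bochner_Integration.integrable_sum integrable_coefficient[OF C a] V)

text \<open>Integrability is part of the notion: the integral of a nonintegrable function is 0 by
  convention, and identities could not be added without it.\<close>

definition null_on :: "'a::euclidean_space set \<Rightarrow> ('a \<Rightarrow> real) \<Rightarrow> bool" where
  "null_on C f \<longleftrightarrow> integrable lborel (\<lambda>x. indicator C x * f x) \<and> (LBINT x. indicator C x * f x) = 0"

lemma null_on_cong: "null_on C f \<Longrightarrow> (\<And>x. x \<in> C \<Longrightarrow> f x = g x) \<Longrightarrow> null_on C g"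
proof -
  assume f: "null_on C f" and "\<And>x. x \<in> C \<Longrightarrow> f x = g x"
  then have "indicator C x * f x = indicator C x * g x" for x by (cases "x \<in> C") auto
  with f show ?thesis unfolding null_on_def by (simp only:)
qed

lemma null_on_add: "null_on C f \<Longrightarrow> null_on C g \<Longrightarrow> null_on C (\<lambda>x. f x + g x)"
  by (simp add: null_on_def distrib_left)

lemma null_on_diff: "null_on C f \<Longrightarrow> null_on C g \<Longrightarrow> null_on C (\<lambda>x. f x - g x)"
  by (simp add: null_on_def right_diff_distrib)

definition integral_tendsto_on :: "'a::euclidean_space set \<Rightarrow> (nat \<Rightarrow> 'a \<Rightarrow> real) \<Rightarrow> ('a \<Rightarrow> real) \<Rightarrow> bool" where
  "integral_tendsto_on C F f \<longleftrightarrow> (\<forall>k. integrable lborel (\<lambda>x. indicator C x * F k x)) \<and> integrable lborel (\<lambda>x. indicator C x * f x)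
    \<and> (\<lambda>k. LBINT x. indicator C x * F k x) \<longlonglongrightarrow> (LBINT x. indicator C x * f x)"

lemma integral_tendsto_on_add:
  "integral_tendsto_on C F f \<Longrightarrow> integral_tendsto_on C G g \<Longrightarrow> integral_tendsto_on C (\<lambda>k x. F k x + G k x) (\<lambda>x. f x + g x)"
  by (auto simp: integral_tendsto_on_def distrib_left intro: tendsto_add)

lemma null_on_limit:
  assumes F: "integral_tendsto_on C F f" and z: "\<And>k. (LBINT x. indicator C x * F k x) = 0"
  shows "null_on C f"
  using F unfolding integral_tendsto_on_def null_on_def z by (auto simp: LIMSEQ_const_iff)

lemma integral_tendsto_on_coefficient:
  assumes C: "compact C" and a: "continuous_on C a" and F: "L2_tendsto F f" and G: "L2_tendsto G g"
  shows "integral_tendsto_on C (\<lambda>k x. a x * (F k x * G k x)) (\<lambda>x. a x * (f x * g x))"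
proof -
  obtain B where B: "(\<lambda>x. indicator C x * a x) \<in> borel_measurable borel" "\<And>x. \<bar>indicator C x * a x\<bar> \<le> B"
    using indicator_continuous_bounded[OF C a] by blast
  from L2_tendsto_mult[OF F G B] show ?thesis
    unfolding integral_tendsto_on_def
    by (auto simp: mult.assoc intro!: integrable_coefficient[OF C a] L2_tendstoD[OF F] L2_tendstoD[OF G])
qed

lemma integral_tendsto_on_normsq:
  assumes C: "compact C" and a: "continuous_on C a"
    and D: "\<And>b. b \<in> Basis \<Longrightarrow> L2_tendsto (\<lambda>k x. D k x \<bullet> b) (\<lambda>x. V x \<bullet> b)"
  shows "integral_tendsto_on C (\<lambda>k x. a x * (D k x \<bullet> D k x)) (\<lambda>x. a x * (V x \<bullet> V x))"
proof -
  have "integral_tendsto_on C (\<lambda>k x. \<Sum>b\<in>I. a x * ((D k x \<bullet> b) * (D k x \<bullet> b))) (\<lambda>x. \<Sum>b\<in>I. a x * ((V x \<bullet> b) * (V x \<bullet> b)))"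
    if "finite I" "I \<subseteq> Basis" for I
    using that
  proof (induction I rule: finite_induct)
    case (insert b I)
    then show ?case using integral_tendsto_on_coefficient[OF C a D[of b] D[of b]] by (simp add: integral_tendsto_on_add)
  qed (simp add: integral_tendsto_on_def)
  from this[OF finite_Basis subset_refl] show ?thesis
    by (simp only: sum_distrib_left[symmetric] euclidean_inner[symmetric])
qed

text \<open>For functions of quadratic growth, such as \<open>s^2 / 2\<close> or a smoothed
  \<open>|s|^q\<close>, the difference is dominated by the product of |F| + |f|, which converges in
  L^2, and |F - f|, which tends to 0 in L^2.\<close>

lemma L2_tendsto_quadratic:
  assumes F: "L2_tendsto F f" and \<phi>: "\<phi> \<in> borel_measurable borel" "\<phi> 0 = 0"
    and L: "\<And>s t. \<bar>\<phi> s - \<phi> t\<bar> \<le> L * (\<bar>s\<bar> + \<bar>t\<bar>) * \<bar>s - t\<bar>" and L0: "L \<ge> 0"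
    and a: "a \<in> borel_measurable borel" "\<And>x. \<bar>a x\<bar> \<le> B"
  shows "integrable lborel (\<lambda>x. a x * \<phi> (f x))"
    "(\<lambda>k. LBINT x. a x * \<phi> (F k x)) \<longlonglongrightarrow> (LBINT x. a x * \<phi> (f x))"
proof -
  note sF = L2_tendstoD(1)[OF F] and sf = L2_tendstoD(2)[OF F]
  have B0: "B \<ge> 0" using a(2)[of undefined] by linarith
  have int: "integrable lborel (\<lambda>x. a x * \<phi> (g x))" if g: "sq_integrable g" for g
  proof (rule Bochner_Integration.integrable_bound)
    show "integrable lborel (\<lambda>x. B * (L * (g x)\<^sup>2))" using g by (simp add: sq_integrable_def)
    show "(\<lambda>x. a x * \<phi> (g x)) \<in> borel_measurable lborel" using g \<phi>(1) a(1) by measurable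
    have "\<bar>a x\<bar> * \<bar>\<phi> (g x)\<bar> \<le> B * (L * (g x)\<^sup>2)" for x
      using L[of "g x" 0] a(2)[of x] B0 by (intro mult_mono) (auto simp: \<phi>(2) power2_eq_square abs_mult_self_eq mult.assoc)
    then show "AE x in lborel. norm (a x * \<phi> (g x)) \<le> norm (B * (L * (g x)\<^sup>2))"
      using B0 L0 by (simp add: abs_mult)
  qed
  show "integrable lborel (\<lambda>x. a x * \<phi> (f x))" by (rule int[OF sf])
  have d: "L2_tendsto (\<lambda>k x. \<bar>F k x - f x\<bar>) (\<lambda>x. 0)"
    using L2_tendstoD(3)[OF F] sq_integrable_abs[OF sq_integrable_diff[OF sF sf]]
    by (auto simp: L2_tendsto_def sq_integrable_def[of "\<lambda>x. 0"])
  have c: "L2_tendsto (\<lambda>k. f) f" using sf by (simp add: L2_tendsto_def)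
  have ab: "L2_tendsto (\<lambda>k x. \<bar>G k x\<bar>) (\<lambda>x. \<bar>g x\<bar>)" if "L2_tendsto G g" for G g
    by (rule L2_tendsto_Lipschitz[OF that, where L = 1]) (auto simp: abs_triangle_ineq3)
  have s: "L2_tendsto (\<lambda>k x. \<bar>F k x\<bar> + \<bar>f x\<bar>) (\<lambda>x. \<bar>f x\<bar> + \<bar>f x\<bar>)"
    by (rule L2_tendsto_add[OF ab[OF F] ab[OF c]])
  have lim: "(\<lambda>k. LBINT x. (B * L) * ((\<bar>F k x\<bar> + \<bar>f x\<bar>) * \<bar>F k x - f x\<bar>)) \<longlonglongrightarrow> 0"
    using L2_tendsto_mult[OF s d, of "\<lambda>_. B * L" "\<bar>B * L\<bar>"] by simp
  have bd: "\<bar>(LBINT x. a x * \<phi> (F k x)) - (LBINT x. a x * \<phi> (f x))\<bar>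
     \<le> (LBINT x. (B * L) * ((\<bar>F k x\<bar> + \<bar>f x\<bar>) * \<bar>F k x - f x\<bar>))" for k
  proof -
    have "(LBINT x. a x * \<phi> (F k x)) - (LBINT x. a x * \<phi> (f x)) = (LBINT x. a x * (\<phi> (F k x) - \<phi> (f x)))"
      using int[OF sF] int[OF sf] by (simp add: right_diff_distrib)
    also have "\<bar>\<dots>\<bar> \<le> (LBINT x. \<bar>a x * (\<phi> (F k x) - \<phi> (f x))\<bar>)" by simp
    also have "\<dots> \<le> (LBINT x. (B * L) * ((\<bar>F k x\<bar> + \<bar>f x\<bar>) * \<bar>F k x - f x\<bar>))"
    proof (rule integral_mono')
      show "integrable lborel (\<lambda>x. B * L * ((\<bar>F k x\<bar> + \<bar>f x\<bar>) * \<bar>F k x - f x\<bar>))"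
        using sq_integrable_mult[OF L2_tendstoD(1)[OF s] L2_tendstoD(1)[OF d]] by (rule integrable_mult_right)
      fix x
      have "\<bar>a x\<bar> * \<bar>\<phi> (F k x) - \<phi> (f x)\<bar> \<le> B * (L * (\<bar>F k x\<bar> + \<bar>f x\<bar>) * \<bar>F k x - f x\<bar>)"
        by (intro mult_mono a L) (use B0 in auto)
      then show "\<bar>a x * (\<phi> (F k x) - \<phi> (f x))\<bar> \<le> B * L * ((\<bar>F k x\<bar> + \<bar>f x\<bar>) * \<bar>F k x - f x\<bar>)"
        by (simp add: abs_mult mult.assoc)
    qed (use B0 L0 in auto)
    finally show ?thesis .
  qed
  have "(\<lambda>k. \<bar>(LBINT x. a x * \<phi> (F k x)) - (LBINT x. a x * \<phi> (f x))\<bar>) \<longlonglongrightarrow> 0"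
    by (rule tendsto_zero_le[OF abs_ge_zero bd lim])
  then show "(\<lambda>k. LBINT x. a x * \<phi> (F k x)) \<longlonglongrightarrow> (LBINT x. a x * \<phi> (f x))"
    by (simp add: LIM_zero_iff tendsto_rabs_zero_iff)
qed

context weak_poisson
begin

text \<open>Cutting \<open>X\<close> off with the indicator of C makes its components bounded and
  Borel, and changes nothing because V vanishes off C.\<close>

lemma sq_integrable_inner:
  assumes X: "continuous_on C X" shows "sq_integrable (\<lambda>x. X x \<bullet> V x)"
proof -
  have "sq_integrable (\<lambda>x. \<Sum>b\<in>Basis. (indicator C x * (X x \<bullet> b)) * (V x \<bullet> b))"
  proof (intro sq_integrable_sum finite_Basis)
    fix b :: 'a assume b: "b \<in> Basis"
    have "continuous_on C (\<lambda>x. X x \<bullet> b)" using X by (intro continuous_intros)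
    then obtain B where B: "(\<lambda>x. indicator C x * (X x \<bullet> b)) \<in> borel_measurable borel" "\<And>x. \<bar>indicator C x * (X x \<bullet> b)\<bar> \<le> B"
      using indicator_continuous_bounded[OF C] by blast
    show "sq_integrable (\<lambda>x. (indicator C x * (X x \<bullet> b)) * (V x \<bullet> b))"
      by (rule sq_integrable_bounded_mult[OF V[OF b] B])
  qed
  moreover have "(\<Sum>b\<in>Basis. (indicator C x * (X x \<bullet> b)) * (V x \<bullet> b)) = X x \<bullet> V x" for x
    using support(2)[of x] by (cases "x \<in> C") (simp_all add: euclidean_inner[of "X x" "V x", symmetric])
  ultimately show ?thesis by simp
qed

lemma inner_L2_tendsto:
  assumes DV: "\<And>b. b \<in> Basis \<Longrightarrow> L2_tendsto (\<lambda>k x. D k x \<bullet> b) (\<lambda>x. V x \<bullet> b)"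
    and D0: "\<And>k x. x \<notin> C \<Longrightarrow> D k x = 0" and X: "continuous_on C X"
  shows "L2_tendsto (\<lambda>k x. X x \<bullet> D k x) (\<lambda>x. X x \<bullet> V x)"
proof -
  have "L2_tendsto (\<lambda>k x. \<Sum>b\<in>Basis. (indicator C x * (X x \<bullet> b)) * (D k x \<bullet> b)) (\<lambda>x. \<Sum>b\<in>Basis. (indicator C x * (X x \<bullet> b)) * (V x \<bullet> b))"
  proof (intro L2_tendsto_sum finite_Basis)
    fix b :: 'a assume b: "b \<in> Basis"
    have "continuous_on C (\<lambda>x. X x \<bullet> b)" using X by (intro continuous_intros)
    then obtain B where B: "(\<lambda>x. indicator C x * (X x \<bullet> b)) \<in> borel_measurable borel" "\<And>x. \<bar>indicator C x * (X x \<bullet> b)\<bar> \<le> B"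
      using indicator_continuous_bounded[OF C] by blast
    show "L2_tendsto (\<lambda>k x. (indicator C x * (X x \<bullet> b)) * (D k x \<bullet> b)) (\<lambda>x. (indicator C x * (X x \<bullet> b)) * (V x \<bullet> b))"
      by (rule L2_tendsto_bounded_mult[OF DV[OF b] B])
  qed
  moreover have "(\<Sum>b\<in>Basis. (indicator C x * (X x \<bullet> b)) * (Y \<bullet> b)) = X x \<bullet> Y" if "x \<notin> C \<Longrightarrow> Y = 0" for x Y
    using that by (cases "x \<in> C") (simp_all add: euclidean_inner[of "X x" Y, symmetric])
  ultimately show ?thesis using support(2) D0 by simp
qed

lemma energy_identity:
  assumes m: "\<And>x. x \<in> C \<Longrightarrow> GDERIV m x :> Dm x" and Dm: "continuous_on C Dm"
  shows "null_on C (\<lambda>x. m x * (u x * h x) + m x * (V x \<bullet> V x) + 1 * (u x * (Dm x \<bullet> V x)))"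
proof (rule regularization)
  fix w D H
  assume r: "\<And>k. C2_compact_support (w k) (D k) (H k) C" and wu: "L2_tendsto w u"
    and DV: "\<And>b. b \<in> Basis \<Longrightarrow> L2_tendsto (\<lambda>k x. D k x \<bullet> b) (\<lambda>x. V x \<bullet> b)"
    and Lh: "L2_tendsto (\<lambda>k x. \<Sum>b\<in>Basis. H k x b \<bullet> b) h"
  have E: "L2_tendsto (\<lambda>k x. Dm x \<bullet> D k x) (\<lambda>x. Dm x \<bullet> V x)"
    by (rule inner_L2_tendsto[OF DV C2_compact_support.D0[OF r] Dm])
  show ?thesis
    by (rule null_on_limit, rule_tac [2] C2_compact_support.energy_identity[OF r m Dm],
        intro integral_tendsto_on_add integral_tendsto_on_coefficient integral_tendsto_on_normsq C
          GDERIV_continuous_on[OF m] continuous_on_const)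
       (rule wu DV Lh E | assumption)+
qed

text \<open>In the limit each summand is a coefficient continuous on C times a product of strong L^2
  limits; the Hessian enters only through its trace, whose limit is h.\<close>

lemma Rellich_identity:
  fixes m :: "'a \<Rightarrow> real"
  assumes m: "\<And>x. x \<in> C \<Longrightarrow> GDERIV m x :> Dm x" and Dm: "continuous_on C Dm"
  shows "null_on C (\<lambda>x. m x * ((x \<bullet> V x) * h x) + (m x - (Dm x \<bullet> x + DIM('a) * m x) / 2) * (V x \<bullet> V x)
    + 1 * ((Dm x \<bullet> V x) * (x \<bullet> V x)))"
proof (rule regularization)
  fix w D H
  assume r: "\<And>k. C2_compact_support (w k) (D k) (H k) C" and wu: "L2_tendsto w u"
    and DV: "\<And>b. b \<in> Basis \<Longrightarrow> L2_tendsto (\<lambda>k x. D k x \<bullet> b) (\<lambda>x. V x \<bullet> b)"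
    and Lh: "L2_tendsto (\<lambda>k x. \<Sum>b\<in>Basis. H k x b \<bullet> b) h"
  have ca: "continuous_on C (\<lambda>x. m x - (Dm x \<bullet> x + DIM('a) * m x) / 2)"
    by (intro continuous_intros GDERIV_continuous_on[OF m] Dm) auto
  have E: "L2_tendsto (\<lambda>k x. Dm x \<bullet> D k x) (\<lambda>x. Dm x \<bullet> V x)"
    by (rule inner_L2_tendsto[OF DV C2_compact_support.D0[OF r] Dm])
  have X: "L2_tendsto (\<lambda>k x. x \<bullet> D k x) (\<lambda>x. x \<bullet> V x)"
    by (rule inner_L2_tendsto[OF DV C2_compact_support.D0[OF r] continuous_on_id])
  show ?thesis
    by (rule null_on_limit, rule_tac [2] C2_compact_support.Rellich_identity[OF r m Dm],
        intro integral_tendsto_on_add integral_tendsto_on_coefficient integral_tendsto_on_normsq C ca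
          GDERIV_continuous_on[OF m] continuous_on_const)
       (rule DV Lh E X | assumption)+
qed

lemma chain_identity:
  fixes m :: "'a \<Rightarrow> real"
  assumes m: "\<And>x. x \<in> C \<Longrightarrow> GDERIV m x :> Dm x" and Dm: "continuous_on C Dm"
    and F: "\<And>s. (F has_real_derivative F' s) (at s)" and F0: "F 0 = 0" and F'0: "F' 0 = 0"
    and L: "\<And>s t. \<bar>F' s - F' t\<bar> \<le> L * \<bar>s - t\<bar>"
  shows "null_on C (\<lambda>x. m x * (F' (u x) * (x \<bullet> V x)) + (Dm x \<bullet> x + DIM('a) * m x) * F (u x))"
proof -
  have cm: "continuous_on C m" by (rule GDERIV_continuous_on[OF m])
  define a where "a x = Dm x \<bullet> x + DIM('a) * m x" for x
  have ca: "continuous_on C a" unfolding a_def[abs_def] by (intro continuous_intros cm Dm)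
  obtain B where B: "(\<lambda>x. indicator C x * a x) \<in> borel_measurable borel" "\<And>x. \<bar>indicator C x * a x\<bar> \<le> B"
    using indicator_continuous_bounded[OF C ca] by blast
  have L0: "L \<ge> 0" using L[of 1 0] by simp
  have cF': "continuous_on UNIV F'"
  proof -
    have "L-lipschitz_on UNIV F'" using L L0 by (auto simp: lipschitz_on_def dist_real_def)
    then show ?thesis by (rule lipschitz_on_continuous_on)
  qed
  have F'm: "F' \<in> borel_measurable borel" by (rule borel_measurable_continuous_onI[OF cF'])
  have "continuous_on UNIV F" by (rule DERIV_continuous_on) (rule has_field_derivative_at_within, rule F)
  then have Fm: "F \<in> borel_measurable borel" by (rule borel_measurable_continuous_onI)
  \<comment> \<open>Mean value theorem, with the Lipschitz bound of F' compared to its value 0 at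
    0.\<close>
  have FL: "\<bar>F s - F t\<bar> \<le> L * (\<bar>s\<bar> + \<bar>t\<bar>) * \<bar>s - t\<bar>" for s t
  proof -
    have *: "\<bar>F s - F t\<bar> \<le> L * (\<bar>s\<bar> + \<bar>t\<bar>) * \<bar>s - t\<bar>" if lt: "t < s" for s t
    proof -
      obtain z where z: "t < z" "z < s" "F s - F t = (s - t) * F' z" using MVT2[OF lt, of F F'] F by blast
      have "\<bar>F' z\<bar> \<le> L * \<bar>z\<bar>" using L[of z 0] F'0 by simp
      also have "\<dots> \<le> L * (\<bar>s\<bar> + \<bar>t\<bar>)" using z L0 by (intro mult_left_mono) auto
      finally show ?thesis unfolding z(3) abs_mult by (subst mult.commute) (rule mult_right_mono, auto)
    qed
    consider "t < s" | "s < t" | "s = t" by linarith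
    then show ?thesis
      by cases (use *[of t s] *[of s t] in \<open>auto simp: abs_minus_commute add.commute\<close>)
  qed
  show ?thesis
  proof (rule regularization)
    fix w D H
    assume r: "\<And>k. C2_compact_support (w k) (D k) (H k) C" and wu: "L2_tendsto w u"
      and DV: "\<And>b. b \<in> Basis \<Longrightarrow> L2_tendsto (\<lambda>k x. D k x \<bullet> b) (\<lambda>x. V x \<bullet> b)"
    \<comment> \<open>The constant sequence makes the first part of
      \<open>L2_tendsto_quadratic\<close> available for each approximation, which gives the
      integrability of the single terms.\<close>
    have "L2_tendsto (\<lambda>_::nat. w k) (w k)" for k using L2_tendstoD(1)[OF wu] by (simp add: L2_tendsto_def)
    note q = L2_tendsto_quadratic[OF _ Fm F0 FL L0 B]
    have "integral_tendsto_on C (\<lambda>k x. a x * F (w k x)) (\<lambda>x. a x * F (u x))"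
      using q(1)[OF wu] q(1)[OF \<open>L2_tendsto (\<lambda>_::nat. w _) (w _)\<close>] q(2)[OF wu]
      unfolding integral_tendsto_on_def mult.assoc by blast
    moreover have "integral_tendsto_on C (\<lambda>k x. m x * (F' (w k x) * (x \<bullet> D k x))) (\<lambda>x. m x * (F' (u x) * (x \<bullet> V x)))"
      by (intro integral_tendsto_on_coefficient C cm L2_tendsto_Lipschitz[OF wu F'm F'0 L]
          inner_L2_tendsto[OF DV C2_compact_support.D0[OF r] continuous_on_id])
    ultimately have t: "integral_tendsto_on C (\<lambda>k x. m x * (F' (w k x) * (x \<bullet> D k x)) + (Dm x \<bullet> x + DIM('a) * m x) * F (w k x))
        (\<lambda>x. m x * (F' (u x) * (x \<bullet> V x)) + (Dm x \<bullet> x + DIM('a) * m x) * F (u x))"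
      unfolding a_def by (intro integral_tendsto_on_add)
    show ?thesis
      by (rule null_on_limit[OF t]) (rule C2_compact_support.chain_identity[OF r m Dm F cF' F0])
  qed
qed

end

section \<open>The sublinear term\<close>

text \<open>One formula for all q: at q = 1 the quotient s / |s| is the sign, and at s = 0 the
  factor s enforces the value 0.\<close>

lemma fq_eq:
  assumes "1 \<le> q" shows "fq q s = \<bar>s\<bar> powr (q - 2) * s"
  by (auto simp: fq_def powr_minus_divide sgn_real_def)

lemma power2_powr_half: "(s\<^sup>2) powr (a / 2) = \<bar>s\<bar> powr a" if "s \<noteq> 0" for s :: real
proof -
  have "(s\<^sup>2) powr (a / 2) = (\<bar>s\<bar> powr 2) powr (a / 2)" using that by simp
  also have "\<dots> = \<bar>s\<bar> powr (2 * (a / 2))" by (rule powr_powr)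
  finally show ?thesis by simp
qed

lemma abs_powr_le:
  assumes "1 \<le> q" "q < 2" and "s \<noteq> 0" shows "\<bar>s\<bar> powr (q - 2) * \<bar>s\<bar> \<le> 1 + \<bar>s :: real\<bar>"
proof -
  have e: "\<bar>s\<bar> powr (q - 2) * \<bar>s\<bar> = \<bar>s\<bar> powr (q - 1)"
    using assms powr_add[of "\<bar>s\<bar>" "q - 2" 1] by simp
  show ?thesis
  proof (cases "\<bar>s\<bar> \<le> 1")
    case True
    then have "\<bar>s\<bar> powr (q - 1) \<le> 1 powr (q - 1)" using assms by (intro powr_mono2) auto
    then show ?thesis using e by simp
  next
    case False
    then have "\<bar>s\<bar> powr (q - 1) \<le> \<bar>s\<bar> powr 1" using assms by (intro powr_mono) auto
    then show ?thesis using e by simp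
  qed
qed

lemma abs_fq_le: "1 \<le> q \<Longrightarrow> q < 2 \<Longrightarrow> \<bar>fq q s\<bar> \<le> 1 + \<bar>s\<bar>"
  using abs_powr_le[of q s] by (cases "s = 0") (auto simp: fq_eq abs_mult)

lemma fq_zero: "1 \<le> q \<Longrightarrow> fq q 0 = 0"
  by (simp add: fq_eq)

lemma fq_mult_self: "1 \<le> q \<Longrightarrow> fq q s * s = \<bar>s\<bar> powr q"
  using powr_add[of "\<bar>s\<bar>" "q - 2" 2] by (cases "s = 0") (auto simp: fq_eq power2_eq_square mult.assoc)

lemma fq_measurable [measurable]: "fq q \<in> borel_measurable borel"
  unfolding fq_def[abs_def] by measurable

text \<open>Replaces |s| by \<open>sqrt (s^2 + \<delta>)\<close> in order to meet the Lipschitz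
  condition of \<open>chain_identity\<close>, which \<open>fq\<close> violates at 0.
  \<open>Fq_reg\<close> is the primitive normalised to vanish at 0.\<close>

definition fq_reg :: "real \<Rightarrow> real \<Rightarrow> real \<Rightarrow> real" where
  "fq_reg q \<delta> s = (s\<^sup>2 + \<delta>) powr (q / 2 - 1) * s"

definition Fq_reg :: "real \<Rightarrow> real \<Rightarrow> real \<Rightarrow> real" where
  "Fq_reg q \<delta> s = ((s\<^sup>2 + \<delta>) powr (q / 2) - \<delta> powr (q / 2)) / q"

context
  fixes q \<delta> :: real
  assumes q: "1 \<le> q" "q < 2" and \<delta>: "0 < \<delta>"
begin

lemma reg_base_pos: "s\<^sup>2 + \<delta> > 0"
  using \<delta> by (intro add_nonneg_pos) auto

lemma Fq_reg_deriv: "(Fq_reg q \<delta> has_real_derivative fq_reg q \<delta> s) (at s)"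
proof -
  have "((\<lambda>s. s\<^sup>2 + \<delta>) has_real_derivative 2 * s) (at s)" by (auto intro!: derivative_eq_intros)
  from DERIV_fun_powr[OF this reg_base_pos, of "q / 2"]
  have "((\<lambda>s. (s\<^sup>2 + \<delta>) powr (q / 2)) has_real_derivative q / 2 * (s\<^sup>2 + \<delta>) powr (q / 2 - 1) * (2 * s)) (at s)" by simp
  from DERIV_cdivide[OF DERIV_diff[OF this DERIV_const], of "\<delta> powr (q / 2)" q]
  have "(Fq_reg q \<delta> has_real_derivative (q / 2 * (s\<^sup>2 + \<delta>) powr (q / 2 - 1) * (2 * s) - 0) / q) (at s)"
    by (simp add: Fq_reg_def[abs_def])
  then show ?thesis by (rule DERIV_cong) (use q in \<open>simp add: fq_reg_def\<close>)
qed

lemma fq_reg_deriv: "(fq_reg q \<delta> has_real_derivative ((s\<^sup>2 + \<delta>) powr (q / 2 - 1) + (q - 2) * s\<^sup>2 * (s\<^sup>2 + \<delta>) powr (q / 2 - 1 - 1))) (at s)"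
  unfolding fq_reg_def[abs_def]
  using reg_base_pos[of s] q by (auto intro!: derivative_eq_intros simp: powr_diff power2_eq_square field_simps)

text \<open>With \<open>A = (z^2 + \<delta>) powr (q / 2 - 1)\<close> the derivative is A minus a
  multiple of A with factor between 0 and 1, and A is largest at z = 0. The constant blows up as
  \<delta> tends to 0, hence \<delta> stays fixed during the mollification limit.\<close>

lemma fq_reg_Lipschitz: "\<bar>fq_reg q \<delta> s - fq_reg q \<delta> t\<bar> \<le> 2 * \<delta> powr (q / 2 - 1) * \<bar>s - t\<bar>"
proof -
  have b: "\<bar>(z\<^sup>2 + \<delta>) powr (q / 2 - 1) + (q - 2) * z\<^sup>2 * (z\<^sup>2 + \<delta>) powr (q / 2 - 1 - 1)\<bar> \<le> 2 * \<delta> powr (q / 2 - 1)" for z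
  proof -
    define A where "A = (z\<^sup>2 + \<delta>) powr (q / 2 - 1)"
    have A: "0 \<le> A" "A \<le> \<delta> powr (q / 2 - 1)" using q \<delta> by (auto simp: A_def intro!: powr_mono2')
    have "(z\<^sup>2 + \<delta>) powr (q / 2 - 1 - 1) = A / (z\<^sup>2 + \<delta>)" using reg_base_pos[of z] by (simp add: A_def powr_diff power2_eq_square)
    then have e: "(q - 2) * z\<^sup>2 * (z\<^sup>2 + \<delta>) powr (q / 2 - 1 - 1) = - ((2 - q) * (z\<^sup>2 / (z\<^sup>2 + \<delta>)) * A)"
    proof -
      have "(q - 2) * s * (A / D) = - ((2 - q) * (s / D) * A)" for s D :: real
        by (cases "D = 0") (simp_all add: field_simps)
      then show ?thesis using \<open>(z\<^sup>2 + \<delta>) powr (q / 2 - 1 - 1) = A / (z\<^sup>2 + \<delta>)\<close> by (simp only:)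
    qed
    have "0 \<le> z\<^sup>2 / (z\<^sup>2 + \<delta>)" "z\<^sup>2 / (z\<^sup>2 + \<delta>) \<le> 1" using reg_base_pos[of z] \<delta> by auto
    then have *: "0 \<le> (2 - q) * (z\<^sup>2 / (z\<^sup>2 + \<delta>))" "(2 - q) * (z\<^sup>2 / (z\<^sup>2 + \<delta>)) \<le> 1 * 1"
      using q mult_nonneg_nonneg[of "2 - q" "z\<^sup>2 / (z\<^sup>2 + \<delta>)"] mult_mono[of "2 - q" 1 "z\<^sup>2 / (z\<^sup>2 + \<delta>)" 1] by simp_all
    from mult_nonneg_nonneg[OF *(1) A(1)] mult_right_mono[OF *(2) A(1)]
    have "0 \<le> (2 - q) * (z\<^sup>2 / (z\<^sup>2 + \<delta>)) * A" "(2 - q) * (z\<^sup>2 / (z\<^sup>2 + \<delta>)) * A \<le> A" by simp_all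
    then show ?thesis unfolding e A_def[symmetric] using A by linarith
  qed
  have "norm (fq_reg q \<delta> s - fq_reg q \<delta> t) \<le> 2 * \<delta> powr (q / 2 - 1) * norm (s - t)"
    by (rule field_differentiable_bound[OF convex_UNIV, where f' = "\<lambda>z. (z\<^sup>2 + \<delta>) powr (q / 2 - 1) + (q - 2) * z\<^sup>2 * (z\<^sup>2 + \<delta>) powr (q / 2 - 1 - 1)"])
       (use fq_reg_deriv b in auto)
  then show ?thesis by simp
qed

text \<open>Uniform in \<delta>, because the exponent q / 2 - 1 is negative and dropping \<delta>
  only enlarges the power. This feeds the dominated convergence for \<delta> tending to 0.\<close>

lemma fq_reg_le: "\<bar>fq_reg q \<delta> s\<bar> \<le> 1 + \<bar>s\<bar>"
proof (cases "s = 0")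
  case False
  have "(s\<^sup>2 + \<delta>) powr (q / 2 - 1) \<le> (s\<^sup>2) powr (q / 2 - 1)"
    using q \<delta> False by (intro powr_mono2') auto
  also have "\<dots> = \<bar>s\<bar> powr (q - 2)" using power2_powr_half[OF False, of "q - 2"] by (simp add: diff_divide_distrib)
  finally have "(s\<^sup>2 + \<delta>) powr (q / 2 - 1) * \<bar>s\<bar> \<le> \<bar>s\<bar> powr (q - 2) * \<bar>s\<bar>" by (rule mult_right_mono) simp
  also have "\<dots> \<le> 1 + \<bar>s\<bar>" by (rule abs_powr_le[OF q False])
  finally show ?thesis by (simp add: fq_reg_def abs_mult)
qed (simp add: fq_reg_def)

lemma Fq_reg_le:
  assumes "\<delta> \<le> 1" shows "\<bar>Fq_reg q \<delta> s\<bar> \<le> 1 + s\<^sup>2"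
proof -
  have "\<delta> powr (q / 2) \<le> (s\<^sup>2 + \<delta>) powr (q / 2)" using q \<delta> by (intro powr_mono2) auto
  moreover have "(s\<^sup>2 + \<delta>) powr (q / 2) \<le> (s\<^sup>2 + 1) powr (q / 2)" using q \<delta> assms by (intro powr_mono2) auto
  moreover have "(s\<^sup>2 + 1) powr (q / 2) \<le> (s\<^sup>2 + 1) powr 1" using q by (intro powr_mono) auto
  ultimately have "0 \<le> (s\<^sup>2 + \<delta>) powr (q / 2) - \<delta> powr (q / 2)" "(s\<^sup>2 + \<delta>) powr (q / 2) - \<delta> powr (q / 2) \<le> 1 + s\<^sup>2"
    by (auto intro: order_trans[of _ "(s\<^sup>2 + \<delta>) powr (q / 2)"])
  then have "0 \<le> Fq_reg q \<delta> s" "Fq_reg q \<delta> s \<le> (1 + s\<^sup>2) / q"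
    unfolding Fq_reg_def using q by (auto intro!: divide_right_mono)
  moreover have "(1 + s\<^sup>2) / q \<le> 1 + s\<^sup>2" using q mult_right_mono[of 1 q "1 + s\<^sup>2"] by (simp add: field_simps)
  ultimately show ?thesis by simp
qed

end

lemma fq_reg_tendsto:
  assumes q: "1 \<le> q" "q < 2" and d: "d \<longlonglongrightarrow> 0"
  shows "(\<lambda>j. fq_reg q (d j) s) \<longlonglongrightarrow> fq q s"
proof (cases "s = 0")
  case False
  have "(\<lambda>j. (s\<^sup>2 + d j) powr (q / 2 - 1) * s) \<longlonglongrightarrow> (s\<^sup>2 + 0) powr (q / 2 - 1) * s"
    using False by (intro tendsto_intros d) auto
  then show ?thesis using power2_powr_half[OF False, of "q - 2"] q
    by (simp add: fq_reg_def fq_eq diff_divide_distrib)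
qed (use q in \<open>simp add: fq_reg_def fq_zero\<close>)

lemma Fq_reg_tendsto:
  assumes q: "1 \<le> q" "q < 2" and d: "d \<longlonglongrightarrow> 0" "\<And>j. d j > 0"
  shows "(\<lambda>j. Fq_reg q (d j) s) \<longlonglongrightarrow> \<bar>s\<bar> powr q / q"
proof -
  have ge: "\<forall>\<^sub>F j in sequentially. 0 \<le> d j" using d(2) by (intro always_eventually) (simp add: less_imp_le)
  have z: "(\<lambda>j. d j powr (q / 2)) \<longlonglongrightarrow> 0"
    using tendsto_powr'[OF d(1) tendsto_const[of "q / 2"]] ge q by simp
  have "(\<lambda>j. (s\<^sup>2 + d j) powr (q / 2)) \<longlonglongrightarrow> \<bar>s\<bar> powr q"
  proof (cases "s = 0")
    case False
    have "(\<lambda>j. (s\<^sup>2 + d j) powr (q / 2)) \<longlonglongrightarrow> (s\<^sup>2 + 0) powr (q / 2)"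
      using False by (intro tendsto_intros d) auto
    then show ?thesis using power2_powr_half[OF False, of q] by simp
  qed (use z in simp)
  then have "(\<lambda>j. ((s\<^sup>2 + d j) powr (q / 2) - d j powr (q / 2)) / q) \<longlonglongrightarrow> (\<bar>s\<bar> powr q - 0) / q"
    using q by (intro tendsto_divide tendsto_diff z tendsto_const) auto
  then show ?thesis by (simp add: Fq_reg_def)
qed

text \<open>The constant 1 in the growth bound of \<open>fq\<close> is not square-integrable; as
  \<open>fq q 0 = 0\<close>, it may be replaced by the indicator of C.\<close>

lemma sq_integrable_fq_compact_support:
  assumes q: "1 \<le> q" "q < 2" and C: "compact C" and u: "sq_integrable u" and u0: "\<And>x. x \<notin> C \<Longrightarrow> u x = 0"
  shows "sq_integrable (\<lambda>x. fq q (u x))"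
proof (rule sq_integrable_bound)
  show "sq_integrable (\<lambda>x. indicator C x + \<bar>u x\<bar>)"
    by (intro sq_integrable_add sq_integrable_abs u sq_integrable_indicator_compact C)
  show "\<bar>fq q (u x)\<bar> \<le> indicator C x + \<bar>u x\<bar>" for x
    using abs_fq_le[OF q, of "u x"] u0[of x] fq_zero[OF q(1)] by (cases "x \<in> C") auto
  show "(\<lambda>x. fq q (u x)) \<in> borel_measurable borel" using u by measurable
qed

context weak_poisson
begin

lemma sq_integrable_fq:
  "1 \<le> q \<Longrightarrow> q < 2 \<Longrightarrow> sq_integrable (\<lambda>x. fq q (u x))"
  using sq_integrable_fq_compact_support[OF _ _ C u support(1)] .

lemma integrable_powr:
  assumes q: "1 \<le> q" "q < 2" and a: "continuous_on C a"
  shows "integrable lborel (\<lambda>x. indicator C x * (a x * \<bar>u x\<bar> powr q))"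
  using integrable_coefficient[OF C a sq_integrable_fq[OF q] u] by (simp add: fq_mult_self q)

text \<open>For fixed \<delta> the chain identity holds with \<open>Fq_reg\<close>. All terms are
  then dominated independently of \<delta>, and dominated convergence gives the identity for
  \<open>|u|^q / q\<close>, including q = 1.\<close>

lemma fq_identity:
  fixes m :: "'a \<Rightarrow> real"
  assumes q: "1 \<le> q" "q < 2"
    and m: "\<And>x. x \<in> C \<Longrightarrow> GDERIV m x :> Dm x" and Dm: "continuous_on C Dm"
  shows "null_on C (\<lambda>x. m x * (fq q (u x) * (x \<bullet> V x)) + (Dm x \<bullet> x + DIM('a) * m x) * (\<bar>u x\<bar> powr q / q))"
proof -
  have cm: "continuous_on C m" by (rule GDERIV_continuous_on[OF m])
  define a where "a x = Dm x \<bullet> x + DIM('a) * m x" for x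
  have ca: "continuous_on C a" unfolding a_def[abs_def] by (intro continuous_intros cm Dm)
  obtain A where A: "(\<lambda>x. indicator C x * a x) \<in> borel_measurable borel" "\<And>x. \<bar>indicator C x * a x\<bar> \<le> A"
    using indicator_continuous_bounded[OF C ca] by blast
  obtain B where B: "(\<lambda>x. indicator C x * m x) \<in> borel_measurable borel" "\<And>x. \<bar>indicator C x * m x\<bar> \<le> B"
    using indicator_continuous_bounded[OF C cm] by blast
  have A0: "A \<ge> 0" and B0: "B \<ge> 0" using A(2)[of undefined] B(2)[of undefined] by linarith+
  have X: "sq_integrable (\<lambda>x. x \<bullet> V x)" by (rule sq_integrable_inner[OF continuous_on_id])
  have um[measurable]: "u \<in> borel_measurable borel" and Xm[measurable]: "(\<lambda>x. x \<bullet> V x) \<in> borel_measurable borel"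
    using u X by measurable
  define d where "d j = inverse (real (Suc j))" for j
  have d: "d \<longlonglongrightarrow> 0" unfolding d_def[abs_def] by (rule LIMSEQ_inverse_real_of_nat)
  have d0: "d j > 0" and d1: "d j \<le> 1" for j by (auto simp: d_def field_simps)
  have rm: "fq_reg q (d j) \<in> borel_measurable borel" "Fq_reg q (d j) \<in> borel_measurable borel" for j
    unfolding fq_reg_def[abs_def] Fq_reg_def[abs_def] by measurable
  define T where "T j x = indicator C x * (m x * (fq_reg q (d j) (u x) * (x \<bullet> V x)) + a x * Fq_reg q (d j) (u x))" for j x
  define S where "S x = indicator C x * (m x * (fq q (u x) * (x \<bullet> V x)) + a x * (\<bar>u x\<bar> powr q / q))" for x
  \<comment> \<open>The dominating function: \<open>A\<close> and \<open>B\<close> bound the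
    coefficients, and the other factors are the \<delta>-free bounds for \<open>Fq_reg\<close> and
    \<open>fq_reg\<close>.\<close>
  define w where "w x = B * ((indicator C x + \<bar>u x\<bar>) * \<bar>x \<bullet> V x\<bar>) + A * (indicator C x + (u x)\<^sup>2)" for x
  have T: "T j x = (indicator C x * m x) * (fq_reg q (d j) (u x) * (x \<bullet> V x)) + (indicator C x * a x) * Fq_reg q (d j) (u x)"
    and S: "S x = (indicator C x * m x) * (fq q (u x) * (x \<bullet> V x)) + (indicator C x * a x) * (\<bar>u x\<bar> powr q / q)" for j x
    by (simp_all add: T_def S_def distrib_left mult.assoc)
  have Tm: "T j \<in> borel_measurable lborel" for j unfolding T[abs_def] using A(1) B(1) rm[of j] by measurable
  have Sm: "S \<in> borel_measurable lborel" unfolding S[abs_def] using A(1) B(1) by measurable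
  have wi: "integrable lborel w"
    unfolding w_def[abs_def] using u integrable_indicator_compact[OF C] X
    by (intro Bochner_Integration.integrable_add integrable_mult_right sq_integrable_mult sq_integrable_add
        sq_integrable_abs sq_integrable_indicator_compact C) (auto simp: sq_integrable_def)
  have lim: "(\<lambda>j. T j x) \<longlonglongrightarrow> S x" for x
    unfolding T S by (intro tendsto_add tendsto_mult tendsto_const fq_reg_tendsto Fq_reg_tendsto q d d0)
  have Tw: "norm (T j x) \<le> w x" for j x
  proof -
    have "\<bar>fq_reg q (d j) (u x)\<bar> \<le> indicator C x + \<bar>u x\<bar>"
      using fq_reg_le[OF q d0, of j "u x"] support(1)[of x] by (cases "x \<in> C") (auto simp: fq_reg_def)
    then have 1: "\<bar>(indicator C x * m x) * (fq_reg q (d j) (u x) * (x \<bullet> V x))\<bar> \<le> B * ((indicator C x + \<bar>u x\<bar>) * \<bar>x \<bullet> V x\<bar>)"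
      unfolding abs_mult[of "indicator C x * m x"] abs_mult[of "fq_reg q (d j) (u x)"]
      by (intro mult_mono B) (use B0 in auto)
    have "\<bar>Fq_reg q (d j) (u x)\<bar> \<le> indicator C x + (u x)\<^sup>2"
      using Fq_reg_le[OF q d0 d1, of j "u x"] support(1)[of x] by (cases "x \<in> C") (auto simp: Fq_reg_def)
    then have "\<bar>(indicator C x * a x) * Fq_reg q (d j) (u x)\<bar> \<le> A * (indicator C x + (u x)\<^sup>2)"
      unfolding abs_mult[of "indicator C x * a x"] by (intro mult_mono A) (use A0 in auto)
    with 1 show ?thesis unfolding T w_def real_norm_def by linarith
  qed
  have "null_on C (\<lambda>x. m x * (fq_reg q (d j) (u x) * (x \<bullet> V x)) + a x * Fq_reg q (d j) (u x))" for j
    unfolding a_def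
    by (rule chain_identity[OF m Dm Fq_reg_deriv[OF q d0] _ _ fq_reg_Lipschitz[OF q d0]]) (simp_all add: Fq_reg_def fq_reg_def)
  then have T0: "(LBINT x. T j x) = 0" for j by (simp add: null_on_def T_def)
  have "(\<lambda>j. LBINT x. T j x) \<longlonglongrightarrow> (LBINT x. S x)"
    by (rule integral_dominated_convergence[where s = T, OF Sm Tm wi]) (use lim Tw in auto)
  moreover have "integrable lborel S"
    by (rule integrable_dominated_convergence[where s = T, OF Sm Tm wi]) (use lim Tw in auto)
  ultimately show ?thesis by (simp add: T0 LIMSEQ_const_iff null_on_def S_def[abs_def] a_def)
qed

end

section \<open>Radial multipliers\<close>

text \<open>Since C avoids the origin, ln |x| is continuous on C and functions of it are admissible
  coefficients.\<close>

locale weak_poisson_annular = weak_poisson +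
  assumes C0: "0 \<notin> C"
begin

lemma ln_norm_continuous: "continuous_on C (\<lambda>x. ln (norm x))"
  using C0 by (intro continuous_intros) auto

lemma radial_continuous:
  fixes M :: "real \<Rightarrow> real"
  assumes "continuous_on UNIV M" shows "continuous_on C (\<lambda>x. M (ln (norm x)))"
  by (rule continuous_on_compose2[OF assms ln_norm_continuous]) auto

text \<open>Pairing this gradient with x gives M'(ln |x|): in the variable t = ln |x| the Euler
  field \<open>x \<bullet> \<nabla>\<close> is d/dt.\<close>

lemma radial_gradient:
  fixes x :: 'a
  assumes M: "\<And>t. (M has_real_derivative M' t) (at t)" and x: "x \<in> C"
  shows "GDERIV (\<lambda>x. M (ln (norm x))) x :> (M' (ln (norm x)) / (norm x)\<^sup>2) *\<^sub>R x"
proof -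
  have x0: "x \<noteq> 0" using x C0 by auto
  have "GDERIV (\<lambda>x. ln (norm x)) x :> (1 / norm x) *\<^sub>R sgn x"
    by (rule GDERIV_DERIV_compose[OF GDERIV_norm[OF x0]]) (use x0 in \<open>simp add: DERIV_ln_divide\<close>)
  from GDERIV_DERIV_compose[OF this M] show ?thesis
    by (simp add: sgn_div_norm power2_eq_square divide_inverse)
qed

lemma radial_gradient_continuous:
  assumes "continuous_on UNIV M'"
  shows "continuous_on C (\<lambda>x. (M' (ln (norm x)) / (norm x)\<^sup>2) *\<^sub>R x)"
  by (intro continuous_intros radial_continuous[OF assms]) (use C0 in auto)

context
  fixes M M' :: "real \<Rightarrow> real"
  assumes M: "\<And>t. (M has_real_derivative M' t) (at t)" and M': "continuous_on UNIV M'"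
begin

lemma radial_energy:
  "null_on C (\<lambda>x. M (ln (norm x)) * (u x * h x) + M (ln (norm x)) * (V x \<bullet> V x)
     + M' (ln (norm x)) / (norm x)\<^sup>2 * (u x * (x \<bullet> V x)))"
  by (rule null_on_cong[OF energy_identity[OF radial_gradient[OF M] radial_gradient_continuous[OF M']]])
     (simp_all add: mult.left_commute)

lemma radial_Rellich:
  "null_on C (\<lambda>x. M (ln (norm x)) * ((x \<bullet> V x) * h x)
     + (M (ln (norm x)) - (M' (ln (norm x)) + DIM('a) * M (ln (norm x))) / 2) * (V x \<bullet> V x)
     + M' (ln (norm x)) / (norm x)\<^sup>2 * ((x \<bullet> V x) * (x \<bullet> V x)))"
  by (rule null_on_cong[OF Rellich_identity[OF radial_gradient[OF M] radial_gradient_continuous[OF M']]])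
     (use C0 in \<open>auto simp: power2_norm_eq_inner mult.assoc\<close>)

lemma radial_square:
  "null_on C (\<lambda>x. M (ln (norm x)) * (u x * (x \<bullet> V x)) + (M' (ln (norm x)) + DIM('a) * M (ln (norm x))) * ((u x)\<^sup>2 / 2))"
proof (rule null_on_cong[OF chain_identity[OF radial_gradient[OF M] radial_gradient_continuous[OF M'], of "\<lambda>s. s\<^sup>2 / 2" "\<lambda>s. s" 1]])
  show "((\<lambda>s. s\<^sup>2 / 2) has_real_derivative s) (at s)" for s :: real
    by (auto intro!: derivative_eq_intros)
qed (use C0 in \<open>auto simp: power2_norm_eq_inner\<close>)

lemma radial_fq:
  assumes q: "1 \<le> q" "q < 2"
  shows "null_on C (\<lambda>x. M (ln (norm x)) * (fq q (u x) * (x \<bullet> V x))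
     + (M' (ln (norm x)) + DIM('a) * M (ln (norm x))) * (\<bar>u x\<bar> powr q / q))"
  by (rule null_on_cong[OF fq_identity[OF q radial_gradient[OF M] radial_gradient_continuous[OF M']]])
     (use C0 in \<open>auto simp: power2_norm_eq_inner mult.assoc\<close>)

end

end

section \<open>The Carleman weight\<close>

definition drift :: "real \<Rightarrow> real \<Rightarrow> real" where
  "drift \<tau> t = \<tau> * (1 - arctan t / 10) - 1"

definition drift1 :: "real \<Rightarrow> real \<Rightarrow> real" where
  "drift1 \<tau> t = - \<tau> / (10 * (1 + t\<^sup>2))"

definition drift2 :: "real \<Rightarrow> real \<Rightarrow> real" where
  "drift2 \<tau> t = \<tau> * t / (5 * (1 + t\<^sup>2)\<^sup>2)"

definition drift3 :: "real \<Rightarrow> real \<Rightarrow> real" where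
  "drift3 \<tau> t = \<tau> * (1 - 3 * t\<^sup>2) / (5 * (1 + t\<^sup>2) ^ 3)"

text \<open>With \<open>t = ln |x|\<close>, \<open>weight \<tau> t\<close> is \<open>exp (2 \<tau> \<phi>(x))\<close> and \<open>drift \<tau> t\<close> is \<open>- (\<tau> \<psi>'(t) + 1)\<close>,
  where the dash is the derivative with respect to \<open>t\<close>.\<close>

definition weight :: "real \<Rightarrow> real \<Rightarrow> real" where
  "weight \<tau> t = exp (2 * \<tau> * (- t + 1/10 * (t * arctan t - 1/2 * ln (1 + t\<^sup>2))))"

lemma one_plus_square_pos: "1 + (t::real)\<^sup>2 > 0"
  by (intro add_pos_nonneg) auto

lemma weight_pos: "weight \<tau> t > 0"
  by (simp add: weight_def)

lemma weight_eq: "x \<noteq> 0 \<Longrightarrow> weight \<tau> (ln (norm x)) = (exp (\<tau> * carleman_phi x))\<^sup>2"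
  by (simp add: weight_def carleman_phi_def carleman_psi_def exp_double[symmetric] mult.assoc)

lemma DERIV_drift [derivative_intros]: "(drift \<tau> has_real_derivative drift1 \<tau> t) (at t)"
proof -
  have "(drift \<tau> has_real_derivative \<tau> * (0 - inverse (1 + t\<^sup>2) / 10) - 0) (at t)"
    unfolding drift_def[abs_def]
    by (intro DERIV_diff DERIV_cmult DERIV_cdivide DERIV_const DERIV_arctan)
  then show ?thesis by (simp add: drift1_def inverse_eq_divide mult.commute)
qed

lemma DERIV_inverse_one_plus_square:
  "((\<lambda>t::real. inverse (1 + t\<^sup>2)) has_real_derivative - (2 * t * (inverse (1 + t\<^sup>2))\<^sup>2)) (at t)"
proof -
  have d: "((\<lambda>t::real. 1 + t\<^sup>2) has_real_derivative 2 * t) (at t)" by (auto intro!: derivative_eq_intros)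
  have "1 + t\<^sup>2 \<noteq> 0" using one_plus_square_pos[of t] by simp
  from DERIV_inverse_fun[OF d this] show ?thesis by (simp add: power2_eq_square mult_ac)
qed

lemma DERIV_drift1: "(drift1 \<tau> has_real_derivative drift2 \<tau> t) (at t)"
proof -
  have "drift1 \<tau> = (\<lambda>t. (- \<tau> / 10) * inverse (1 + t\<^sup>2))"
    by (simp add: fun_eq_iff drift1_def inverse_eq_divide)
  moreover have "drift2 \<tau> t = (- \<tau> / 10) * - (2 * t * (inverse (1 + t\<^sup>2))\<^sup>2)"
    by (simp add: drift2_def inverse_eq_divide power_divide)
  ultimately show ?thesis using DERIV_cmult[OF DERIV_inverse_one_plus_square] by metis
qed

lemma DERIV_drift2: "(drift2 \<tau> has_real_derivative drift3 \<tau> t) (at t)"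
proof -
  define i where "i = inverse (1 + t\<^sup>2)"
  have "1 + t\<^sup>2 \<noteq> 0" using one_plus_square_pos[of t] by simp
  \<comment> \<open>This relation replaces division by \<open>1 + t^2\<close>: inserted into the
    first summand, it brings both summands to the common factor \<open>i^3\<close>.\<close>
  then have i: "i + i * t\<^sup>2 = 1" by (simp add: i_def field_simps)
  have l: "((\<lambda>t. (\<tau> / 5) * t) has_real_derivative \<tau> / 5) (at t)" by (auto intro!: derivative_eq_intros)
  from DERIV_mult[OF l DERIV_power[OF DERIV_inverse_one_plus_square, of 2]]
  have "((\<lambda>t. (\<tau> / 5) * t * (inverse (1 + t\<^sup>2))\<^sup>2) has_real_derivative
      (\<tau> / 5) * i\<^sup>2 + (2 * (- (2 * t * i\<^sup>2) * i)) * ((\<tau> / 5) * t)) (at t)"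
    by (simp add: i_def)
  moreover have "(\<tau> / 5) * i\<^sup>2 + (2 * (- (2 * t * i\<^sup>2) * i)) * ((\<tau> / 5) * t) = drift3 \<tau> t"
  proof -
    have "(\<tau> / 5) * i\<^sup>2 + (2 * (- (2 * t * i\<^sup>2) * i)) * ((\<tau> / 5) * t)
        = (\<tau> / 5) * i\<^sup>2 * (i + i * t\<^sup>2) - 4 / 5 * \<tau> * t\<^sup>2 * i ^ 3"
      unfolding i by (simp add: power2_eq_square power3_eq_cube)
    also have "\<dots> = (\<tau> / 5) * i ^ 3 * (1 - 3 * t\<^sup>2)"
      by (simp add: power2_eq_square power3_eq_cube algebra_simps)
    also have "\<dots> = drift3 \<tau> t" by (simp add: drift3_def i_def inverse_eq_divide power_divide)
    finally show ?thesis .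
  qed
  moreover have "drift2 \<tau> = (\<lambda>t. (\<tau> / 5) * t * (inverse (1 + t\<^sup>2))\<^sup>2)"
    by (simp add: fun_eq_iff drift2_def inverse_eq_divide power_divide)
  ultimately show ?thesis by (simp only:)
qed

lemma DERIV_weight: "(weight \<tau> has_real_derivative - 2 * (drift \<tau> t + 1) * weight \<tau> t) (at t)"
proof -
  let ?E = "\<lambda>t. 2 * \<tau> * (- t + 1/10 * (t * arctan t - 1/2 * ln (1 + t\<^sup>2)))"
  have "(?E has_real_derivative - 2 * (drift \<tau> t + 1)) (at t)"
  proof -
    have d: "((\<lambda>t::real. 1 + t\<^sup>2) has_real_derivative 2 * t) (at t)" by (auto intro!: derivative_eq_intros)
    have l: "((\<lambda>t::real. ln (1 + t\<^sup>2)) has_real_derivative 1 / (1 + t\<^sup>2) * (2 * t)) (at t)"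
      by (rule DERIV_chain2[OF DERIV_ln_divide[OF one_plus_square_pos] d])
    have a: "((\<lambda>t::real. t * arctan t) has_real_derivative 1 * arctan t + inverse (1 + t\<^sup>2) * t) (at t)"
      by (rule DERIV_mult[OF DERIV_ident DERIV_arctan])
    have "(?E has_real_derivative 2 * \<tau> * (- 1 + 1/10 * (1 * arctan t + inverse (1 + t\<^sup>2) * t - 1/2 * (1 / (1 + t\<^sup>2) * (2 * t))))) (at t)"
      by (intro DERIV_cmult DERIV_add DERIV_minus DERIV_ident DERIV_diff l a)
    then show ?thesis
      by (rule DERIV_cong) (simp add: drift_def inverse_eq_divide algebra_simps)
  qed
  from DERIV_chain2[OF DERIV_exp this] show ?thesis unfolding weight_def[abs_def] by (simp add: mult.commute)
qed

text \<open>On the unit ball t \<le> 0, so arctan t \<le> 0 and the drift stays above \<tau> - 1.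
  The higher derivatives are measured by \<open>- drift1\<close> and not by \<tau>, because the
  commutator that has to absorb them decays like \<open>1 / (1 + t^2)\<close>.\<close>

lemma drift_bounds:
  assumes t: "t \<le> 0" and \<tau>: "\<tau> > 0"
  shows "\<tau> - 1 \<le> drift \<tau> t" "drift \<tau> t \<le> 2 * \<tau>"
    "drift1 \<tau> t < 0" "- drift1 \<tau> t \<le> \<tau>" "\<bar>drift2 \<tau> t\<bar> \<le> - drift1 \<tau> t" "\<bar>drift3 \<tau> t\<bar> \<le> 6 * (- drift1 \<tau> t)"
proof -
  have a: "arctan t \<le> 0" using t by simp
  have b: "- 10 \<le> arctan t" using arctan_bounded[of t] pi_less_4 by auto
  show "\<tau> - 1 \<le> drift \<tau> t" using mult_nonneg_nonpos[of \<tau> "arctan t"] a \<tau> by (simp add: drift_def algebra_simps)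
  have "\<tau> * (1 - arctan t / 10) \<le> \<tau> * 2" using b \<tau> by (intro mult_left_mono) auto
  then show "drift \<tau> t \<le> 2 * \<tau>" by (simp add: drift_def)
  define y where "y = 1 + t\<^sup>2"
  have y: "y \<ge> 1" by (simp add: y_def)
  show "drift1 \<tau> t < 0" using \<tau> y by (simp add: drift1_def y_def[symmetric])
  have "\<tau> / (10 * y) \<le> \<tau> / 1" using \<tau> y by (intro divide_left_mono) auto
  then show "- drift1 \<tau> t \<le> \<tau>" by (simp add: drift1_def y_def)
  have ty: "2 * \<bar>t\<bar> \<le> y" using sum_squares_bound[of "\<bar>t\<bar>" 1] by (simp add: y_def)
  have d2: "drift2 \<tau> t = \<tau> * t / (5 * y\<^sup>2)" and d3: "drift3 \<tau> t = \<tau> * (1 - 3 * t\<^sup>2) / (5 * y ^ 3)"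
    by (simp_all add: drift2_def drift3_def y_def)
  have "\<bar>drift2 \<tau> t\<bar> = \<tau> / (10 * y) * (2 * \<bar>t\<bar> / y)"
    using \<tau> y by (simp add: d2 abs_mult power2_eq_square)
  also have "\<dots> \<le> \<tau> / (10 * y) * 1" using ty y \<tau> by (intro mult_left_mono) (auto simp: divide_le_eq)
  finally show "\<bar>drift2 \<tau> t\<bar> \<le> - drift1 \<tau> t" by (simp add: drift1_def y_def)
  have "\<bar>1 - 3 * t\<^sup>2\<bar> \<le> 3 * y" by (simp add: y_def abs_le_iff)
  also have "3 * y \<le> 3 * y\<^sup>2" using y by (simp add: power2_eq_square)
  finally have ny: "\<bar>1 - 3 * t\<^sup>2\<bar> / y\<^sup>2 \<le> 3" using y by (simp add: divide_le_eq)
  have "\<bar>drift3 \<tau> t\<bar> = \<tau> / (10 * y) * (2 * (\<bar>1 - 3 * t\<^sup>2\<bar> / y\<^sup>2))"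
    using \<tau> y by (simp add: d3 abs_mult power2_eq_square power3_eq_cube)
  also have "\<dots> \<le> \<tau> / (10 * y) * (2 * 3)" using ny y \<tau> by (intro mult_left_mono) auto
  finally show "\<bar>drift3 \<tau> t\<bar> \<le> 6 * (- drift1 \<tau> t)" by (simp add: drift1_def y_def mult.commute)
qed

text \<open>In the variable \<open>v = exp (\<tau> \<psi> + n t / 2) u\<close> the symmetric and antisymmetric parts decouple;
  up to the exponential factor, \<open>e + \<sigma> u\<close>
  is the \<open>t\<close>-derivative of \<open>v\<close>, with \<open>e = x \<bullet> \<nabla>u\<close>.\<close>

lemma conjugated_square:
  fixes p p1 p2 p3 \<sigma> k k' b b' e u :: real
  assumes "k = 2 * p * \<sigma> + p1" and "k' = 2 * p1 * \<sigma> - 2 * p * p1 + p2"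
    and "b = 2 * (4 * p\<^sup>2 - 2 * p1) * \<sigma> + 4 * p * p1 + k' - 2 * p * k"
    and "b' = 2 * (8 * p * p1 - 2 * p2) * \<sigma> - 2 * (4 * p\<^sup>2 - 2 * p1) * p1 + 4 * p1\<^sup>2 + 4 * p * p2
        + (2 * p2 * \<sigma> - 4 * p1\<^sup>2 - 2 * p * p2 + p3) - 2 * p1 * k - 2 * p * k'"
  shows "(2 * p * (e + \<sigma> * u) + p1 * u)\<^sup>2 - 2 * p1 * (e + \<sigma> * u)\<^sup>2 + (p3 / 2 - 2 * p\<^sup>2 * p1) * u\<^sup>2
    = (4 * p\<^sup>2 - 2 * p1) * e\<^sup>2 + (b - k' + 2 * p * k) * (u * e) + (b' / 2 + \<sigma> * b) * u\<^sup>2"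
  unfolding assms by (simp add: power2_eq_square field_simps)

text \<open>Here R stands for |x|^2, S for |\<nabla>u|^2 and \<open>iq\<close> for 1 / q.
  \<open>Z\<close> is the sum of the energy identity with multiplier \<open>k w R\<close> and of the
  Rellich and power identities with multiplier \<open>2 p w R\<close>, minus the chain identity for
  u^2 with multiplier \<open>w b\<close>. The choice of \<open>k\<close> turns
  \<open>2 p e + k u\<close> into the test function \<open>2 p (e + \<sigma> u) + p1 u\<close>; the
  choice of \<sigma> cancels all terms in S; \<open>b\<close> converts the surplus of the cross term
  \<open>u e\<close> into a multiple of u^2. In front of \<open>f u\<close> the terms of order
  \<open>p^2\<close> cancel except for \<open>2 a p^2\<close>, the contribution of 1 / q - 1 /
  2.\<close>

lemma carleman_pointwise_identity:
  fixes p p1 p2 p3 \<sigma> k k' b b' e u n w R g f S a iq Z :: real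
  assumes \<sigma>: "\<sigma> = - p - 1 + n / 2" and k: "k = 2 * p * \<sigma> + p1" and k': "k' = 2 * p1 * \<sigma> - 2 * p * p1 + p2"
    and b: "b = 2 * (4 * p\<^sup>2 - 2 * p1) * \<sigma> + 4 * p * p1 + k' - 2 * p * k"
    and b': "b' = 2 * (8 * p * p1 - 2 * p2) * \<sigma> - 2 * (4 * p\<^sup>2 - 2 * p1) * p1 + 4 * p1\<^sup>2 + 4 * p * p2
        + (2 * p2 * \<sigma> - 4 * p1\<^sup>2 - 2 * p * p2 + p3) - 2 * p1 * k - 2 * p * k'"
    and iq: "iq = (1 + a) / 2"
    and Z: "Z = (k * (w * R) * (u * (g - f)) + k * (w * R) * S + (k' - 2 * p * k) * w * (u * e))
      + (2 * p * (w * R) * (e * (g - f)) + (2 * p * (w * R) - ((2 * p1 - 4 * p\<^sup>2) * (w * R) + n * (2 * p * (w * R))) / 2) * S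
         + (2 * p1 - 4 * p\<^sup>2) * w * (e * e))
      + (2 * p * (w * R) * (f * e) + ((2 * p1 - 4 * p\<^sup>2) * (w * R) + n * (2 * p * (w * R))) * (f * u * iq))
      - (w * b * (u * e) + (w * (b' - 2 * (p + 1) * b) + n * (w * b)) * (u\<^sup>2 / 2))"
  shows "- Z = w * ((2 * p * (e + \<sigma> * u) + p1 * u)\<^sup>2 - 2 * p1 * (e + \<sigma> * u)\<^sup>2 + (p3 / 2 - 2 * p\<^sup>2 * p1) * u\<^sup>2)
     + w * R * (- a * p1 + 2 * a * p\<^sup>2 - p * (2 + n * a)) * (f * u)
     - w * R * g * (2 * p * (e + \<sigma> * u) + p1 * u)"
proof -
  have n: "n = 2 * (\<sigma> + p + 1)" using \<sigma> by simp
  show ?thesis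
    unfolding conjugated_square[OF k k' b b'] Z iq n unfolding k
    by (simp add: power2_eq_square field_simps)
qed

text \<open>The positive terms of the identity are kept and the errors absorbed: g by the square of
  the test function, \<open>p3\<close> and the terms linear in \<open>p\<close> by half of the
  respective leading terms.\<close>

lemma carleman_pointwise_main:
  fixes p p1 p2 p3 \<sigma> e u n w R g U a Z :: real
  assumes w: "w \<ge> 0" and R: "R > 0" and p1: "p1 < 0" and p3: "\<bar>p3\<bar> \<le> 6 * (- p1)" and p: "p \<ge> 3"
    and a: "0 < a" and pa: "2 / a + n \<le> p" and U: "U \<ge> 0"
    and Z: "- Z = w * ((2 * p * (e + \<sigma> * u) + p1 * u)\<^sup>2 - 2 * p1 * (e + \<sigma> * u)\<^sup>2 + (p3 / 2 - 2 * p\<^sup>2 * p1) * u\<^sup>2)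
     + w * R * (- a * p1 + 2 * a * p\<^sup>2 - p * (2 + n * a)) * U
     - w * R * g * (2 * p * (e + \<sigma> * u) + p1 * u)"
  shows "w * (- p1) * (2 * (e + \<sigma> * u)\<^sup>2 + p\<^sup>2 * u\<^sup>2) + w * R * (a * p\<^sup>2) * U \<le> - Z + w * (R * g)\<^sup>2 / 4"
proof -
  define A where "A = 2 * p * (e + \<sigma> * u) + p1 * u"
  \<comment> \<open>Young's inequality with weights that spend the whole square \<open>A^2\<close>
    and leave a quarter for g.\<close>
  have 1: "R * g * A \<le> (R * g)\<^sup>2 / 4 + A\<^sup>2"
    using zero_le_power2[of "R * g / 2 - A"] by (simp add: power2_eq_square field_simps)
  have p9: "p\<^sup>2 \<ge> 3" using power_mono[OF p, of 2] by simp
  \<comment> \<open>\<open>p3 / 2\<close> costs at most 3 (- p1), which one of the two copies of (-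
    p1) p^2 covers.\<close>
  have 2: "(- p1) * p\<^sup>2 \<le> p3 / 2 - 2 * p\<^sup>2 * p1"
  proof -
    have "(- p1) * 3 \<le> (- p1) * p\<^sup>2" using p9 p1 by (intro mult_left_mono) auto
    then show ?thesis using p3 by (simp add: abs_le_iff algebra_simps)
  qed
  \<comment> \<open>The source of the threshold for \<tau>: 2 / a + n \<le> p means 2 + n a \<le> a
    p, so half of \<open>2 a p^2\<close> absorbs the terms linear in p.\<close>
  have 3: "a * p\<^sup>2 \<le> - a * p1 + 2 * a * p\<^sup>2 - p * (2 + n * a)"
  proof -
    have "2 + n * a \<le> a * p" using pa a by (simp add: field_simps)
    then have "p * (2 + n * a) \<le> p * (a * p)" using p by (intro mult_left_mono) auto
    moreover have "a * p1 \<le> 0" using a p1 by (simp add: mult_nonneg_nonpos)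
    ultimately show ?thesis by (simp add: power2_eq_square algebra_simps)
  qed
  have "w * R * (a * p\<^sup>2) * U \<le> w * R * (- a * p1 + 2 * a * p\<^sup>2 - p * (2 + n * a)) * U"
    using w R U 3 by (intro mult_right_mono mult_left_mono) auto
  moreover have "w * (R * g * A) \<le> w * ((R * g)\<^sup>2 / 4 + A\<^sup>2)" using 1 w by (rule mult_left_mono)
  moreover have "w * ((- p1) * p\<^sup>2 * u\<^sup>2) \<le> w * ((p3 / 2 - 2 * p\<^sup>2 * p1) * u\<^sup>2)"
    using w 2 by (intro mult_left_mono mult_right_mono) auto
  ultimately show ?thesis unfolding Z A_def[symmetric] by (simp add: algebra_simps)
qed

text \<open>The main estimate controls only the radial part of the gradient. The energy identity
  with multiplier \<open>- p1 w R\<close> recovers all of it: this multiplier carries the factor of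
  the commutator, so that the remaining terms are dominated by \<open>P\<close> and g.\<close>

lemma carleman_pointwise_gradient:
  fixes p p1 p2 \<sigma> e u n w R g f U a S Z P :: real
  assumes w: "w \<ge> 0" and R: "R > 0" and p1: "p1 < 0" "- p1 \<le> p\<^sup>2" and p2: "\<bar>p2\<bar> \<le> - p1" and p: "p \<ge> 3"
    and a: "0 < a" "a \<le> 1" and U: "U \<ge> 0" "U = f * u" and \<sigma>: "\<bar>\<sigma>\<bar> \<le> 2 * p"
    and Z: "Z = (- p1) * (w * R) * (u * (g - f)) + (- p1) * (w * R) * S + (2 * p * p1 - p2) * w * (u * e)"
    and P: "P = w * (- p1) * (2 * (e + \<sigma> * u)\<^sup>2 + p\<^sup>2 * u\<^sup>2) + w * R * (a * p\<^sup>2) * U"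
  shows "(- p1) * (w * R) * S \<le> Z + w * (R * g)\<^sup>2 / 2 + 9 / a * P"
proof -
  define \<nu> Y where "\<nu> = - p1" and "Y = e + \<sigma> * u"
  have \<nu>: "\<nu> > 0" "\<nu> \<le> p\<^sup>2" using p1 by (auto simp: \<nu>_def)
  have 1: "- \<nu> * (R * g) * u \<le> (R * g)\<^sup>2 / 2 + \<nu> * (p\<^sup>2 * u\<^sup>2) / 2"
  proof -
    have "- \<nu> * (R * g) * u \<le> (R * g)\<^sup>2 / 2 + \<nu>\<^sup>2 * u\<^sup>2 / 2"
      using zero_le_power2[of "R * g + \<nu> * u"] by (simp add: power2_eq_square algebra_simps)
    moreover have "\<nu>\<^sup>2 * u\<^sup>2 \<le> \<nu> * (p\<^sup>2 * u\<^sup>2)"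
      unfolding power2_eq_square[of \<nu>] mult.assoc using \<nu> by (intro mult_left_mono mult_right_mono) auto
    ultimately show ?thesis by linarith
  qed
  have 2: "- ((2 * p * p1 - p2) * (u * e)) \<le> \<nu> * (3 * Y\<^sup>2 + 8 * (p\<^sup>2 * u\<^sup>2))"
  proof -
    have c: "\<bar>2 * p * p1 - p2\<bar> \<le> 3 * p * \<nu>"
    proof -
      have "\<bar>2 * p * p1\<bar> = 2 * p * \<nu>" using p p1 by (simp add: abs_mult \<nu>_def)
      moreover have "\<bar>p2\<bar> \<le> p * \<nu>" 
      proof -
        have "1 * \<nu> \<le> p * \<nu>" using p \<nu>(1) by (intro mult_right_mono) auto
        then show ?thesis using p2 by (simp add: \<nu>_def)
      qed
      ultimately show ?thesis using abs_triangle_ineq4[of "2 * p * p1" p2] by (simp add: algebra_simps)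
    qed
    \<comment> \<open>\<open>e\<close> is not controlled directly; it is
      \<open>Y - \<sigma> u\<close>, and both Y and p u are.\<close>
    have "\<bar>u * e\<bar> \<le> \<bar>u\<bar> * \<bar>Y\<bar> + 2 * p * u\<^sup>2"
    proof -
      have "u * e = u * Y - \<sigma> * u\<^sup>2" by (simp add: Y_def power2_eq_square algebra_simps)
      then have "\<bar>u * e\<bar> \<le> \<bar>u * Y\<bar> + \<bar>\<sigma> * u\<^sup>2\<bar>" by simp
      moreover have "\<bar>\<sigma> * u\<^sup>2\<bar> \<le> 2 * p * u\<^sup>2" unfolding abs_mult using \<sigma> by (intro mult_mono) auto
      ultimately show ?thesis by (simp add: abs_mult)
    qed
    then have "\<bar>2 * p * p1 - p2\<bar> * \<bar>u * e\<bar> \<le> 3 * p * \<nu> * (\<bar>u\<bar> * \<bar>Y\<bar> + 2 * p * u\<^sup>2)"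
      using c p \<nu> by (intro mult_mono) auto
    also have "\<dots> = \<nu> * (3 * (p * \<bar>u\<bar>) * \<bar>Y\<bar> + 6 * (p\<^sup>2 * u\<^sup>2))" by (simp add: power2_eq_square algebra_simps)
    also have "\<dots> \<le> \<nu> * (3 * Y\<^sup>2 + 8 * (p\<^sup>2 * u\<^sup>2))"
    proof (rule mult_left_mono)
      have "2 * ((p * \<bar>u\<bar>) * \<bar>Y\<bar>) \<le> (p * \<bar>u\<bar>)\<^sup>2 + \<bar>Y\<bar>\<^sup>2" using sum_squares_bound[of "p * \<bar>u\<bar>" "\<bar>Y\<bar>"] by (simp add: mult.assoc)
      then have "2 * ((p * \<bar>u\<bar>) * \<bar>Y\<bar>) \<le> p\<^sup>2 * u\<^sup>2 + Y\<^sup>2" by (simp add: power_mult_distrib)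
      moreover have "0 \<le> p\<^sup>2 * u\<^sup>2" "0 \<le> Y\<^sup>2" by auto
      ultimately show "3 * (p * \<bar>u\<bar>) * \<bar>Y\<bar> + 6 * (p\<^sup>2 * u\<^sup>2) \<le> 3 * Y\<^sup>2 + 8 * (p\<^sup>2 * u\<^sup>2)"
        unfolding mult.assoc[of 3] by linarith
    qed (use \<nu> in simp)
    finally show ?thesis using abs_ge_minus_self[of "(2 * p * p1 - p2) * (u * e)"] by (simp add: abs_mult)
  qed
  have 3: "w * R * \<nu> * U \<le> w * R * p\<^sup>2 * U" using \<nu> w R U by (intro mult_right_mono mult_left_mono) auto
  \<comment> \<open>The factor 1 / a undoes the \<open>a\<close> in the last term of
    \<open>P\<close>. The 9 covers the 8 + 1 / 2 in front of \<open>p^2 u^2\<close>; the 3 in front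
    of \<open>Y^2\<close> is met by 18.\<close>
  have a1: "9 / a \<ge> 9" using a by (simp add: field_simps)
  have Q0: "0 \<le> w * \<nu> * (2 * Y\<^sup>2 + p\<^sup>2 * u\<^sup>2)" using w \<nu> by auto
  have U0: "0 \<le> w * R * p\<^sup>2 * U" using w R U(1) by auto
  have P9: "9 / a * P = 9 / a * (w * \<nu> * (2 * Y\<^sup>2 + p\<^sup>2 * u\<^sup>2)) + 9 * (w * R * p\<^sup>2 * U)"
    using a by (simp add: P Y_def \<nu>_def field_simps)
  have P9': "9 * (w * \<nu> * (2 * Y\<^sup>2 + p\<^sup>2 * u\<^sup>2)) \<le> 9 / a * (w * \<nu> * (2 * Y\<^sup>2 + p\<^sup>2 * u\<^sup>2))"
    by (rule mult_right_mono[OF a1 Q0])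
  have e: "(- p1) * (w * R) * S = Z + w * (- \<nu> * (R * g) * u) + w * R * \<nu> * U + w * (- ((2 * p * p1 - p2) * (u * e)))"
    unfolding Z U(2) \<nu>_def by (simp add: algebra_simps)
  have "w * (- \<nu> * (R * g) * u) \<le> w * ((R * g)\<^sup>2 / 2 + \<nu> * (p\<^sup>2 * u\<^sup>2) / 2)" using 1 w by (rule mult_left_mono)
  moreover have "w * (- ((2 * p * p1 - p2) * (u * e))) \<le> w * (\<nu> * (3 * Y\<^sup>2 + 8 * (p\<^sup>2 * u\<^sup>2)))"
    using 2 w by (rule mult_left_mono)
  moreover have "0 \<le> w * (\<nu> * Y\<^sup>2)" "0 \<le> w * (\<nu> * (p\<^sup>2 * u\<^sup>2))" using w \<nu> by auto
  ultimately show ?thesis unfolding e using P9 P9' 3 U0 by (simp add: algebra_simps)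
qed

lemma drift_continuous:
  "continuous_on UNIV (drift \<tau>)" "continuous_on UNIV (drift1 \<tau>)" "continuous_on UNIV (drift2 \<tau>)"
  "continuous_on UNIV (drift3 \<tau>)" "continuous_on UNIV (weight \<tau>)"
proof -
  show "continuous_on UNIV (drift \<tau>)" "continuous_on UNIV (drift1 \<tau>)" "continuous_on UNIV (drift2 \<tau>)" "continuous_on UNIV (weight \<tau>)"
    using DERIV_drift DERIV_drift1 DERIV_drift2 DERIV_weight DERIV_isCont continuous_at_imp_continuous_on by metis+
  show "continuous_on UNIV (drift3 \<tau>)"
    unfolding drift3_def[abs_def] using one_plus_square_pos
    by (intro continuous_intros) (auto simp: less_imp_neq[symmetric])
qed

section \<open>Integrated estimates for the squares of the three norms\<close>

context weak_poisson_annular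
begin

lemma integral_on_C_mono:
  fixes f :: "'a \<Rightarrow> real"
  assumes "integrable lborel (\<lambda>x. indicator C x * f x)" "integrable lborel (\<lambda>x. indicator C x * g x)"
    and "\<And>x. x \<in> C \<Longrightarrow> f x \<le> g x"
  shows "(LBINT x. indicator C x * f x) \<le> (LBINT x. indicator C x * g x)"
  using assms by (intro integral_mono) (auto simp: indicator_def)

lemma integrable_on_C_add:
  fixes f :: "'a \<Rightarrow> real"
  shows "integrable lborel (\<lambda>x. indicator C x * f x) \<Longrightarrow> integrable lborel (\<lambda>x. indicator C x * g x) \<Longrightarrow>
    integrable lborel (\<lambda>x. indicator C x * (f x + g x))"
  by (simp add: distrib_left)

lemma on_C_scale:
  fixes f :: "'a \<Rightarrow> real"
  shows "integrable lborel (\<lambda>x. indicator C x * f x) \<Longrightarrow> integrable lborel (\<lambda>x. indicator C x * (c * f x))"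
    and "(LBINT x. indicator C x * (c * f x)) = c * (LBINT x. indicator C x * f x)"
proof -
  have "(\<lambda>x. indicator C x * (c * f x)) = (\<lambda>x. c * (indicator C x * f x))" by (simp add: mult.left_commute)
  then show "integrable lborel (\<lambda>x. indicator C x * f x) \<Longrightarrow> integrable lborel (\<lambda>x. indicator C x * (c * f x))"
    "(LBINT x. indicator C x * (c * f x)) = c * (LBINT x. indicator C x * f x)" by simp_all
qed

lemma exp_ln_norm: "x \<in> C \<Longrightarrow> exp (2 * ln (norm x)) = (norm x)\<^sup>2"
  using C0 by (subst exp_double) auto

text \<open>Integrating the two pointwise inequalities removes \<open>Z\<close> and
  \<open>ZB\<close>, which have integral 0. This bounds the integral of \<open>P\<close> by R / 4
  and that of the weighted |\<nabla>u|^2 by 3 R / a; the lower bounds for the drift convert these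
  into powers of \<tau>.\<close>

lemma carleman_weighted:
  fixes g :: "'a \<Rightarrow> real"
  assumes q: "1 \<le> q" "q < 2" and g: "sq_integrable g" and hg: "\<And>x. h x = g x - fq q (u x)"
    and C1: "\<And>x. x \<in> C \<Longrightarrow> norm x \<le> 1" and a: "a = (2 - q) / q"
    and \<tau>: "4 + 2 / a + DIM('a) \<le> \<tau>"
  defines "R \<equiv> LBINT x. indicator C x * (weight \<tau> (ln (norm x)) * ((norm x)\<^sup>2 * g x)\<^sup>2)"
  shows "integrable lborel (\<lambda>x. indicator C x * (weight \<tau> (ln (norm x)) / (1 + (ln (norm x))\<^sup>2) * (u x)\<^sup>2))"
    and "\<tau> ^ 3 * (LBINT x. indicator C x * (weight \<tau> (ln (norm x)) / (1 + (ln (norm x))\<^sup>2) * (u x)\<^sup>2)) \<le> 10 * R"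
    and "integrable lborel (\<lambda>x. indicator C x * (weight \<tau> (ln (norm x)) * (norm x)\<^sup>2 / (1 + (ln (norm x))\<^sup>2) * (V x \<bullet> V x)))"
    and "\<tau> * (LBINT x. indicator C x * (weight \<tau> (ln (norm x)) * (norm x)\<^sup>2 / (1 + (ln (norm x))\<^sup>2) * (V x \<bullet> V x))) \<le> 30 / a * R"
    and "integrable lborel (\<lambda>x. indicator C x * (weight \<tau> (ln (norm x)) * (norm x)\<^sup>2 * \<bar>u x\<bar> powr q))"
    and "a * \<tau>\<^sup>2 * (LBINT x. indicator C x * (weight \<tau> (ln (norm x)) * (norm x)\<^sup>2 * \<bar>u x\<bar> powr q)) \<le> R"
proof -
  define n where "n = real DIM('a)"
  have n1: "n \<ge> 1" using DIM_positive[where 'a='a] by (simp add: n_def)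
  have a0: "0 < a" and a1: "a \<le> 1" using q by (auto simp: a field_simps)
  have a2: "2 / a \<ge> 2" using a0 a1 by (simp add: field_simps)
  have iq: "1 / q = (1 + a) / 2" using q by (simp add: a field_simps)
  define w where "w = weight \<tau>"
  \<comment> \<open>The -1 in the drift is chosen for this function: the factor |x|^2 contributes
    +2, so that \<open>W' = - 2 p W\<close>.\<close>
  define W where "W t = w t * exp (2 * t)" for t
  define p where "p = drift \<tau>"
  define p1 where "p1 = drift1 \<tau>"
  define p2 where "p2 = drift2 \<tau>"
  define p3 where "p3 = drift3 \<tau>"
  note dp = DERIV_drift[of \<tau>, folded p_def p1_def] and dp1 = DERIV_drift1[of \<tau>, folded p1_def p2_def]
    and dp2 = DERIV_drift2[of \<tau>, folded p2_def p3_def]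
  have dw: "(w has_real_derivative - 2 * (p t + 1) * w t) (at t)" for t
    using DERIV_weight[of \<tau> t] by (simp add: w_def p_def)
  have dW: "(W has_real_derivative - 2 * p t * W t) (at t)" for t
    unfolding W_def[abs_def] by (auto intro!: derivative_eq_intros dw simp: algebra_simps)
  \<comment> \<open>The logarithmic derivative of \<open>exp (\<tau> \<psi> + n t / 2)\<close>,
    rewritten in terms of the drift.\<close>
  define \<sigma> where "\<sigma> t = - p t - 1 + n / 2" for t
  define k where "k t = 2 * p t * \<sigma> t + p1 t" for t
  define k' where "k' t = 2 * p1 t * \<sigma> t - 2 * p t * p1 t + p2 t" for t
  define b where "b t = 2 * (4 * (p t)\<^sup>2 - 2 * p1 t) * \<sigma> t + 4 * p t * p1 t + k' t - 2 * p t * k t" for t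
  define b' where "b' t = 2 * (8 * p t * p1 t - 2 * p2 t) * \<sigma> t - 2 * (4 * (p t)\<^sup>2 - 2 * p1 t) * p1 t + 4 * (p1 t)\<^sup>2 + 4 * p t * p2 t
        + (2 * p2 t * \<sigma> t - 4 * (p1 t)\<^sup>2 - 2 * p t * p2 t + p3 t) - 2 * p1 t * k t - 2 * p t * k' t" for t
  have d\<sigma>: "(\<sigma> has_real_derivative - p1 t) (at t)" for t
    unfolding \<sigma>_def[abs_def] by (auto intro!: derivative_eq_intros dp)
  have dk: "(k has_real_derivative k' t) (at t)" for t
    unfolding k_def[abs_def] k'_def by (auto intro!: derivative_eq_intros dp dp1 d\<sigma> simp: algebra_simps)
  have dk': "(k' has_real_derivative 2 * p2 t * \<sigma> t - 4 * (p1 t)\<^sup>2 - 2 * p t * p2 t + p3 t) (at t)" for t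
    unfolding k'_def[abs_def] by (auto intro!: derivative_eq_intros dp dp1 dp2 d\<sigma> simp: algebra_simps power2_eq_square)
  have db: "(b has_real_derivative b' t) (at t)" for t
    unfolding b_def[abs_def] b'_def
    by (auto intro!: derivative_eq_intros dp dp1 dp2 d\<sigma> dk dk' simp: algebra_simps power2_eq_square)
  have c0: "continuous_on UNIV p" "continuous_on UNIV p1" "continuous_on UNIV p2" "continuous_on UNIV p3" "continuous_on UNIV w"
    using drift_continuous[of \<tau>] by (simp_all add: p_def p1_def p2_def p3_def w_def)
  have cW: "continuous_on UNIV W" unfolding W_def[abs_def] by (intro continuous_intros c0)
  have c\<sigma>: "continuous_on UNIV \<sigma>" unfolding \<sigma>_def[abs_def] by (intro continuous_intros c0)
  have ck: "continuous_on UNIV k" unfolding k_def[abs_def] by (intro continuous_intros c0 c\<sigma>)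
  have ck': "continuous_on UNIV k'" unfolding k'_def[abs_def] by (intro continuous_intros c0 c\<sigma>)
  have cb: "continuous_on UNIV b" unfolding b_def[abs_def] by (intro continuous_intros c0 c\<sigma> ck ck')
  have cb': "continuous_on UNIV b'" unfolding b'_def[abs_def] by (intro continuous_intros c0 c\<sigma> ck ck')
  have d1: "((\<lambda>t. k t * W t) has_real_derivative (k' t - 2 * p t * k t) * W t) (at t)" for t
    by (auto intro!: derivative_eq_intros dk dW simp: algebra_simps)
  have d2: "((\<lambda>t. 2 * p t * W t) has_real_derivative (2 * p1 t - 4 * (p t)\<^sup>2) * W t) (at t)" for t
    by (auto intro!: derivative_eq_intros dp dW simp: algebra_simps power2_eq_square)
  have d3: "((\<lambda>t. w t * b t) has_real_derivative w t * (b' t - 2 * (p t + 1) * b t)) (at t)" for t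
    by (auto intro!: derivative_eq_intros dw db simp: algebra_simps)
  have d4: "((\<lambda>t. - p1 t * W t) has_real_derivative (2 * p t * p1 t - p2 t) * W t) (at t)" for t
    by (auto intro!: derivative_eq_intros dp1 dW simp: algebra_simps)
  have e1: "continuous_on UNIV (\<lambda>t. (k' t - 2 * p t * k t) * W t)" by (intro continuous_intros c0 cW ck ck')
  have e2: "continuous_on UNIV (\<lambda>t. (2 * p1 t - 4 * (p t)\<^sup>2) * W t)" by (intro continuous_intros c0 cW)
  have e3: "continuous_on UNIV (\<lambda>t. w t * (b' t - 2 * (p t + 1) * b t))" by (intro continuous_intros c0 cb cb')
  have e4: "continuous_on UNIV (\<lambda>t. (2 * p t * p1 t - p2 t) * W t)" by (intro continuous_intros c0 cW)
  define l where "l x = ln (norm x)" for x :: 'a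
  define e where "e x = x \<bullet> V x" for x
  define f where "f x = fq q (u x)" for x
  have fu: "f x * u x = \<bar>u x\<bar> powr q" for x using q by (simp add: f_def fq_mult_self)
  have Wl: "W (l x) = w (l x) * (norm x)\<^sup>2" if "x \<in> C" for x
    using exp_ln_norm[OF that] by (simp add: W_def l_def)
  have nx: "norm x > 0" if "x \<in> C" for x using that C0 by auto
  have W_div: "A * W (l x) / (norm x)\<^sup>2 = A * w (l x)" if "x \<in> C" for A x using nx[OF that] by (simp add: Wl[OF that])
  \<comment> \<open>Copied in shape from \<open>carleman_pointwise_identity\<close>; the derivatives
    \<open>d1\<close>, \<open>d2\<close>, \<open>d3\<close> of the multipliers make each bracket one
    of the four null integrands.\<close>
  define Z where "Z x = (k (l x) * (w (l x) * (norm x)\<^sup>2) * (u x * (g x - f x)) + k (l x) * (w (l x) * (norm x)\<^sup>2) * (V x \<bullet> V x)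
       + (k' (l x) - 2 * p (l x) * k (l x)) * w (l x) * (u x * e x))
      + (2 * p (l x) * (w (l x) * (norm x)\<^sup>2) * (e x * (g x - f x)) + (2 * p (l x) * (w (l x) * (norm x)\<^sup>2)
          - ((2 * p1 (l x) - 4 * (p (l x))\<^sup>2) * (w (l x) * (norm x)\<^sup>2) + n * (2 * p (l x) * (w (l x) * (norm x)\<^sup>2))) / 2) * (V x \<bullet> V x)
         + (2 * p1 (l x) - 4 * (p (l x))\<^sup>2) * w (l x) * (e x * e x))
      + (2 * p (l x) * (w (l x) * (norm x)\<^sup>2) * (f x * e x)
          + ((2 * p1 (l x) - 4 * (p (l x))\<^sup>2) * (w (l x) * (norm x)\<^sup>2) + n * (2 * p (l x) * (w (l x) * (norm x)\<^sup>2))) * (f x * u x * (1 / q)))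
      - (w (l x) * b (l x) * (u x * e x) + (w (l x) * (b' (l x) - 2 * (p (l x) + 1) * b (l x)) + n * (w (l x) * b (l x))) * ((u x)\<^sup>2 / 2))" for x
  have nZ: "null_on C Z"
    by (rule null_on_cong[OF null_on_diff[OF null_on_add[OF null_on_add[OF
        radial_energy[OF d1 e1] radial_Rellich[OF d2 e2]] radial_fq[OF d2 e2 q]] radial_square[OF d3 e3]],
        folded l_def e_def f_def n_def], simp only: W_div Z_def hg fu f_def[symmetric]) (simp add: Wl)
  define ZB where "ZB x = (- p1 (l x)) * (w (l x) * (norm x)\<^sup>2) * (u x * (g x - f x)) + (- p1 (l x)) * (w (l x) * (norm x)\<^sup>2) * (V x \<bullet> V x)
     + (2 * p (l x) * p1 (l x) - p2 (l x)) * w (l x) * (u x * e x)" for x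
  have nZB: "null_on C ZB"
    by (rule null_on_cong[OF radial_energy[OF d4 e4], folded l_def e_def], simp only: W_div ZB_def hg f_def[symmetric])
       (simp add: Wl)
  define P where "P x = w (l x) * (- p1 (l x)) * (2 * (e x + \<sigma> (l x) * u x)\<^sup>2 + (p (l x))\<^sup>2 * (u x)\<^sup>2)
     + w (l x) * (norm x)\<^sup>2 * (a * (p (l x))\<^sup>2) * \<bar>u x\<bar> powr q" for x
  have rc: "continuous_on C (\<lambda>x. M (l x))" if "continuous_on UNIV M" for M :: "real \<Rightarrow> real"
    unfolding l_def by (rule radial_continuous[OF that])
  note rc' = rc[OF c0(1)] rc[OF c0(2)] rc[OF c0(3)] rc[OF c0(5)] rc[OF c\<sigma>]
  have se: "sq_integrable e" unfolding e_def[abs_def] by (rule sq_integrable_inner[OF continuous_on_id])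
  have den: "continuous_on C (\<lambda>x. 1 + (l x)\<^sup>2)" "\<And>x. 1 + (l x)\<^sup>2 \<noteq> 0"
    using one_plus_square_pos less_imp_neq[symmetric] by (auto intro!: continuous_intros rc[OF continuous_on_id])
  have iP: "integrable lborel (\<lambda>x. indicator C x * P x)"
  proof -
    have P: "P x = (2 * w (l x) * (- p1 (l x))) * (e x * e x) + (4 * w (l x) * (- p1 (l x)) * \<sigma> (l x)) * (e x * u x)
       + (w (l x) * (- p1 (l x)) * (2 * (\<sigma> (l x))\<^sup>2 + (p (l x))\<^sup>2)) * (u x * u x)
       + (w (l x) * (norm x)\<^sup>2 * (a * (p (l x))\<^sup>2)) * \<bar>u x\<bar> powr q" for x
      by (simp add: P_def power2_eq_square algebra_simps)
    show ?thesis unfolding P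
      by (intro integrable_on_C_add integrable_coefficient[OF C] integrable_powr[OF q] se u continuous_intros rc')
  qed
  have iS: "integrable lborel (\<lambda>x. indicator C x * ((- p1 (l x)) * (w (l x) * (norm x)\<^sup>2) * (V x \<bullet> V x)))"
    by (intro integrable_normsq C V continuous_intros rc')
  define G where "G x = w (l x) * ((norm x)\<^sup>2 * g x)\<^sup>2" for x
  have iG: "integrable lborel (\<lambda>x. indicator C x * G x)"
  proof -
    have G: "G x = (w (l x) * ((norm x)\<^sup>2)\<^sup>2) * (g x * g x)" for x by (simp add: G_def power2_eq_square algebra_simps)
    show ?thesis unfolding G by (intro integrable_coefficient[OF C] g continuous_intros rc')
  qed
  have RG: "R = (LBINT x. indicator C x * G x)" by (simp add: R_def G_def w_def l_def)
  have \<tau>4: "\<tau> \<ge> 4" "\<tau> > 0" using \<tau> a2 n1 by (auto simp: n_def)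
  have l0: "l x \<le> 0" if "x \<in> C" for x using C1[OF that] nx[OF that] by (simp add: l_def)
  note bd = drift_bounds[OF l0 \<tau>4(2), folded p_def p1_def p2_def p3_def]
  \<comment> \<open>All of this follows from p \<ge> \<tau> - 1 and the threshold: the 4 in it
    provides p \<ge> 3, p \<ge> \<tau> / 2 and \<tau> \<le> (\<tau> - 1)^2, the rest provides 2 / a
    + n \<le> p.\<close>
  have p\<tau>: "p (l x) \<ge> \<tau> / 2" "p (l x) \<ge> 3" "2 / a + n \<le> p (l x)" "- p1 (l x) \<le> (p (l x))\<^sup>2" "\<bar>\<sigma> (l x)\<bar> \<le> 2 * p (l x)"
    if x: "x \<in> C" for x
  proof -
    have b: "\<tau> - 1 \<le> p (l x)" by (rule bd(1)[OF x])
    show "p (l x) \<ge> \<tau> / 2" "p (l x) \<ge> 3" and p: "2 / a + n \<le> p (l x)" using b \<tau> \<tau>4 by (auto simp: n_def)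
    have "\<tau> \<le> (\<tau> - 1)\<^sup>2"
    proof -
      have "3 * (\<tau> - 1) \<le> (\<tau> - 1) * (\<tau> - 1)" using \<tau>4 by (intro mult_right_mono) auto
      then show ?thesis using \<tau>4 by (simp add: power2_eq_square)
    qed
    also have "\<dots> \<le> (p (l x))\<^sup>2" using b \<tau>4 by (intro power_mono) auto
    finally show "- p1 (l x) \<le> (p (l x))\<^sup>2" using bd(4)[OF x] by simp
    show "\<bar>\<sigma> (l x)\<bar> \<le> 2 * p (l x)" using p a2 n1 by (simp add: \<sigma>_def abs_le_iff)
  qed
  have ptA: "P x \<le> - Z x + G x / 4" if x: "x \<in> C" for x
  proof -
    have "- Z x = w (l x) * ((2 * p (l x) * (e x + \<sigma> (l x) * u x) + p1 (l x) * u x)\<^sup>2 - 2 * p1 (l x) * (e x + \<sigma> (l x) * u x)\<^sup>2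
          + (p3 (l x) / 2 - 2 * (p (l x))\<^sup>2 * p1 (l x)) * (u x)\<^sup>2)
        + w (l x) * (norm x)\<^sup>2 * (- a * p1 (l x) + 2 * a * (p (l x))\<^sup>2 - p (l x) * (2 + n * a)) * (f x * u x)
        - w (l x) * (norm x)\<^sup>2 * g x * (2 * p (l x) * (e x + \<sigma> (l x) * u x) + p1 (l x) * u x)"
      by (rule carleman_pointwise_identity[OF \<sigma>_def k_def k'_def b_def b'_def iq Z_def])
    then show ?thesis
      unfolding P_def G_def fu
      by (rule carleman_pointwise_main[OF _ _ bd(3)[OF x] bd(6)[OF x] p\<tau>(2)[OF x] a0 p\<tau>(3)[OF x], rotated 3])
         (use weight_pos[of \<tau>] nx[OF x] in \<open>auto simp: w_def less_imp_le\<close>)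
  qed
  have ptB: "(- p1 (l x)) * (w (l x) * (norm x)\<^sup>2) * (V x \<bullet> V x) \<le> ZB x + G x / 2 + 9 / a * P x" if x: "x \<in> C" for x
    unfolding G_def
    by (rule carleman_pointwise_gradient[OF _ _ bd(3)[OF x] p\<tau>(4)[OF x] bd(5)[OF x] p\<tau>(2)[OF x] a0 a1 _ fu[symmetric] p\<tau>(5)[OF x] ZB_def P_def])
       (use weight_pos[of \<tau>] nx[OF x] in \<open>auto simp: w_def less_imp_le\<close>)
  have R0: "R \<ge> 0" unfolding RG
    by (rule Bochner_Integration.integral_nonneg) (use weight_pos[of \<tau>] in \<open>auto simp: G_def w_def indicator_def less_imp_le\<close>)
  have IP: "(LBINT x. indicator C x * P x) \<le> R / 4"
  proof -
    have i: "integrable lborel (\<lambda>x. indicator C x * (- Z x + G x / 4))"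
      using nZ iG by (simp add: null_on_def right_diff_distrib)
    have "(LBINT x. indicator C x * P x) \<le> (LBINT x. indicator C x * (- Z x + G x / 4))"
      by (rule integral_on_C_mono[OF iP i ptA])
    also have "\<dots> = R / 4" using nZ iG by (simp add: null_on_def right_diff_distrib RG)
    finally show ?thesis .
  qed
  have IS: "(LBINT x. indicator C x * ((- p1 (l x)) * (w (l x) * (norm x)\<^sup>2) * (V x \<bullet> V x))) \<le> 3 / a * R"
  proof -
    have i: "integrable lborel (\<lambda>x. indicator C x * (ZB x + G x / 2 + 9 / a * P x))"
      using nZB iG iP by (simp add: null_on_def distrib_left mult.left_commute[of "indicator C _"])
    have "(LBINT x. indicator C x * ((- p1 (l x)) * (w (l x) * (norm x)\<^sup>2) * (V x \<bullet> V x))) \<le> (LBINT x. indicator C x * (ZB x + G x / 2 + 9 / a * P x))"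
      by (rule integral_on_C_mono[OF iS i ptB])
    also have "\<dots> = R / 2 + 9 / a * (LBINT x. indicator C x * P x)"
    proof -
      have "(LBINT x. indicator C x * (ZB x + G x / 2 + 9 / a * P x))
        = (LBINT x. indicator C x * ZB x + indicator C x * G x / 2 + 9 / a * (indicator C x * P x))"
        by (rule Bochner_Integration.integral_cong) (auto simp: distrib_left)
      also have "\<dots> = R / 2 + 9 / a * (LBINT x. indicator C x * P x)"
        using nZB iG iP by (simp add: null_on_def RG)
      finally show ?thesis .
    qed
    also have "\<dots> \<le> R / 2 + 9 / a * (R / 4)" using IP a0 by (intro add_left_mono mult_left_mono) auto
    \<comment> \<open>As a \<le> 1, the summand 1 / 2 is at most 1 / (2 a), and 1 / (2 a) + 9 / (4
      a) = 11 / (4 a).\<close>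
    also have "\<dots> \<le> 3 / a * R"
    proof -
      have "R / 2 \<le> (R / 2) * (1 / a)" using R0 a0 a1 by (simp add: field_simps mult_left_le)
      then have "R / 2 + 9 / a * (R / 4) \<le> (R / 2) * (1 / a) + 9 / a * (R / 4)" by simp
      also have "\<dots> = (11 / 4 / a) * R" using a0 by (simp add: field_simps)
      also have "\<dots> \<le> 3 / a * R" using R0 a0 by (intro mult_right_mono divide_right_mono) auto
      finally show ?thesis .
    qed
    finally show ?thesis .
  qed
  have w0: "w t \<ge> 0" for t using weight_pos[of \<tau> t] by (simp add: w_def)
  have p1e: "- p1 t = \<tau> / (10 * (1 + t\<^sup>2))" for t by (simp add: p1_def drift1_def)
  have p2\<tau>: "\<tau>\<^sup>2 / 4 \<le> (p (l x))\<^sup>2" if "x \<in> C" for x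
    using power_mono[OF p\<tau>(1)[OF that], of 2] \<tau>4 by (simp add: power_divide)
  show i1: "integrable lborel (\<lambda>x. indicator C x * (weight \<tau> (ln (norm x)) / (1 + (ln (norm x))\<^sup>2) * (u x)\<^sup>2))"
    using integrable_coefficient[OF C _ u u, of "\<lambda>x. w (l x) / (1 + (l x)\<^sup>2)"]
    by (simp add: den continuous_on_divide rc' power2_eq_square[of "u _"]) (simp add: w_def l_def)
  show i2: "integrable lborel (\<lambda>x. indicator C x * (weight \<tau> (ln (norm x)) * (norm x)\<^sup>2 / (1 + (ln (norm x))\<^sup>2) * (V x \<bullet> V x)))"
  proof -
    have "continuous_on C (\<lambda>x. w (l x) * (norm x)\<^sup>2 / (1 + (l x)\<^sup>2))" by (intro continuous_intros rc' den) (use den in auto)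
    from integrable_normsq[OF C this V] show ?thesis by (simp add: w_def l_def)
  qed
  show i3: "integrable lborel (\<lambda>x. indicator C x * (weight \<tau> (ln (norm x)) * (norm x)\<^sup>2 * \<bar>u x\<bar> powr q))"
  proof -
    have "continuous_on C (\<lambda>x. w (l x) * (norm x)\<^sup>2)" by (intro continuous_intros rc')
    from integrable_powr[OF q this] show ?thesis by (simp add: w_def l_def)
  qed
  show "\<tau> ^ 3 * (LBINT x. indicator C x * (weight \<tau> (ln (norm x)) / (1 + (ln (norm x))\<^sup>2) * (u x)\<^sup>2)) \<le> 10 * R"
  proof -
    have i: "integrable lborel (\<lambda>x. indicator C x * (\<tau> ^ 3 / 40 * (weight \<tau> (ln (norm x)) / (1 + (ln (norm x))\<^sup>2) * (u x)\<^sup>2)))"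
      by (rule on_C_scale(1)[OF i1])
    \<comment> \<open>40 is the 10 in the denominator of \<open>drift1\<close> times the 4 from p^2
      \<ge> \<tau>^2 / 4; with the bound R / 4 for the integral of \<open>P\<close> this leaves 10
      R.\<close>
    have "(LBINT x. indicator C x * (\<tau> ^ 3 / 40 * (weight \<tau> (ln (norm x)) / (1 + (ln (norm x))\<^sup>2) * (u x)\<^sup>2))) \<le> (LBINT x. indicator C x * P x)"
    proof (rule integral_on_C_mono[OF i iP])
      fix x assume x: "x \<in> C"
      have "\<tau> ^ 3 / 40 * (w (l x) / (1 + (l x)\<^sup>2) * (u x)\<^sup>2) = w (l x) * (- p1 (l x)) * (\<tau>\<^sup>2 / 4 * (u x)\<^sup>2)"
        by (simp add: p1e power2_eq_square power3_eq_cube)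
      also have "\<dots> \<le> w (l x) * (- p1 (l x)) * (2 * (e x + \<sigma> (l x) * u x)\<^sup>2 + (p (l x))\<^sup>2 * (u x)\<^sup>2)"
      proof (rule mult_left_mono)
        have "\<tau>\<^sup>2 / 4 * (u x)\<^sup>2 \<le> (p (l x))\<^sup>2 * (u x)\<^sup>2" by (rule mult_right_mono[OF p2\<tau>[OF x]]) simp
        then show "\<tau>\<^sup>2 / 4 * (u x)\<^sup>2 \<le> 2 * (e x + \<sigma> (l x) * u x)\<^sup>2 + (p (l x))\<^sup>2 * (u x)\<^sup>2"
          using zero_le_power2[of "e x + \<sigma> (l x) * u x"] by linarith
        show "0 \<le> w (l x) * (- p1 (l x))" using w0 bd(3)[OF x] by (intro mult_nonneg_nonneg) auto
      qed
      also have "\<dots> \<le> P x" unfolding P_def using w0 a0 by simp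
      finally show "\<tau> ^ 3 / 40 * (weight \<tau> (ln (norm x)) / (1 + (ln (norm x))\<^sup>2) * (u x)\<^sup>2) \<le> P x"
        by (simp add: w_def l_def)
    qed
    then show ?thesis unfolding on_C_scale(2) using IP by simp
  qed
  show "\<tau> * (LBINT x. indicator C x * (weight \<tau> (ln (norm x)) * (norm x)\<^sup>2 / (1 + (ln (norm x))\<^sup>2) * (V x \<bullet> V x))) \<le> 30 / a * R"
  proof -
    have "indicator C x * ((- p1 (l x)) * (w (l x) * (norm x)\<^sup>2) * (V x \<bullet> V x))
       = \<tau> / 10 * (indicator C x * (weight \<tau> (ln (norm x)) * (norm x)\<^sup>2 / (1 + (ln (norm x))\<^sup>2) * (V x \<bullet> V x)))" for x
      unfolding p1e by (simp add: w_def l_def)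
    then have "(LBINT x. indicator C x * ((- p1 (l x)) * (w (l x) * (norm x)\<^sup>2) * (V x \<bullet> V x)))
      = \<tau> / 10 * (LBINT x. indicator C x * (weight \<tau> (ln (norm x)) * (norm x)\<^sup>2 / (1 + (ln (norm x))\<^sup>2) * (V x \<bullet> V x)))"
      by (simp only: integral_mult_right_zero)
    then show ?thesis using IS by simp
  qed
  show "a * \<tau>\<^sup>2 * (LBINT x. indicator C x * (weight \<tau> (ln (norm x)) * (norm x)\<^sup>2 * \<bar>u x\<bar> powr q)) \<le> R"
  proof -
    have i: "integrable lborel (\<lambda>x. indicator C x * (a * \<tau>\<^sup>2 / 4 * (weight \<tau> (ln (norm x)) * (norm x)\<^sup>2 * \<bar>u x\<bar> powr q)))"
      by (rule on_C_scale(1)[OF i3])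
    have "(LBINT x. indicator C x * (a * \<tau>\<^sup>2 / 4 * (weight \<tau> (ln (norm x)) * (norm x)\<^sup>2 * \<bar>u x\<bar> powr q))) \<le> (LBINT x. indicator C x * P x)"
    proof (rule integral_on_C_mono[OF i iP])
      fix x assume x: "x \<in> C"
      have "a * \<tau>\<^sup>2 / 4 * (w (l x) * (norm x)\<^sup>2 * \<bar>u x\<bar> powr q) = w (l x) * (norm x)\<^sup>2 * (a * (\<tau>\<^sup>2 / 4)) * \<bar>u x\<bar> powr q"
        by simp
      also have "\<dots> \<le> w (l x) * (norm x)\<^sup>2 * (a * (p (l x))\<^sup>2) * \<bar>u x\<bar> powr q"
        using w0 a0 p2\<tau>[OF x] by (intro mult_right_mono mult_left_mono) auto
      also have "\<dots> \<le> P x"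
      proof -
        have "0 \<le> w (l x) * (- p1 (l x)) * (2 * (e x + \<sigma> (l x) * u x)\<^sup>2 + (p (l x))\<^sup>2 * (u x)\<^sup>2)"
          using w0 bd(3)[OF x] by (intro mult_nonneg_nonneg add_nonneg_nonneg) auto
        then show ?thesis unfolding P_def by linarith
      qed
      finally show "a * \<tau>\<^sup>2 / 4 * (weight \<tau> (ln (norm x)) * (norm x)\<^sup>2 * \<bar>u x\<bar> powr q) \<le> P x"
        by (simp add: w_def l_def)
    qed
    then show ?thesis unfolding on_C_scale(2) using IP by simp
  qed
qed

end

section \<open>Passage from Lebesgue to Borel functions\<close>

lemma lebesgue_integral_eq_lborel:
  fixes f :: "'a::euclidean_space \<Rightarrow> real"
  assumes "AE x in lborel. f x = f' x" and "f' \<in> borel_measurable borel" and "f \<in> borel_measurable lebesgue"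
  shows "(\<integral>x. f x \<partial>lebesgue) = (LBINT x. f' x)"
proof -
  have "(\<integral>x. f x \<partial>lebesgue) = (\<integral>x. f' x \<partial>lebesgue)"
    using assms by (intro integral_cong_AE) (auto intro: AE_completion measurable_completion)
  also have "\<dots> = (LBINT x. f' x)" using assms(2) by (intro integral_completion) simp
  finally show ?thesis .
qed

lemma borel_representative:
  fixes f :: "'a::euclidean_space \<Rightarrow> real"
  assumes "f \<in> borel_measurable lebesgue"
  obtains f' where "f' \<in> borel_measurable borel" "AE x in lborel. f x = f' x"
  using completion_ex_borel_measurable_real[OF assms] by auto

lemma borel_representative_vector:
  fixes f :: "'a::euclidean_space \<Rightarrow> 'b::euclidean_space"
  assumes f: "f \<in> borel_measurable lebesgue"
  obtains f' where "f' \<in> borel_measurable borel" "AE x in lborel. f x = f' x"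
proof -
  have "\<exists>c. c \<in> borel_measurable borel \<and> (AE x in lborel. f x \<bullet> b = c x)" for b
  proof -
    have "(\<lambda>x. f x \<bullet> b) \<in> borel_measurable lebesgue" using f by measurable
    from borel_representative[OF this] show ?thesis by blast
  qed
  then obtain c where c: "\<And>b. c b \<in> borel_measurable borel" "\<And>b. AE x in lborel. f x \<bullet> b = c b x" by metis
  have "AE x in lborel. \<forall>b\<in>Basis. f x \<bullet> b = c b x" by (rule AE_finite_allI[OF finite_Basis c(2)])
  then have "AE x in lborel. f x = (\<Sum>b\<in>Basis. c b x *\<^sub>R b)"
  proof eventually_elim
    case (elim x)
    have "(\<Sum>b\<in>Basis. c b x *\<^sub>R b) = (\<Sum>b\<in>Basis. (f x \<bullet> b) *\<^sub>R b)" using elim by simp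
    then show ?case by (simp add: euclidean_representation)
  qed
  moreover have "(\<lambda>x. \<Sum>b\<in>Basis. c b x *\<^sub>R b) \<in> borel_measurable borel" using c(1) by measurable
  ultimately show thesis by (rule that[rotated])
qed

lemma L2_norm_finite:
  "L2_norm f < \<infinity> \<longleftrightarrow> (\<integral>\<^sup>+ x. ennreal ((norm (f x))\<^sup>2) \<partial>lebesgue) < \<infinity>"
  by (auto simp: L2_norm_def Let_def less_top[symmetric])

lemma sq_integrable_representative:
  fixes f f' :: "'a::euclidean_space \<Rightarrow> real"
  assumes "f' \<in> borel_measurable borel" and "AE x in lborel. \<bar>f' x\<bar> \<le> norm (F x)" and "L2_norm F < \<infinity>"
  shows "sq_integrable f'"
proof -
  have "(\<integral>\<^sup>+ x. ennreal ((f' x)\<^sup>2) \<partial>lborel) \<le> (\<integral>\<^sup>+ x. ennreal ((norm (F x))\<^sup>2) \<partial>lborel)"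
  proof (rule nn_integral_mono_AE, use assms(2) in eventually_elim)
    case (elim x)
    then show ?case using power_mono[OF elim, of 2] by (intro ennreal_leI) simp
  qed
  also have "\<dots> < \<infinity>" using assms(3) unfolding L2_norm_finite nn_integral_completion .
  finally have "integrable lborel (\<lambda>x. (f' x)\<^sup>2)"
    using assms(1) by (intro integrableI_nonneg) auto
  then show ?thesis using assms(1) by (simp add: sq_integrable_def)
qed

lemma L2_norm_eq:
  fixes F :: "'a::euclidean_space \<Rightarrow> 'b::euclidean_space"
  assumes "AE x in lborel. (norm (F x))\<^sup>2 = \<phi> x" and "integrable lborel \<phi>" and "\<And>x. \<phi> x \<ge> 0"
  shows "L2_norm F = ennreal (sqrt (LBINT x. \<phi> x))"
proof -
  have "(\<integral>\<^sup>+ x. ennreal ((norm (F x))\<^sup>2) \<partial>lebesgue) = (\<integral>\<^sup>+ x. ennreal (\<phi> x) \<partial>lborel)"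
    unfolding nn_integral_completion
    by (rule nn_integral_cong_AE, use assms(1) in eventually_elim) simp
  also have "\<dots> = ennreal (LBINT x. \<phi> x)"
    using assms by (intro nn_integral_eq_integral) auto
  finally show ?thesis using assms(3) by (simp add: L2_norm_def Let_def)
qed

text \<open>One-sided, for the right-hand side of the estimate: its norm runs over the whole space,
  whereas the energy integral sees g on C only. An infinite norm is covered as well.\<close>

lemma L2_norm_ge:
  fixes F :: "'a::euclidean_space \<Rightarrow> 'b::euclidean_space"
  assumes "AE x in lborel. \<phi> x \<le> (norm (F x))\<^sup>2" and "integrable lborel \<phi>" and "\<And>x. \<phi> x \<ge> 0"
  shows "ennreal (sqrt (LBINT x. \<phi> x)) \<le> L2_norm F"
proof -
  define N where "N = (\<integral>\<^sup>+ x. ennreal ((norm (F x))\<^sup>2) \<partial>lebesgue)"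
  have "ennreal (LBINT x. \<phi> x) = (\<integral>\<^sup>+ x. ennreal (\<phi> x) \<partial>lborel)"
    using assms by (intro nn_integral_eq_integral[symmetric]) auto
  also have "\<dots> \<le> N" unfolding N_def nn_integral_completion
    by (rule nn_integral_mono_AE, use assms(1) in eventually_elim) (rule ennreal_leI)
  finally have le: "ennreal (LBINT x. \<phi> x) \<le> N" .
  show ?thesis
  proof (cases "N = \<infinity>")
    case False
    then obtain r where r: "N = ennreal r" "r \<ge> 0" by (cases N) auto
    have "(LBINT x. \<phi> x) \<le> r" using le r by simp
    then show ?thesis using r N_def[symmetric] by (simp add: L2_norm_def Let_def ennreal_leI)
  qed (simp add: L2_norm_def N_def[symmetric])
qed

section \<open>Essential support, and bumps as admissible test functions\<close>

lemma ess_support_closed: "closed (ess_support f)"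
  unfolding ess_support_def by (intro closed_Compl open_Union) auto

text \<open>The complement of the support is an uncountable union of open sets on each of which f
  vanishes almost everywhere; by Lindelof a countable subfamily suffices.\<close>

lemma AE_zero_outside_ess_support: "AE x in lebesgue. x \<notin> ess_support f \<longrightarrow> f x = 0"
proof -
  define \<U> where "\<U> = {U. open U \<and> (AE x in lebesgue. x \<in> U \<longrightarrow> f x = 0)}"
  obtain \<U>' where \<U>': "\<U>' \<subseteq> \<U>" "countable \<U>'" "\<Union>\<U>' = \<Union>\<U>"
    using Lindelof[of \<U>] by (auto simp: \<U>_def)
  have "AE x in lebesgue. \<forall>U\<in>\<U>'. x \<in> U \<longrightarrow> f x = 0"
    by (rule AE_ball_countable'[OF _ \<U>'(2)]) (use \<U>'(1) in \<open>auto simp: \<U>_def\<close>)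
  then show ?thesis
  proof eventually_elim
    case (elim x)
    show ?case
    proof
      assume "x \<notin> ess_support f"
      then have "x \<in> \<Union>\<U>'" unfolding \<U>'(3) by (auto simp: ess_support_def \<U>_def)
      then show "f x = 0" using elim by auto
    qed
  qed
qed

text \<open>Each component of the gradient is itself smooth, hence differentiable, hence
  continuous.\<close>

lemma smooth_gradient_continuous:
  assumes "smooth \<eta>" and G: "\<And>x. GDERIV \<eta> x :> G x"
  shows "continuous_on UNIV G"
  using assms(1)
proof cases
  case (1 G')
  have "G = G'" using GDERIV_unique[OF G 1(1)] by auto
  have "continuous_on UNIV (\<lambda>x. G' x \<bullet> b)" if "b \<in> Basis" for b
  proof -
    from 1(2)[OF that] obtain G'' where "\<And>x. GDERIV (\<lambda>x. G' x \<bullet> b) x :> G'' x" by cases auto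
    then show ?thesis by (rule GDERIV_continuous_on)
  qed
  then have "continuous_on UNIV (\<lambda>x. \<Sum>b\<in>Basis. (G' x \<bullet> b) *\<^sub>R b)"
    by (intro continuous_on_sum continuous_on_scaleR continuous_on_const)
  then show ?thesis by (simp add: euclidean_representation \<open>G = G'\<close>)
qed

lemma integrable_lebesgue_lborel:
  fixes f :: "'a::euclidean_space \<Rightarrow> 'b::euclidean_space"
  assumes "integrable lborel f" shows "integrable lebesgue f"
  using assms integrable_completion[of f lborel] by (auto dest: borel_measurable_integrable)

lemma bump_gradient_measurable:
  fixes G :: "'a::euclidean_space \<Rightarrow> 'a"
  assumes "\<And>b. bump y \<epsilon> (\<lambda>z. G z \<bullet> b)" shows "continuous_on UNIV G" "G \<in> borel_measurable borel"
proof -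
  have "continuous_on UNIV (\<lambda>x. \<Sum>b\<in>Basis. (G x \<bullet> b) *\<^sub>R b)"
    by (intro continuous_intros bump_continuous[OF assms])
  then show "continuous_on UNIV G" by (simp add: euclidean_representation)
  then show "G \<in> borel_measurable borel" by (rule borel_measurable_continuous_onI)
qed

text \<open>\<open>bump_gradient\<close> only provides some gradient; by uniqueness its properties
  hold for whichever gradient is given.\<close>

lemma bump_gradient_components:
  fixes G :: "'a::euclidean_space \<Rightarrow> 'a"
  assumes \<eta>: "bump y \<epsilon> \<eta>" and G: "\<And>z. GDERIV \<eta> z :> G z"
  shows "bump y \<epsilon> (\<lambda>z. G z \<bullet> b)" "x \<notin> cball y \<bar>\<epsilon>\<bar> \<Longrightarrow> \<eta> x = 0" "x \<notin> cball y \<bar>\<epsilon>\<bar> \<Longrightarrow> G x = 0"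
proof -
  obtain G' where G': "\<And>z. GDERIV \<eta> z :> G' z" "\<And>b. bump y \<epsilon> (\<lambda>z. G' z \<bullet> b)" using bump_gradient[OF \<eta>] by blast
  have "G' = G" by (rule ext) (rule GDERIV_unique[OF G'(1) G])
  with G'(2) have Gb: "bump y \<epsilon> (\<lambda>z. G z \<bullet> b)" for b by simp
  show "bump y \<epsilon> (\<lambda>z. G z \<bullet> b)" by (rule Gb)
  assume "x \<notin> cball y \<bar>\<epsilon>\<bar>"
  then have n: "\<bar>\<epsilon>\<bar> \<le> norm (x - y)" by (simp add: dist_norm norm_minus_commute)
  show "\<eta> x = 0" by (rule bump_zero[OF \<eta> n])
  have "G x \<bullet> b = 0" for b by (rule bump_zero[OF Gb n])
  then show "G x = 0" by (metis inner_eq_zero_iff)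
qed

text \<open>With this, \<open>weak_solution\<close> may be tested with bumps, the classical gradient
  serving as the weak one.\<close>

lemma bump_in_H1:
  fixes G :: "'a::euclidean_space \<Rightarrow> 'a"
  assumes \<eta>: "bump y \<epsilon> \<eta>" and G: "\<And>z. GDERIV \<eta> z :> G z"
  shows "in_H1 \<eta> G" "in_Linf \<eta>" "compact (ess_support \<eta>)"
proof -
  note Gb = bump_gradient_components(1)[OF \<eta> G] and out = bump_gradient_components(2,3)[OF \<eta> G]
  have [measurable]: "\<eta> \<in> borel_measurable borel" by (rule bump_measurable[OF \<eta>])
  have Gm[measurable]: "G \<in> borel_measurable borel" by (rule bump_gradient_measurable(2)[OF Gb])
  have lm: "\<eta> \<in> borel_measurable lebesgue" "G \<in> borel_measurable lebesgue" by (auto intro: measurable_completion)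
  obtain M where "M \<ge> 0" "\<And>z. \<bar>\<eta> z\<bar> \<le> M" using bump_bounded[OF \<eta>] by blast
  then show "in_Linf \<eta>" using lm by (auto simp: in_Linf_def)
  have "in_L2 \<eta>"
  proof -
    have "L2_norm \<eta> = ennreal (sqrt (LBINT x. (\<eta> x)\<^sup>2))"
      using bump_integrable(2)[OF \<eta>] by (intro L2_norm_eq) (auto simp: sq_integrable_def)
    then show ?thesis using lm by (simp add: in_L2_def)
  qed
  moreover have "in_L2 G"
  proof -
    have "integrable lborel (\<lambda>x. \<Sum>b\<in>Basis. (G x \<bullet> b)\<^sup>2)"
      using bump_integrable(2)[OF Gb] by (intro Bochner_Integration.integrable_sum) (auto simp: sq_integrable_def)
    moreover have "(norm (G x))\<^sup>2 = (\<Sum>b\<in>Basis. (G x \<bullet> b)\<^sup>2)" for x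
      unfolding power2_norm_eq_inner by (subst euclidean_inner) (simp add: power2_eq_square)
    ultimately have "L2_norm G = ennreal (sqrt (LBINT x. (\<Sum>b\<in>Basis. (G x \<bullet> b)\<^sup>2)))"
      by (intro L2_norm_eq) (auto intro: sum_nonneg)
    then show ?thesis using lm by (simp add: in_L2_def)
  qed
  moreover have "has_weak_gradient \<eta> G"
    unfolding has_weak_gradient_def
  proof (intro conjI allI impI)
    fix K :: "'a set" assume K: "compact K"
    have "integrable lborel (\<lambda>x. indicator K x *\<^sub>R \<eta> x)"
      by (rule borel_integrable_compact[OF K continuous_on_subset[OF bump_continuous[OF \<eta>]]]) auto
    moreover have "integrable lborel (\<lambda>x. indicator K x *\<^sub>R G x)"
      by (rule borel_integrable_compact[OF K continuous_on_subset[OF bump_gradient_measurable(1)[OF Gb]]]) auto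
    ultimately show "set_integrable lebesgue K \<eta>" "set_integrable lebesgue K G"
      unfolding set_integrable_def by (auto intro: integrable_lebesgue_lborel)
  next
    fix \<zeta> :: "'a \<Rightarrow> real" and Z :: "'a \<Rightarrow> 'a" assume \<zeta>: "smooth \<zeta>" "compact (closure {x. \<zeta> x \<noteq> 0})" and Z: "\<forall>x. GDERIV \<zeta> x :> Z x"
    have cZ: "continuous_on UNIV Z" by (rule smooth_gradient_continuous[OF \<zeta>(1)]) (use Z in auto)
    have c\<zeta>: "continuous_on UNIV \<zeta>" using Z by (intro GDERIV_continuous_on) auto
    have c\<eta>: "continuous_on UNIV \<eta>" by (rule bump_continuous[OF \<eta>])
    note cG = bump_gradient_measurable(1)[OF Gb]
    let ?C = "cball y \<bar>\<epsilon>\<bar>"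
    have i1: "integrable lborel (\<lambda>x. \<eta> x *\<^sub>R Z x)"
    proof -
      have "integrable lborel (\<lambda>x. indicator ?C x *\<^sub>R (\<eta> x *\<^sub>R Z x))"
        by (rule borel_integrable_compact[OF compact_cball]) (intro continuous_intros continuous_on_subset[OF c\<eta>] continuous_on_subset[OF cZ]; simp)
      moreover have "(\<lambda>x. indicator ?C x *\<^sub>R (\<eta> x *\<^sub>R Z x)) = (\<lambda>x. \<eta> x *\<^sub>R Z x)" using out by (auto simp: fun_eq_iff indicator_def)
      ultimately show ?thesis by simp
    qed
    have i2: "integrable lborel (\<lambda>x. \<zeta> x *\<^sub>R G x)"
    proof -
      have "integrable lborel (\<lambda>x. indicator ?C x *\<^sub>R (\<zeta> x *\<^sub>R G x))"
        by (rule borel_integrable_compact[OF compact_cball]) (intro continuous_intros continuous_on_subset[OF c\<zeta>] continuous_on_subset[OF cG]; simp)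
      moreover have "(\<lambda>x. indicator ?C x *\<^sub>R (\<zeta> x *\<^sub>R G x)) = (\<lambda>x. \<zeta> x *\<^sub>R G x)" using out by (auto simp: fun_eq_iff indicator_def)
      ultimately show ?thesis by simp
    qed
    \<comment> \<open>Integration by parts: the product of \<eta> and \<zeta> is supported in the
      ball, so each of its partial derivatives has integral 0.\<close>
    have "(LBINT x. \<eta> x *\<^sub>R Z x) = - (LBINT x. \<zeta> x *\<^sub>R G x)"
    proof (rule euclidean_eqI)
      fix b :: 'a assume b: "b \<in> Basis"
      have "(LBINT x. indicator ?C x * (\<eta> x * (b \<bullet> Z x) + (b \<bullet> G x) * \<zeta> x)) = 0"
      proof (rule integral_derivative_compact_support[OF compact_cball, of _ _ "\<lambda>x. \<eta> x * \<zeta> x" "\<lambda>x b. \<eta> x * (b \<bullet> Z x) + (b \<bullet> G x) * \<zeta> x"])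
        show "((\<lambda>x. \<eta> x * \<zeta> x) has_derivative (\<lambda>b. \<eta> x * (b \<bullet> Z x) + (b \<bullet> G x) * \<zeta> x)) (at x)" for x
          using G Z by (auto intro!: derivative_eq_intros simp: gderiv_def)
        show "continuous_on ?C (\<lambda>x. \<eta> x * (b \<bullet> Z x) + (b \<bullet> G x) * \<zeta> x)"
          by (intro continuous_intros continuous_on_subset[OF c\<zeta>] continuous_on_subset[OF cG] continuous_on_subset[OF c\<eta>] continuous_on_subset[OF cZ]; simp)
      qed (use out in auto)
      moreover have "indicator ?C x * (\<eta> x * (b \<bullet> Z x) + (b \<bullet> G x) * \<zeta> x) = (\<eta> x *\<^sub>R Z x) \<bullet> b + (\<zeta> x *\<^sub>R G x) \<bullet> b" for x
        using out[of x] by (cases "x \<in> ?C") (auto simp: inner_commute)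
      ultimately have "(LBINT x. (\<eta> x *\<^sub>R Z x) \<bullet> b + (\<zeta> x *\<^sub>R G x) \<bullet> b) = 0" by simp
      then have "(LBINT x. (\<eta> x *\<^sub>R Z x) \<bullet> b) + (LBINT x. (\<zeta> x *\<^sub>R G x) \<bullet> b) = 0"
        using i1 i2 by (subst (asm) Bochner_Integration.integral_add) (auto simp del: inner_scaleR_left)
      then show "(LBINT x. \<eta> x *\<^sub>R Z x) \<bullet> b = (- (LBINT x. \<zeta> x *\<^sub>R G x)) \<bullet> b"
        using i1 i2 by (simp del: inner_scaleR_left)
    qed
    moreover have "(\<lambda>x. \<eta> x *\<^sub>R Z x) \<in> borel_measurable borel" "(\<lambda>x. \<zeta> x *\<^sub>R G x) \<in> borel_measurable borel"
      using i1 i2 by auto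
    ultimately show "(\<integral>x. \<eta> x *\<^sub>R Z x \<partial>lebesgue) = - (\<integral>x. \<zeta> x *\<^sub>R G x \<partial>lebesgue)"
      by (simp add: integral_completion)
  qed
  ultimately show "in_H1 \<eta> G" by (simp add: in_H1_def)
  have "ess_support \<eta> \<subseteq> cball y \<bar>\<epsilon>\<bar>"
  proof -
    have "- cball y \<bar>\<epsilon>\<bar> \<in> {U. open U \<and> (AE x in lebesgue. x \<in> U \<longrightarrow> \<eta> x = 0)}" using out(1) by auto
    then have "- cball y \<bar>\<epsilon>\<bar> \<subseteq> - ess_support \<eta>" unfolding ess_support_def double_complement by (rule Union_upper)
    then show ?thesis by blast
  qed
  then show "compact (ess_support \<eta>)"
    using ess_support_closed[of \<eta>] by (metis bounded_cball bounded_subset compact_eq_bounded_closed)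
qed

section \<open>The Carleman estimate\<close>

text \<open>Translates the defining identity, which concerns Lebesgue measurable functions and
  vector-valued integrals, into scalar identities for Borel representatives.\<close>

lemma has_weak_gradient_bump:
  fixes u u' :: "'a::euclidean_space \<Rightarrow> real" and V V' :: "'a \<Rightarrow> 'a"
  assumes wg: "has_weak_gradient u V" and um: "u \<in> borel_measurable lebesgue" and Vm: "V \<in> borel_measurable lebesgue"
    and u': "u' \<in> borel_measurable borel" "AE x in lborel. u x = u' x"
    and V': "V' \<in> borel_measurable borel" "AE x in lborel. V x = V' x"
    and \<eta>: "bump y \<epsilon> \<eta>" and G: "\<And>z. GDERIV \<eta> z :> G z"
  shows "(LBINT z. u' z * (G z \<bullet> b)) = - (LBINT z. \<eta> z * (V' z \<bullet> b))"
proof -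
  note Gb = bump_gradient_components(1)[OF \<eta> G] and out = bump_gradient_components(2,3)[OF \<eta> G]
  have \<eta>m[measurable]: "\<eta> \<in> borel_measurable borel" by (rule bump_measurable[OF \<eta>])
  have Gm[measurable]: "G \<in> borel_measurable borel" by (rule bump_gradient_measurable(2)[OF Gb])
  have \<eta>lm[measurable]: "\<eta> \<in> borel_measurable lebesgue" and Glm[measurable]: "G \<in> borel_measurable lebesgue"
    by (auto intro: measurable_completion)
  obtain M where M: "M \<ge> 0" "\<And>z. \<bar>\<eta> z\<bar> \<le> M" using bump_bounded[OF \<eta>] by blast
  obtain N where N: "N \<ge> 0" "\<And>z. norm (G z) \<le> N" using bump_gradient_bounded[OF Gb] by blast
  let ?C = "cball y \<bar>\<epsilon>\<bar>"
  have si: "set_integrable lebesgue ?C u" "set_integrable lebesgue ?C V"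
    using wg by (auto simp: has_weak_gradient_def)
  \<comment> \<open>Integrability must be known before the inner product with b is moved under the
    vector-valued integral; local integrability suffices because G is bounded and vanishes off the
    ball.\<close>
  have i1: "integrable lebesgue (\<lambda>x. u x *\<^sub>R G x)"
  proof (rule Bochner_Integration.integrable_bound)
    show "integrable lebesgue (\<lambda>x. N * (indicator ?C x *\<^sub>R u x))"
      using si(1) unfolding set_integrable_def by (rule integrable_mult_right)
    show "AE x in lebesgue. norm (u x *\<^sub>R G x) \<le> norm (N * (indicator ?C x *\<^sub>R u x))"
    proof (rule AE_I2)
      fix x
      have "\<bar>u x\<bar> * norm (G x) \<le> \<bar>u x\<bar> * N" by (intro mult_left_mono N) auto
      then show "norm (u x *\<^sub>R G x) \<le> norm (N * (indicator ?C x *\<^sub>R u x))"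
        using out(2)[of x] N(1) by (cases "x \<in> ?C") (auto simp: abs_mult mult.commute)
    qed
  qed (use um in measurable)
  have i2: "integrable lebesgue (\<lambda>x. \<eta> x *\<^sub>R V x)"
  proof (rule Bochner_Integration.integrable_bound)
    show "integrable lebesgue (\<lambda>x. M *\<^sub>R (indicator ?C x *\<^sub>R V x))"
      using si(2) unfolding set_integrable_def by (rule integrable_scaleR_right)
    show "AE x in lebesgue. norm (\<eta> x *\<^sub>R V x) \<le> norm (M *\<^sub>R (indicator ?C x *\<^sub>R V x))"
    proof (rule AE_I2)
      fix x
      have "\<bar>\<eta> x\<bar> * norm (V x) \<le> M * norm (V x)" by (intro mult_right_mono M) auto
      then show "norm (\<eta> x *\<^sub>R V x) \<le> norm (M *\<^sub>R (indicator ?C x *\<^sub>R V x))"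
        using out(1)[of x] M(1) by (cases "x \<in> ?C") auto
    qed
  qed (use Vm in measurable)
  have "{x. \<eta> x \<noteq> 0} \<subseteq> ?C" using out(1) by force
  then have "closure {x. \<eta> x \<noteq> 0} \<subseteq> ?C" by (rule closure_minimal) simp
  then have "compact (closure {x. \<eta> x \<noteq> 0})"
    by (metis bounded_cball bounded_subset closed_closure compact_eq_bounded_closed)
  then have "(\<integral>x. u x *\<^sub>R G x \<partial>lebesgue) = - (\<integral>x. \<eta> x *\<^sub>R V x \<partial>lebesgue)"
    using wg bump_smooth[OF \<eta>] G unfolding has_weak_gradient_def by blast
  then have "(\<integral>x. u x *\<^sub>R G x \<partial>lebesgue) \<bullet> b = - ((\<integral>x. \<eta> x *\<^sub>R V x \<partial>lebesgue) \<bullet> b)" by simp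
  also have "(\<integral>x. u x *\<^sub>R G x \<partial>lebesgue) \<bullet> b = (\<integral>x. (u x *\<^sub>R G x) \<bullet> b \<partial>lebesgue)"
    by (rule integral_inner_left[symmetric]) (rule i1)
  also have "\<dots> = (\<integral>x. u x * (G x \<bullet> b) \<partial>lebesgue)" by simp
  also have "\<dots> = (LBINT z. u' z * (G z \<bullet> b))"
  proof (rule lebesgue_integral_eq_lborel)
    show "AE x in lborel. u x * (G x \<bullet> b) = u' x * (G x \<bullet> b)" using u'(2) by eventually_elim simp
  qed (use u' um in measurable)
  also have "(\<integral>x. \<eta> x *\<^sub>R V x \<partial>lebesgue) \<bullet> b = (\<integral>x. (\<eta> x *\<^sub>R V x) \<bullet> b \<partial>lebesgue)"
    by (rule integral_inner_left[symmetric]) (rule i2)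
  also have "\<dots> = (\<integral>x. \<eta> x * (V x \<bullet> b) \<partial>lebesgue)" by simp
  also have "\<dots> = (LBINT z. \<eta> z * (V' z \<bullet> b))"
  proof (rule lebesgue_integral_eq_lborel)
    show "AE x in lborel. \<eta> x * (V x \<bullet> b) = \<eta> x * (V' x \<bullet> b)" using V'(2) by eventually_elim simp
  qed (use V' Vm in measurable)
  finally show ?thesis .
qed

text \<open>At a point at positive distance from K, a mollifier of small radius meets only places
  where u vanishes. By the weak gradient identity the mollification of V is 0 there, and
  \<open>AE_zero_if_convol_zero\<close> applies.\<close>

lemma weak_gradient_zero_outside:
  fixes u :: "'a::euclidean_space \<Rightarrow> real" and V :: "'a \<Rightarrow> 'a"
  assumes K: "closed K" and u0: "\<And>x. x \<notin> K \<Longrightarrow> u x = 0"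
    and V: "\<And>C b. compact C \<Longrightarrow> sq_integrable (\<lambda>x. indicator C x * (V x \<bullet> b))"
    and wg: "\<And>y \<epsilon> \<eta> G b. bump y \<epsilon> \<eta> \<Longrightarrow> (\<And>z. GDERIV \<eta> z :> G z) \<Longrightarrow>
      (LBINT z. u z * (G z \<bullet> b)) = - (LBINT z. \<eta> z * (V z \<bullet> b))"
  shows "AE x in lborel. x \<notin> K \<longrightarrow> V x = 0"
proof -
  \<comment> \<open>An exhaustion of the complement of K by sets on which a single index j makes all
    mollifiers with k \<ge> j avoid K.\<close>
  define S where "S j = ball (0::'a) (Suc j) \<inter> {x. \<forall>y\<in>K. 1 / Suc j \<le> dist x y}" for j
  have Sb: "S j \<in> sets borel" for j
  proof -
    have "closed (\<Inter>y\<in>K. {x. 1 / Suc j \<le> dist x y})"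
      by (intro closed_INT ballI closed_Collect_le continuous_intros)
    also have "(\<Inter>y\<in>K. {x. 1 / Suc j \<le> dist x y}) = {x. \<forall>y\<in>K. 1 / Suc j \<le> dist x y}" by auto
    finally show ?thesis unfolding S_def by (intro sets.Int) auto
  qed
  have S: "x \<notin> K \<Longrightarrow> \<exists>j. x \<in> S j" for x
  proof -
    assume "x \<notin> K"
    then obtain d where d: "d > 0" "ball x d \<subseteq> - K" using K by (metis ComplI open_Compl open_contains_ball)
    obtain N where N: "norm x < real N" using reals_Archimedean2 by blast
    obtain M where M: "inverse (real (Suc M)) < d" using reals_Archimedean[OF d(1)] by blast
    have "x \<in> S (max N M)"
    proof -
      have "1 / real (Suc (max N M)) \<le> inverse (real (Suc M))" by (simp add: field_simps)
      then have "1 / real (Suc (max N M)) < d" using M by linarith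
      moreover have "dist x y \<ge> d" if "y \<in> K" for y using d(2) that by (meson ComplD in_mono linorder_not_less mem_ball)
      ultimately show ?thesis using N by (force simp: S_def)
    qed
    then show "\<exists>j. x \<in> S j" by blast
  qed
  have AEb: "AE x in lborel. x \<in> S j \<longrightarrow> V x \<bullet> b = 0" if "b \<in> Basis" for j b
  proof -
    \<comment> \<open>V is square-integrable only locally, so it is cut off. The radius j + 2
      exceeds that of the ball in \<open>S j\<close> by 1, the largest radius of a mollifier, so the
      cut-off is invisible to the convolution on \<open>S j\<close>.\<close>
    define F where "F x = indicator (cball 0 (j + 2)) x * (V x \<bullet> b)" for x :: 'a
    have "AE x in lborel. x \<in> S j \<longrightarrow> F x = 0"
    proof (rule AE_zero_if_convol_zero[OF _ Sb])
      show "sq_integrable F" unfolding F_def[abs_def] by (rule V[OF compact_cball])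
      fix k x assume k: "k \<ge> j" and x: "x \<in> S j"
      have kj: "1 / real (Suc k) \<le> 1 / real (Suc j)" using k by (simp add: field_simps)
      obtain G where G: "\<And>z. GDERIV (mollifier k) z :> (G z :: 'a)" "\<And>b. bump 0 (1 / Suc k) (\<lambda>z. G z \<bullet> b)"
        using bump_gradient[OF mollifier_bump] by blast
      obtain G' where G': "\<And>z. GDERIV (\<lambda>y. mollifier k (x - y)) z :> G' z" "\<And>b. bump x (1 / Suc k) (\<lambda>z. G' z \<bullet> b)"
        using bump_gradient[OF bump_reflect[OF mollifier_bump]] by blast
      have "convol (mollifier k) F x = (LBINT y. mollifier k (x - y) * (V y \<bullet> b))"
        unfolding convol_def
      proof (rule Bochner_Integration.integral_cong[OF refl])
        fix y
        show "mollifier k (x - y) * F y = mollifier k (x - y) * (V y \<bullet> b)"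
        proof (cases "1 / Suc k \<le> norm (x - y)")
          case False
          have "norm y \<le> norm x + norm (x - y)" using norm_triangle_sub[of y x] by (simp add: norm_minus_commute)
          moreover have "norm x < Suc j" using x by (simp add: S_def)
          moreover have "norm (x - y) \<le> 1" using False by (smt (verit) divide_le_eq_1 of_nat_0_le_iff of_nat_Suc)
          ultimately show ?thesis by (simp add: F_def)
        qed (use mollifier_zero[of k "x - y"] in simp)
      qed
      also have "\<dots> = - (LBINT y. u y * (G' y \<bullet> b))"
        using wg[OF bump_reflect[OF mollifier_bump] G'(1)] by simp
      also have "(\<lambda>y. u y * (G' y \<bullet> b)) = (\<lambda>y. 0)"
      proof (rule ext)
        fix y
        show "u y * (G' y \<bullet> b) = 0"
        proof (cases "y \<in> K")
          case True
          then have "1 / Suc j \<le> dist x y" using x by (simp add: S_def)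
          then have "\<bar>1 / Suc k\<bar> \<le> norm (y - x)" using kj by (simp add: dist_norm norm_minus_commute)
          from bump_zero[OF G'(2) this] show ?thesis by simp
        qed (simp add: u0)
      qed
      finally show "convol (mollifier k) F x = 0" by simp
    qed
    then show ?thesis
    proof eventually_elim
      case (elim x)
      show ?case
      proof
        assume x: "x \<in> S j"
        then have "x \<in> cball 0 (j + 2)" by (simp add: S_def)
        then show "V x \<bullet> b = 0" using elim x by (simp add: F_def)
      qed
    qed
  qed
  have "AE x in lborel. \<forall>b\<in>Basis. \<forall>j\<in>UNIV. x \<in> S j \<longrightarrow> V x \<bullet> b = 0"
    by (intro AE_finite_allI finite_Basis AE_ball_countable' AEb) auto
  then show ?thesis
  proof eventually_elim
    case (elim x)
    show ?case
    proof
      assume "x \<notin> K"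
      then obtain j where "x \<in> S j" using S by blast
      then have "\<forall>b\<in>Basis. V x \<bullet> b = 0" using elim by blast
      then show "V x = 0" by (simp only: euclidean_all_zero_iff)
    qed
  qed
qed

lemma sqrt_powr_mult:
  assumes "x \<ge> 0" "y \<ge> 0" "t > 0" "t ^ k * x \<le> c * y" "c \<ge> 0"
  shows "t powr (real k / 2) * sqrt x \<le> sqrt c * sqrt y"
proof -
  have "t powr (real k / 2) = (t powr real k) powr (1 / 2)" by (simp add: powr_powr)
  also have "\<dots> = sqrt (t ^ k)" using assms(3) by (simp add: powr_half_sqrt powr_realpow)
  finally have "t powr (real k / 2) * sqrt x = sqrt (t ^ k * x)" by (simp add: real_sqrt_mult)
  also have "\<dots> \<le> sqrt (c * y)" using assms(4) by (rule real_sqrt_le_mono)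
  finally show ?thesis by (simp add: real_sqrt_mult)
qed

text \<open>The three terms on the left are bounded separately, by \<open>sqrt 10\<close>,
  \<open>sqrt (30 / a)\<close> and 1 times the square root of the energy integral of g; the constant
  is their sum.\<close>

theorem carleman_estimate:
  fixes u g :: "'a::euclidean_space \<Rightarrow> real" and Du :: "'a \<Rightarrow> 'a"
  assumes q: "1 \<le> q" "q < 2" and r1: "0 < r1" and g: "in_L2 g" and uH: "in_H1_loc u Du"
    and sol: "weak_solution q g u Du" and supp: "ess_support u \<subseteq> ball 0 1 - closure (ball 0 r1)"
    and a: "a = (2 - q) / q" and \<tau>: "4 + 2 / a + DIM('a) \<le> \<tau>"
  shows "ennreal (\<tau> powr (3/2)) *
           L2_norm (\<lambda>x. exp (\<tau> * carleman_phi x) * (1 + (ln (norm x))\<^sup>2) powr (-1/2) * u x)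
         + ennreal (\<tau> powr (1/2)) *
           L2_norm (\<lambda>x. (exp (\<tau> * carleman_phi x) * norm x * (1 + (ln (norm x))\<^sup>2) powr (-1/2))
                         *\<^sub>R Du x)
         + ennreal (((2 - q) / q) powr (1/2) * \<tau>) *
           L2_norm (\<lambda>x. exp (\<tau> * carleman_phi x) * norm x * \<bar>u x\<bar> powr (q/2))
         \<le> ennreal (1 + sqrt 10 + sqrt (30 / a)) * L2_norm (\<lambda>x. exp (\<tau> * carleman_phi x) * (norm x)\<^sup>2 * g x)"
proof -
  define K where "K = ess_support u"
  have Kc: "closed K" unfolding K_def by (rule ess_support_closed)
  have cl: "closure (ball (0::'a) r1) = cball 0 r1" using r1 by simp
  have Kann: "K \<subseteq> ball 0 1 - cball 0 r1" using supp unfolding K_def cl .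
  have K: "compact K" using Kann Kc by (metis Diff_subset bounded_ball bounded_subset compact_eq_bounded_closed subset_trans)
  have KB[measurable]: "K \<in> sets borel" using Kc by simp
  \<comment> \<open>The support K is a compact subset of the open annulus, so the closed annulus C
    leaves the margin required for mollification.\<close>
  define C where "C = cball (0::'a) 1 - ball 0 r1"
  have C: "compact C" unfolding C_def by (intro compact_diff) auto
  have um: "u \<in> borel_measurable lebesgue" and Dm: "Du \<in> borel_measurable lebesgue" and gm: "g \<in> borel_measurable lebesgue"
    using uH g by (auto simp: in_H1_loc_def in_L2_loc_def in_L2_def)
  obtain u1 where u1: "u1 \<in> borel_measurable borel" "AE x in lborel. u x = u1 x" using borel_representative[OF um] by blast
  obtain V1 where V1: "V1 \<in> borel_measurable borel" "AE x in lborel. Du x = V1 x" using borel_representative_vector[OF Dm] by blast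
  obtain g0 where g0: "g0 \<in> borel_measurable borel" "AE x in lborel. g x = g0 x" using borel_representative[OF gm] by blast
  \<comment> \<open>Cutting off at K turns vanishing almost everywhere into vanishing at every
    point, as the locale demands. That \<open>V0\<close> still represents \<open>Du\<close> is only
    known after \<open>V10\<close>.\<close>
  define u0 where "u0 x = indicator K x * u1 x" for x
  define V0 where "V0 x = indicator K x *\<^sub>R V1 x" for x
  have u0m: "u0 \<in> borel_measurable borel" unfolding u0_def[abs_def] using u1(1) by measurable
  have V0m: "V0 \<in> borel_measurable borel" unfolding V0_def[abs_def] using V1(1) by measurable
  have uu0: "AE x in lborel. u x = u0 x"
  proof -
    have "AE x in lborel. x \<notin> K \<longrightarrow> u x = 0"
      using AE_zero_outside_ess_support[of u] unfolding K_def AE_completion_iff .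
    with u1(2) show ?thesis by eventually_elim (auto simp: u0_def indicator_def)
  qed
  have wg: "has_weak_gradient u Du" using uH by (simp add: in_H1_loc_def)
  have W1: "(LBINT z. u0 z * (G z \<bullet> b)) = - (LBINT z. \<eta> z * (V1 z \<bullet> b))"
    if "bump y \<epsilon> \<eta>" "\<And>z. GDERIV \<eta> z :> G z" for y \<epsilon> \<eta> G b
    by (rule has_weak_gradient_bump[OF wg um Dm u0m uu0 V1 that])
  have V1_L2: "sq_integrable (\<lambda>x. indicator C x * (V1 x \<bullet> b))" if "compact C" "norm b \<le> 1" for C b
  proof (rule sq_integrable_representative)
    have "C \<in> sets borel" using that(1) by (simp add: compact_imp_closed)
    then show "(\<lambda>x. indicator C x * (V1 x \<bullet> b)) \<in> borel_measurable borel" using V1(1) by measurable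
    show "AE x in lborel. \<bar>indicator C x * (V1 x \<bullet> b)\<bar> \<le> norm (indicator C x *\<^sub>R Du x)"
      using V1(2)
    proof eventually_elim
      case (elim x)
      have "\<bar>V1 x \<bullet> b\<bar> \<le> norm (V1 x) * norm b" by (rule Cauchy_Schwarz_ineq2)
      also have "\<dots> \<le> norm (V1 x)" using that(2) by (simp add: mult_left_le)
      finally show ?case using elim by (auto simp: indicator_def)
    qed
    show "L2_norm (\<lambda>x. indicator C x *\<^sub>R Du x) < \<infinity>" using uH that(1) by (simp add: in_H1_loc_def in_L2_loc_def)
  qed
  have V1_L2': "sq_integrable (\<lambda>x. indicator C x * (V1 x \<bullet> b))" if "compact C" for C b
  proof -
    \<comment> \<open>Scaling reduces an arbitrary b to norm at most 1. For b = 0 the scaled vector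
      is 0, since the inverse of 0 is 0.\<close>
    have "sq_integrable (\<lambda>x. norm b * (indicator C x * (V1 x \<bullet> (b /\<^sub>R norm b))))"
      by (rule sq_integrable_cmult[OF V1_L2[OF that]]) (cases "b = 0"; simp)
    moreover have "(\<lambda>x. norm b * (indicator C x * (V1 x \<bullet> (b /\<^sub>R norm b)))) = (\<lambda>x. indicator C x * (V1 x \<bullet> b))"
      by (cases "b = 0") (auto simp: fun_eq_iff)
    ultimately show ?thesis by (simp only:)
  qed
  have V10: "AE x in lborel. V1 x = V0 x"
  proof -
    have "AE x in lborel. x \<notin> K \<longrightarrow> V1 x = 0"
      by (rule weak_gradient_zero_outside[OF Kc _ V1_L2' W1]) (auto simp: u0_def)
    then show ?thesis by eventually_elim (auto simp: V0_def indicator_def)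
  qed
  have V0: "AE x in lborel. Du x = V0 x" using V1(2) V10 by eventually_elim simp
  have su: "sq_integrable u0"
  proof (rule sq_integrable_representative[OF u0m])
    show "AE x in lborel. \<bar>u0 x\<bar> \<le> norm (indicator K x *\<^sub>R u x)"
      using uu0 by eventually_elim (auto simp: u0_def indicator_def)
    show "L2_norm (\<lambda>x. indicator K x *\<^sub>R u x) < \<infinity>" using uH K by (simp add: in_H1_loc_def in_L2_loc_def)
  qed
  have sg: "sq_integrable g0"
  proof (rule sq_integrable_representative[OF g0(1)])
    show "AE x in lborel. \<bar>g0 x\<bar> \<le> norm (g x)" using g0(2) by eventually_elim simp
  qed (use g in \<open>simp add: in_L2_def\<close>)
  have sf: "sq_integrable (\<lambda>x. fq q (u0 x))"
    by (rule sq_integrable_fq_compact_support[OF q K su]) (simp add: u0_def)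
  define h where "h x = g0 x - fq q (u0 x)" for x
  interpret weak_poisson_annular u0 V0 h C
  proof unfold_locales
    show "sq_integrable u0" by fact
    show "sq_integrable (\<lambda>x. V0 x \<bullet> b)" for b using V1_L2'[OF K] by (simp add: V0_def)
    show "sq_integrable h" unfolding h_def[abs_def] by (rule sq_integrable_diff[OF sg sf])
    show "compact C" by fact
    show "0 \<notin> C" using r1 by (simp add: C_def)
    show "\<exists>\<delta>>0. \<forall>x y. x \<notin> C \<longrightarrow> dist x y < \<delta> \<longrightarrow> u0 y = 0 \<and> V0 y = 0"
    proof -
      obtain d where d: "d > 0" "(\<Union>x\<in>K. ball x d) \<subseteq> ball 0 1 - cball 0 r1"
        using compact_subset_open_imp_ball_epsilon_subset[OF K _ Kann] by (metis closed_cball open_Diff open_ball)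
      have "y \<notin> K" if "x \<notin> C" "dist x y < d" for x y
      proof
        assume "y \<in> K"
        then have "x \<in> ball 0 1 - cball 0 r1" using d(2) that(2) by (force simp: dist_commute)
        then show False using that(1) by (auto simp: C_def)
      qed
      then show ?thesis using d(1) by (intro exI[of _ d]) (simp add: u0_def V0_def)
    qed
    show "(LBINT z. u0 z * (G z \<bullet> b)) = - (LBINT z. \<eta> z * (V0 z \<bullet> b))"
      if "bump y \<epsilon> \<eta>" "\<And>z. GDERIV \<eta> z :> G z" for y \<epsilon> \<eta> G b
      by (rule has_weak_gradient_bump[OF wg um Dm u0m uu0 V0m V0 that])
    show "(LBINT z. V0 z \<bullet> G z) = - (LBINT z. h z * \<eta> z)"
      if \<eta>: "bump y \<epsilon> \<eta>" and G: "\<And>z. GDERIV \<eta> z :> G z" for y \<epsilon> \<eta> G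
    proof -
      have \<eta>m[measurable]: "\<eta> \<in> borel_measurable borel" by (rule bump_measurable[OF \<eta>])
      have cG: "continuous_on UNIV G" by (rule smooth_gradient_continuous[OF bump_smooth[OF \<eta>] G])
      have Gm[measurable]: "G \<in> borel_measurable borel" by (rule borel_measurable_continuous_onI[OF cG])
      have lm[measurable]: "\<eta> \<in> borel_measurable lebesgue" "G \<in> borel_measurable lebesgue"
        "fq q \<in> borel_measurable borel"
        by (auto intro: measurable_completion)
      \<comment> \<open>The bump is an admissible test function; moving the nonlinear term to the
        right gives the Poisson equation with right-hand side \<open>h\<close>.\<close>
      have "- (\<integral>x. Du x \<bullet> G x \<partial>lebesgue) + (\<integral>x. fq q (u x) * \<eta> x \<partial>lebesgue) = (\<integral>x. g x * \<eta> x \<partial>lebesgue)"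
        using sol bump_in_H1[OF \<eta> G] unfolding weak_solution_def by blast
      moreover have "(\<integral>x. Du x \<bullet> G x \<partial>lebesgue) = (LBINT x. V0 x \<bullet> G x)"
      proof (rule lebesgue_integral_eq_lborel)
        show "AE x in lborel. Du x \<bullet> G x = V0 x \<bullet> G x" using V0 by eventually_elim simp
      qed (use V0m Dm in measurable)
      moreover have "(\<integral>x. fq q (u x) * \<eta> x \<partial>lebesgue) = (LBINT x. fq q (u0 x) * \<eta> x)"
      proof (rule lebesgue_integral_eq_lborel)
        show "AE x in lborel. fq q (u x) * \<eta> x = fq q (u0 x) * \<eta> x" using uu0 by eventually_elim simp
      qed (use u0m um in measurable)
      moreover have "(\<integral>x. g x * \<eta> x \<partial>lebesgue) = (LBINT x. g0 x * \<eta> x)"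
      proof (rule lebesgue_integral_eq_lborel)
        show "AE x in lborel. g x * \<eta> x = g0 x * \<eta> x" using g0(2) by eventually_elim simp
      qed (use g0 gm in measurable)
      moreover have "(LBINT z. h z * \<eta> z) = (LBINT x. g0 x * \<eta> x) - (LBINT x. fq q (u0 x) * \<eta> x)"
        using sq_integrable_mult[OF sg bump_integrable(2)[OF \<eta>]] sq_integrable_mult[OF sf bump_integrable(2)[OF \<eta>]]
        by (simp add: h_def left_diff_distrib)
      ultimately show ?thesis by simp
    qed
  qed
  have C1: "norm x \<le> 1" if "x \<in> C" for x using that by (simp add: C_def)
  note est = carleman_weighted[OF q sg h_def C1 a \<tau>]
  define w where "w x = weight \<tau> (ln (norm x))" for x :: 'a
  define l2 where "l2 x = 1 + (ln (norm x))\<^sup>2" for x :: 'a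
  have l2: "l2 x > 0" for x using one_plus_square_pos by (simp add: l2_def)
  have wC: "w x = (exp (\<tau> * carleman_phi x))\<^sup>2" if "x \<in> C" for x
    unfolding w_def by (rule weight_eq) (use that C0 in auto)
  have l2C: "(l2 x powr (- (1/2)))\<^sup>2 = 1 / l2 x" for x
    using l2[of x] by (simp add: powr_minus_divide power2_eq_square powr_add[symmetric])
  have w0: "w x \<ge> 0" for x using weight_pos[of \<tau>] by (simp add: w_def less_imp_le)
  define R where "R = (LBINT x. indicator C x * (w x * ((norm x)\<^sup>2 * g0 x)\<^sup>2))"
  define I1 where "I1 = (LBINT x. indicator C x * (w x / l2 x * (u0 x)\<^sup>2))"
  define I2 where "I2 = (LBINT x. indicator C x * (w x * (norm x)\<^sup>2 / l2 x * (V0 x \<bullet> V0 x)))"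
  define I3 where "I3 = (LBINT x. indicator C x * (w x * (norm x)\<^sup>2 * \<bar>u0 x\<bar> powr q))"
  note est' = est[folded w_def l2_def, folded R_def I1_def I2_def I3_def]
  have I0: "I1 \<ge> 0" "I2 \<ge> 0" "I3 \<ge> 0" "R \<ge> 0"
    unfolding I1_def I2_def I3_def R_def using w0 l2
    by (auto intro!: Bochner_Integration.integral_nonneg mult_nonneg_nonneg divide_nonneg_nonneg simp: less_imp_le)
  have N1: "L2_norm (\<lambda>x. exp (\<tau> * carleman_phi x) * (1 + (ln (norm x))\<^sup>2) powr (-1/2) * u x) = ennreal (sqrt I1)"
    unfolding I1_def l2_def[symmetric]
  proof (rule L2_norm_eq[OF _ est'(1)])
    show "AE x in lborel. (norm (exp (\<tau> * carleman_phi x) * l2 x powr (-1/2) * u x))\<^sup>2 = indicator C x * (w x / l2 x * (u0 x)\<^sup>2)"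
      using uu0
    proof eventually_elim
      case (elim x)
      show ?case
      proof (cases "x \<in> C")
        case True
        then show ?thesis by (simp add: elim power_mult_distrib l2C wC)
      qed (use elim support(1)[of x] in simp)
    qed
  qed (use w0 l2 in \<open>auto simp: less_imp_le\<close>)
  have N2: "L2_norm (\<lambda>x. (exp (\<tau> * carleman_phi x) * norm x * (1 + (ln (norm x))\<^sup>2) powr (-1/2)) *\<^sub>R Du x) = ennreal (sqrt I2)"
    unfolding I2_def l2_def[symmetric]
  proof (rule L2_norm_eq[OF _ est'(3)])
    show "AE x in lborel. (norm ((exp (\<tau> * carleman_phi x) * norm x * l2 x powr (-1/2)) *\<^sub>R Du x))\<^sup>2
        = indicator C x * (w x * (norm x)\<^sup>2 / l2 x * (V0 x \<bullet> V0 x))"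
      using V0
    proof eventually_elim
      case (elim x)
      show ?case
      proof (cases "x \<in> C")
        case True
        then show ?thesis by (simp add: elim power_mult_distrib l2C wC power2_norm_eq_inner[of "V0 x"])
      qed (use elim support(2)[of x] in simp)
    qed
  qed (use w0 l2 in \<open>auto simp: less_imp_le\<close>)
  have N3: "L2_norm (\<lambda>x. exp (\<tau> * carleman_phi x) * norm x * \<bar>u x\<bar> powr (q/2)) = ennreal (sqrt I3)"
    unfolding I3_def
  proof (rule L2_norm_eq[OF _ est'(5)])
    show "AE x in lborel. (norm (exp (\<tau> * carleman_phi x) * norm x * \<bar>u x\<bar> powr (q/2)))\<^sup>2
        = indicator C x * (w x * (norm x)\<^sup>2 * \<bar>u0 x\<bar> powr q)"
      using uu0
    proof eventually_elim
      case (elim x)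
      have "(\<bar>u0 x\<bar> powr (q/2))\<^sup>2 = \<bar>u0 x\<bar> powr q" by (simp add: power2_eq_square powr_add[symmetric])
      then show ?case
        using elim support(1)[of x] by (cases "x \<in> C") (simp_all add: power_mult_distrib wC)
    qed
  qed (use w0 in auto)
  have NR: "ennreal (sqrt R) \<le> L2_norm (\<lambda>x. exp (\<tau> * carleman_phi x) * (norm x)\<^sup>2 * g x)"
    unfolding R_def
  proof (rule L2_norm_ge)
    show "AE x in lborel. indicator C x * (w x * ((norm x)\<^sup>2 * g0 x)\<^sup>2) \<le> (norm (exp (\<tau> * carleman_phi x) * (norm x)\<^sup>2 * g x))\<^sup>2"
      using g0(2)
    proof eventually_elim
      case (elim x)
      then show ?case by (cases "x \<in> C") (simp_all add: power_mult_distrib wC)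
    qed
    have "continuous_on C (\<lambda>x. w x * ((norm x)\<^sup>2)\<^sup>2)"
      unfolding w_def by (intro continuous_intros radial_continuous drift_continuous)
    from integrable_coefficient[OF C this sg sg]
    show "integrable lborel (\<lambda>x. indicator C x * (w x * ((norm x)\<^sup>2 * g0 x)\<^sup>2))"
      by (simp add: power_mult_distrib power2_eq_square[of "g0 _"] mult.assoc)
  qed (use w0 in auto)
  have a0: "0 < a" using q by (simp add: a)
  have \<tau>0: "\<tau> > 0" using \<tau> a0 DIM_positive[where 'a='a] by (smt (verit) divide_pos_pos of_nat_0_le_iff)
  have B1: "\<tau> powr (3/2) * sqrt I1 \<le> sqrt 10 * sqrt R"
    using sqrt_powr_mult[OF I0(1) I0(4) \<tau>0, of 3 10] est'(2) by simp
  have B2: "\<tau> powr (1/2) * sqrt I2 \<le> sqrt (30 / a) * sqrt R"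
    using sqrt_powr_mult[OF I0(2) I0(4) \<tau>0, of 1 "30 / a"] est'(4) a0 by simp
  have B3: "((2 - q) / q) powr (1/2) * \<tau> * sqrt I3 \<le> 1 * sqrt R"
  proof -
    have "((2 - q) / q) powr (1/2) * \<tau> * sqrt I3 = sqrt (a * \<tau>\<^sup>2 * I3)"
      using a0 \<tau>0 by (simp add: a[symmetric] powr_half_sqrt real_sqrt_mult)
    also have "\<dots> \<le> sqrt R" using est'(6) by simp
    finally show ?thesis by simp
  qed
  \<comment> \<open>The three norms on the left are finite by \<open>N1\<close>, \<open>N2\<close>
    and \<open>N3\<close>, so the extended sum can be collected into one real number.\<close>
  have "ennreal (\<tau> powr (3/2)) * ennreal (sqrt I1) + ennreal (\<tau> powr (1/2)) * ennreal (sqrt I2)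
      + ennreal (((2 - q) / q) powr (1/2) * \<tau>) * ennreal (sqrt I3)
    = ennreal (\<tau> powr (3/2) * sqrt I1 + \<tau> powr (1/2) * sqrt I2 + ((2 - q) / q) powr (1/2) * \<tau> * sqrt I3)"
    using I0 \<tau>0 by (simp add: ennreal_mult[symmetric] ennreal_plus[symmetric] del: ennreal_plus)
  also have "\<dots> \<le> ennreal ((1 + sqrt 10 + sqrt (30 / a)) * sqrt R)"
    using B1 B2 B3 by (intro ennreal_leI) (simp add: algebra_simps)
  also have "\<dots> = ennreal (1 + sqrt 10 + sqrt (30 / a)) * ennreal (sqrt R)"
    using a0 I0 by (intro ennreal_mult) auto
  also have "\<dots> \<le> ennreal (1 + sqrt 10 + sqrt (30 / a)) * L2_norm (\<lambda>x. exp (\<tau> * carleman_phi x) * (norm x)\<^sup>2 * g x)"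
    by (intro mult_left_mono NR) auto
  finally show ?thesis unfolding N1 N2 N3 .
qed

theorem theorem2:
  fixes q :: real
  assumes "1 \<le> q" and "q < 2"
  shows "\<exists>\<tau>0>1. \<exists>C>1.
    \<forall>(r1::real) (g :: real ^ 'n \<Rightarrow> real) (u :: real ^ 'n \<Rightarrow> real) (Du :: real ^ 'n \<Rightarrow> real ^ 'n).
      0 < r1 \<longrightarrow> r1 < 1/2 \<longrightarrow> in_L2 g \<longrightarrow> in_H1_loc u Du \<longrightarrow> in_Linf_loc u \<longrightarrow>
      weak_solution q g u Du \<longrightarrow>
      ess_support u \<subseteq> ball 0 1 - closure (ball 0 r1) \<longrightarrow>
      (\<forall>\<tau>\<ge>\<tau>0.
         ennreal (\<tau> powr (3/2)) *
           L2_norm (\<lambda>x. exp (\<tau> * carleman_phi x) * (1 + (ln (norm x))\<^sup>2) powr (-1/2) * u x)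
         + ennreal (\<tau> powr (1/2)) *
           L2_norm (\<lambda>x. (exp (\<tau> * carleman_phi x) * norm x * (1 + (ln (norm x))\<^sup>2) powr (-1/2))
                         *\<^sub>R Du x)
         + ennreal (((2 - q) / q) powr (1/2) * \<tau>) *
           L2_norm (\<lambda>x. exp (\<tau> * carleman_phi x) * norm x * \<bar>u x\<bar> powr (q/2))
         \<le> ennreal C * L2_norm (\<lambda>x. exp (\<tau> * carleman_phi x) * (norm x)\<^sup>2 * g x))"
proof -
  define a where "a = (2 - q) / q"
  have a: "a > 0" using assms by (simp add: a_def)
  show ?thesis
  \<comment> \<open>Both witnesses depend on n and q only, through \<open>a\<close> and the
    dimension; they are fixed before r1, g and u.\<close>
  proof (rule exI[of _ "4 + 2 / a + DIM(real ^ 'n)"], rule conjI,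
      rule_tac [2] exI[of _ "1 + sqrt 10 + sqrt (30 / a)"], rule_tac [2] conjI)
    show "1 < 4 + 2 / a + DIM(real ^ 'n)" using a by (simp add: add_pos_nonneg)
    show "1 < 1 + sqrt 10 + sqrt (30 / a)" using a by (simp add: add_pos_nonneg)
  qed (intro allI impI carleman_estimate[OF assms _ _ _ _ _ a_def])
qed

end
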